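(* Let $H$ be a finitely generated strongly verbally closed group whose central quotient $H/Z(H)$ satisfies the maximality condition for direct factors (or, equivalently, $H/Z(H)$ decomposes into a finite direct product of indecomposable groups). Then the centre $Z(H)$ is a pure subgroup of $H$. In particular, the centre of any finitely generated solvable strongly verbally closed group is pure.
   Context: A subgroup $H$ of a group $G$ is verbally closed in $G$ if every equation of the form $w(x_1,\dots,x_r)=h$, where $w$ is an element of the free group $F(x_1,\dots,x_r)$ and $h\in H$, has a solution in $G$ if and only if it has a solution in $H$. A subgroup $H$ of $G$ is algebraically closed in $G$ if every finite system of equations $\{w_1(x_1,\dots,x_r)=1,\dots,w_m(x_1,\dots,x_r)=1\}$ with coefficients from $H$, i.e. with $w_i\in H*F(x_1,\dots,x_r)$ (free product), has a solution in $G$ if and only if it has a solution in $H$. A group $H$ is strongly verbally closed if it is algebraically closed in every group containing $H$ as a verbally closed subgroup. A subgroup $B$ of a group $A$ is pure if for every integer $n$ and every $b\in B$, the element $b$ is an $n$th power of an element of $A$ if and only if it is an $n$th power of an element of $B$. A group satisfies the maximality condition for direct factors if it has no infinite strictly ascending chain of direct factors. A nontrivial group is indecomposable if it is not the direct product of two nontrivial subgroups; the trivial group is regarded as the empty direct product. *)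

theory Defs
  imports "HOL-Algebra.Algebra"
begin

section \<open>Words and equations over groups\<close>

text \<open>
  An element of the free product \<open>A * F(x\<^sub>0, \<dots>, x\<^sub>r\<^sub>-\<^sub>1)\<close> is given by a word, i.e. a list of
  letters \<open>Coeff a\<close> (with \<open>a \<in> A\<close>), \<open>Var i\<close> (for \<open>x\<^sub>i\<close>) and \<open>InvVar i\<close> (for the inverse of \<open>x\<^sub>i\<close>),
  where \<open>i < r\<close>.  Words need not be reduced: every element of the free product is represented by
  some word, and the value of a word under an assignment of the variables depends only on the
  element that it represents (see \<open>word_val_relations\<close> below).  For \<open>A = {}\<close> the words are those of
  the free group \<open>F(x\<^sub>0, \<dots>, x\<^sub>r\<^sub>-\<^sub>1)\<close>.
\<close>

datatype 'a letter = Coeff 'a | Var nat | InvVar nat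

definition letters :: "'a set \<Rightarrow> nat \<Rightarrow> 'a letter set" where
  "letters A r = Coeff ` A \<union> Var ` {..<r} \<union> InvVar ` {..<r}"

definition words :: "'a set \<Rightarrow> nat \<Rightarrow> 'a letter list set" where
  "words A r = lists (letters A r)"

fun letter_val :: "('a, 'b) monoid_scheme \<Rightarrow> (nat \<Rightarrow> 'a) \<Rightarrow> 'a letter \<Rightarrow> 'a" where
  "letter_val G x (Coeff a) = a"
| "letter_val G x (Var i) = x i"
| "letter_val G x (InvVar i) = inv\<^bsub>G\<^esub> (x i)"

fun word_val :: "('a, 'b) monoid_scheme \<Rightarrow> (nat \<Rightarrow> 'a) \<Rightarrow> 'a letter list \<Rightarrow> 'a" where
  "word_val G x [] = \<one>\<^bsub>G\<^esub>"
| "word_val G x (l # w) = letter_val G x l \<otimes>\<^bsub>G\<^esub> word_val G x w"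


section \<open>Verbally, algebraically and strongly verbally closed groups\<close>

definition verbally_closed_subgroup :: "'a set \<Rightarrow> ('a, 'b) monoid_scheme \<Rightarrow> bool" where
  "verbally_closed_subgroup H G \<longleftrightarrow> subgroup H G \<and>
     (\<forall>r. \<forall>w \<in> words {} r. \<forall>h \<in> H.
        (\<exists>x \<in> {..<r} \<rightarrow> carrier G. word_val G x w = h) \<longleftrightarrow>
        (\<exists>x \<in> {..<r} \<rightarrow> H. word_val G x w = h))"

definition algebraically_closed_subgroup :: "'a set \<Rightarrow> ('a, 'b) monoid_scheme \<Rightarrow> bool" where
  "algebraically_closed_subgroup H G \<longleftrightarrow> subgroup H G \<and>
     (\<forall>r S. finite S \<and> S \<subseteq> words H r \<longrightarrow>
        (\<exists>x \<in> {..<r} \<rightarrow> carrier G. \<forall>w \<in> S. word_val G x w = \<one>\<^bsub>G\<^esub>) \<longleftrightarrow>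
        (\<exists>x \<in> {..<r} \<rightarrow> H. \<forall>w \<in> S. word_val G x w = \<one>\<^bsub>G\<^esub>))"

text \<open>
  A group containing \<open>H\<close> is a group \<open>G\<close> together with an embedding of \<open>H\<close>.  A definition cannot
  quantify over the type of the elements of \<open>G\<close>; here \<open>G\<close> ranges over the groups whose elements
  have type \<open>'a + nat\<close>.  This is no restriction: theorem
  \<open>strongly_verbally_closedD\<close> below gives the same property for groups \<open>G\<close> over an arbitrary type.
\<close>

definition strongly_verbally_closed :: "('a, 'b) monoid_scheme \<Rightarrow> bool" where
  "strongly_verbally_closed H \<longleftrightarrow> group H \<and>
     (\<forall>(G :: ('a + nat) monoid) f.
        group G \<and> f \<in> mon H G \<and> verbally_closed_subgroup (f ` carrier H) G \<longrightarrow>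
        algebraically_closed_subgroup (f ` carrier H) G)"


section \<open>Centre, purity, direct factors\<close>

definition finitely_generated :: "('a, 'b) monoid_scheme \<Rightarrow> bool" where
  "finitely_generated G \<longleftrightarrow> (\<exists>S. finite S \<and> S \<subseteq> carrier G \<and> generate G S = carrier G)"

definition centre :: "('a, 'b) monoid_scheme \<Rightarrow> 'a set" where
  "centre G = {z \<in> carrier G. \<forall>g \<in> carrier G. z \<otimes>\<^bsub>G\<^esub> g = g \<otimes>\<^bsub>G\<^esub> z}"

definition pure_subgroup :: "'a set \<Rightarrow> ('a, 'b) monoid_scheme \<Rightarrow> bool" where
  "pure_subgroup B A \<longleftrightarrow> subgroup B A \<and>
     (\<forall>n :: int. \<forall>b \<in> B. (\<exists>a \<in> carrier A. a [^]\<^bsub>A\<^esub> n = b) \<longleftrightarrow> (\<exists>c \<in> B. c [^]\<^bsub>A\<^esub> n = b))"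

definition internal_direct_product :: "('a, 'b) monoid_scheme \<Rightarrow> 'a set \<Rightarrow> 'a set \<Rightarrow> bool" where
  "internal_direct_product G A B \<longleftrightarrow>
     A \<lhd> G \<and> B \<lhd> G \<and> A \<inter> B = {\<one>\<^bsub>G\<^esub>} \<and> A <#>\<^bsub>G\<^esub> B = carrier G"

definition direct_factor :: "'a set \<Rightarrow> ('a, 'b) monoid_scheme \<Rightarrow> bool" where
  "direct_factor A G \<longleftrightarrow> (\<exists>B. internal_direct_product G A B)"

definition max_condition_direct_factors :: "('a, 'b) monoid_scheme \<Rightarrow> bool" where
  "max_condition_direct_factors G \<longleftrightarrow>
     \<not> (\<exists>D :: nat \<Rightarrow> 'a set. (\<forall>i. direct_factor (D i) G) \<and> (\<forall>i. D i \<subset> D (Suc i)))"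

definition indecomposable :: "('a, 'b) monoid_scheme \<Rightarrow> bool" where
  "indecomposable G \<longleftrightarrow> group G \<and> carrier G \<noteq> {\<one>\<^bsub>G\<^esub>} \<and>
     \<not> (\<exists>A B. internal_direct_product G A B \<and> A \<noteq> {\<one>\<^bsub>G\<^esub>} \<and> B \<noteq> {\<one>\<^bsub>G\<^esub>})"

text \<open>
  The factors are isomorphic to subgroups of \<open>G\<close>, so it is no restriction that their elements have
  the same type as those of \<open>G\<close>.  For \<open>n = 0\<close> the product is the trivial group.
\<close>

definition finite_product_of_indecomposables :: "('a, 'b) monoid_scheme \<Rightarrow> bool" where
  "finite_product_of_indecomposables G \<longleftrightarrow>
     (\<exists>n (K :: nat \<Rightarrow> 'a monoid).
        (\<forall>i < n. indecomposable (K i)) \<and> product_group {..<n} K \<cong> G)"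


section \<open>Adequacy of the definitions\<close>

lemma letter_val_closed:
  assumes "group G" "l \<in> letters A r" "A \<subseteq> carrier G" "x \<in> {..<r} \<rightarrow> carrier G"
  shows "letter_val G x l \<in> carrier G"
  using assms by (auto simp: letters_def Pi_def group.inv_closed)

lemma word_val_closed:
  assumes "group G" "A \<subseteq> carrier G" "x \<in> {..<r} \<rightarrow> carrier G" "w \<in> words A r"
  shows "word_val G x w \<in> carrier G"
proof -
  interpret group G by fact
  from assms(4) show ?thesis
    by (induction w)
       (auto simp: words_def letter_val_closed[OF assms(1) _ assms(2,3)])
qed

lemma word_val_append:
  assumes "group G" "A \<subseteq> carrier G" "x \<in> {..<r} \<rightarrow> carrier G" "v \<in> words A r" "w \<in> words A r"
  shows "word_val G x (v @ w) = word_val G x v \<otimes>\<^bsub>G\<^esub> word_val G x w"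
proof -
  interpret group G by fact
  have w: "word_val G x w \<in> carrier G"
    using word_val_closed[OF assms(1,2,3,5)] .
  from assms(4) show ?thesis
  proof (induction v)
    case Nil
    then show ?case using w by simp
  next
    case (Cons l v)
    then have "l \<in> letters A r" and v: "v \<in> words A r" by (auto simp: words_def)
    with Cons w show ?case
      using letter_val_closed[OF assms(1) \<open>l \<in> letters A r\<close> assms(2,3)]
            word_val_closed[OF assms(1,2,3) v]
      by (simp add: m_assoc)
  qed
qed

text \<open>
  The value of a word is invariant under the defining relations of \<open>H * F(x\<^sub>0, \<dots>, x\<^sub>r\<^sub>-\<^sub>1)\<close>.
\<close>

lemma word_val_relations:
  assumes "group G" "subgroup H G" "x \<in> {..<r} \<rightarrow> carrier G"
    and uv: "u \<in> words H r" "v \<in> words H r"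
  shows "i < r \<Longrightarrow> word_val G x (u @ [Var i, InvVar i] @ v) = word_val G x (u @ v)"
    and "i < r \<Longrightarrow> word_val G x (u @ [InvVar i, Var i] @ v) = word_val G x (u @ v)"
    and "a \<in> H \<Longrightarrow> b \<in> H \<Longrightarrow>
           word_val G x (u @ [Coeff a, Coeff b] @ v) = word_val G x (u @ [Coeff (a \<otimes>\<^bsub>G\<^esub> b)] @ v)"
    and "word_val G x (u @ [Coeff \<one>\<^bsub>G\<^esub>] @ v) = word_val G x (u @ v)"
proof -
  interpret group G by fact
  interpret H: subgroup H G by fact
  note app = word_val_append[OF assms(1) H.subset assms(3)]
  have cl: "word_val G x u \<in> carrier G" "word_val G x v \<in> carrier G"
    using word_val_closed[OF assms(1) H.subset assms(3)] uv by auto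
  have *: "word_val G x (u @ p @ v) = word_val G x u \<otimes>\<^bsub>G\<^esub> (word_val G x p \<otimes>\<^bsub>G\<^esub> word_val G x v)"
    if "p \<in> words H r" for p
    using that uv app[of p v] app[of u "p @ v"] by (simp add: words_def)
  have **: "word_val G x (u @ v) = word_val G x u \<otimes>\<^bsub>G\<^esub> word_val G x v"
    by (rule app[OF uv])
  show "word_val G x (u @ [Var i, InvVar i] @ v) = word_val G x (u @ v)" if "i < r"
  proof -
    have "[Var i, InvVar i] \<in> words H r" "x i \<in> carrier G"
      using that assms(3) by (auto simp: words_def letters_def)
    then show ?thesis using *[of "[Var i, InvVar i]"] ** cl by simp
  qed
  show "word_val G x (u @ [InvVar i, Var i] @ v) = word_val G x (u @ v)" if "i < r"
  proof -
    have "[InvVar i, Var i] \<in> words H r" "x i \<in> carrier G"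
      using that assms(3) by (auto simp: words_def letters_def)
    then show ?thesis using *[of "[InvVar i, Var i]"] ** cl by simp
  qed
  show "word_val G x (u @ [Coeff a, Coeff b] @ v) = word_val G x (u @ [Coeff (a \<otimes>\<^bsub>G\<^esub> b)] @ v)"
    if "a \<in> H" "b \<in> H"
  proof -
    have "[Coeff a, Coeff b] \<in> words H r" "[Coeff (a \<otimes>\<^bsub>G\<^esub> b)] \<in> words H r"
      using that by (auto simp: words_def letters_def)
    then show ?thesis
      using *[of "[Coeff a, Coeff b]"] *[of "[Coeff (a \<otimes>\<^bsub>G\<^esub> b)]"] cl that by (simp add: m_assoc)
  qed
  show "word_val G x (u @ [Coeff \<one>\<^bsub>G\<^esub>] @ v) = word_val G x (u @ v)"
  proof -
    have "[Coeff \<one>\<^bsub>G\<^esub>] \<in> words H r"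
      by (auto simp: words_def letters_def)
    then show ?thesis using *[of "[Coeff \<one>\<^bsub>G\<^esub>]"] ** cl by simp
  qed
qed

text \<open>Values of words under homomorphisms that are only defined on a subgroup.\<close>

lemma word_val_hom:
  assumes "group G" "group G'" "subgroup K G" "\<phi> \<in> hom (G\<lparr>carrier := K\<rparr>) G'"
    and "A \<subseteq> K" "x \<in> {..<r} \<rightarrow> K" "w \<in> words A r"
  shows "word_val G x w \<in> K \<and>
         word_val G' (\<lambda>i. \<phi> (x i)) (map (map_letter \<phi>) w) = \<phi> (word_val G x w)"
proof -
  interpret group G by fact
  interpret G': group G' by fact
  interpret K: subgroup K G by fact
  interpret GK: group "G\<lparr>carrier := K\<rparr>" using K.subgroup_is_group[OF assms(1)] .
  interpret h: group_hom "G\<lparr>carrier := K\<rparr>" G' \<phi>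
    using assms(4) by unfold_locales
  from assms(7) show ?thesis
  proof (induction w)
    case Nil
    then show ?case using h.hom_one by simp
  next
    case (Cons l w)
    then have l: "l \<in> letters A r" and w: "w \<in> words A r" by (auto simp: words_def)
    have "letter_val G x l \<in> K \<and>
          letter_val G' (\<lambda>i. \<phi> (x i)) (map_letter \<phi> l) = \<phi> (letter_val G x l)"
    proof (cases l)
      case (InvVar i)
      then have "x i \<in> K" using l assms(6) by (auto simp: letters_def)
      then show ?thesis
        using InvVar h.hom_inv[of "x i"] m_inv_consistent[OF assms(3), of "x i"] by simp
    qed (use l assms(5,6) in \<open>auto simp: letters_def\<close>)
    moreover note Cons.IH[OF w]
    ultimately show ?case using h.hom_mult by simp
  qed
qed

lemma map_letter_words:
  assumes "w \<in> words A r" "\<phi> ` A \<subseteq> B"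
  shows "map (map_letter \<phi>) w \<in> words B r"
  using assms by (fastforce simp: words_def letters_def)

lemma ex_inj_list:
  assumes "infinite (UNIV :: 'c set)"
  shows "\<exists>e :: 'c list \<Rightarrow> 'c. inj e"
proof -
  have "|UNIV \<times> UNIV :: ('c \<times> 'c) set| \<le>o |UNIV :: 'c set|"
    using card_of_Times_same_infinite[OF assms] ordIso_iff_ordLeq by blast
  then obtain p :: "'c \<times> 'c \<Rightarrow> 'c" where p: "inj p"
    by (auto simp: card_of_ordLeq[symmetric])
  obtain q :: "nat \<Rightarrow> 'c" where q: "inj q"
    using infinite_countable_subset[OF assms] by auto
  define enc where "enc = rec_list undefined (\<lambda>x _ y. p (x, y))"
  have enc_Cons: "enc (x # xs) = p (x, enc xs)" for x xs
    by (simp add: enc_def)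
  have enc: "length xs = length ys \<Longrightarrow> enc xs = enc ys \<Longrightarrow> xs = ys" for xs ys
  proof (induction xs arbitrary: ys)
    case (Cons x xs)
    then obtain y ys' where "ys = y # ys'" by (cases ys) auto
    with Cons p show ?case by (auto simp: enc_Cons dest: injD)
  qed simp
  have "inj (\<lambda>xs. p (q (length xs), enc xs))"
  proof (rule injI)
    fix xs ys assume "p (q (length xs), enc xs) = p (q (length ys), enc ys)"
    then have "q (length xs) = q (length ys)" "enc xs = enc ys"
      using injD[OF p] by blast+
    then have "length xs = length ys" "enc xs = enc ys"
      using injD[OF q] by blast+
    then show "xs = ys" by (rule enc)
  qed
  then show ?thesis by blast
qed

theorem strongly_verbally_closedD:
  fixes H :: "('a, 'b) monoid_scheme" and G :: "('c, 'd) monoid_scheme"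
  assumes svc: "strongly_verbally_closed H" and G: "group G" and f: "f \<in> mon H G"
    and vc: "verbally_closed_subgroup (f ` carrier H) G"
  shows "algebraically_closed_subgroup (f ` carrier H) G"
proof -
  define A where "A = f ` carrier H"
  interpret group G by fact
  have H: "group H" using svc by (simp add: strongly_verbally_closed_def)
  have A: "subgroup A G" using vc by (simp add: verbally_closed_subgroup_def A_def)
  interpret A: subgroup A G by fact
  have main: "\<exists>y \<in> {..<r} \<rightarrow> A. \<forall>w \<in> S. word_val G y w = \<one>\<^bsub>G\<^esub>"
    if S: "finite S" "S \<subseteq> words A r" and x: "x \<in> {..<r} \<rightarrow> carrier G"
      and sol: "\<forall>w \<in> S. word_val G x w = \<one>\<^bsub>G\<^esub>" for r S x
  proof -
    define K where "K = generate G (A \<union> x ` {..<r})"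
    have gens: "A \<union> x ` {..<r} \<subseteq> carrier G" using x A.subset by auto
    have K: "subgroup K G" unfolding K_def by (rule generate_is_subgroup[OF gens])
    interpret K: subgroup K G by fact
    have AK: "A \<subseteq> K" and xK: "x \<in> {..<r} \<rightarrow> K"
      unfolding K_def by (auto intro: generate.incl)
    have KW: "K \<subseteq> word_val G x ` words A r"
    proof
      fix k assume "k \<in> K"
      then show "k \<in> word_val G x ` words A r" unfolding K_def
      proof (induction rule: generate.induct)
        case one
        have "[] \<in> words A r" by (simp add: words_def)
        then show ?case by force
      next
        case (incl h)
        then consider "h \<in> A" | i where "i < r" "h = x i" by auto
        then show ?case
        proof cases
          case 1
          then have "[Coeff h] \<in> words A r" by (simp add: words_def letters_def)
          with 1 show ?thesis by (intro image_eqI[of _ _ "[Coeff h]"]) auto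
        next
          case 2
          then have "[Var i] \<in> words A r" by (simp add: words_def letters_def)
          moreover have "x i \<in> carrier G" using 2 x by auto
          ultimately show ?thesis using 2 by (intro image_eqI[of _ _ "[Var i]"]) auto
        qed
      next
        case (inv h)
        then consider "h \<in> A" | i where "i < r" "h = x i" by auto
        then show ?case
        proof cases
          case 1
          then have "[Coeff (inv\<^bsub>G\<^esub> h)] \<in> words A r" by (simp add: words_def letters_def)
          with 1 show ?thesis by (intro image_eqI[of _ _ "[Coeff (inv\<^bsub>G\<^esub> h)]"]) auto
        next
          case 2
          then have "[InvVar i] \<in> words A r" by (simp add: words_def letters_def)
          moreover have "x i \<in> carrier G" using 2 x by auto
          ultimately show ?thesis using 2 by (intro image_eqI[of _ _ "[InvVar i]"]) auto
        qed
      next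
        case (eng h1 h2)
        then obtain w1 w2 where "w1 \<in> words A r" "w2 \<in> words A r"
          and "h1 = word_val G x w1" "h2 = word_val G x w2" by blast
        then show ?case using word_val_append[OF G A.subset x, of w1 w2]
          by (intro image_eqI[of _ _ "w1 @ w2"]) (auto simp: words_def)
      qed
    qed

    define code :: "'c letter \<Rightarrow> 'a + nat" where
      "code = case_letter (\<lambda>a. Inl (inv_into (carrier H) f a)) (\<lambda>i. Inr (2 * i)) (\<lambda>i. Inr (2 * i + 1))"
    have code: "inj_on code (letters A r)"
    proof (rule inj_onI)
      fix l m assume lm: "l \<in> letters A r" "m \<in> letters A r" "code l = code m"
      have odd: "2 * i \<noteq> Suc (2 * j)" "Suc (2 * j) \<noteq> 2 * i" for i j :: nat
        by presburger+
      have inv: "a \<in> A \<Longrightarrow> b \<in> A \<Longrightarrow>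
          inv_into (carrier H) f a = inv_into (carrier H) f b \<Longrightarrow> a = b" for a b
        unfolding A_def by (rule inv_into_injective)
      from lm show "l = m"
        by (cases l; cases m) (simp_all add: code_def letters_def image_iff odd inv)
    qed
    have inf: "infinite (UNIV :: ('a + nat) set)"
      by (simp add: finite_Plus_UNIV_iff)
    obtain e :: "('a + nat) list \<Rightarrow> 'a + nat" where e: "inj e"
      using ex_inj_list[OF inf] by blast
    define g where "g = (\<lambda>k. e (map code (inv_into (words A r) (word_val G x) k)))"
    have g: "inj_on g K"
    proof (rule inj_onI)
      fix k l assume kl: "k \<in> K" "l \<in> K" "g k = g l"
      let ?i = "inv_into (words A r) (word_val G x)"
      have "?i k \<in> words A r" "?i l \<in> words A r"
        using kl KW by (auto intro: inv_into_into)
      moreover have "map code (?i k) = map code (?i l)"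
        using kl e by (auto simp: g_def dest: injD)
      ultimately have "?i k = ?i l"
        using map_inj_on[of code "?i k" "?i l"] code
        by (auto simp: words_def in_lists_conv_set intro: inj_on_subset)
      then show "k = l" using kl KW by (auto intro: inv_into_injective)
    qed

    define g' where "g' = inv_into K g"
    have g'g: "g' (g k) = k" if "k \<in> K" for k
      using that g by (simp add: g'_def)
    define G' :: "('a + nat) monoid" where
      "G' = \<lparr>carrier = g ` K, monoid.mult = (\<lambda>a b. g (g' a \<otimes>\<^bsub>G\<^esub> g' b)), one = g \<one>\<^bsub>G\<^esub>\<rparr>"
    have G'_simps [simp]: "carrier G' = g ` K" "\<one>\<^bsub>G'\<^esub> = g \<one>\<^bsub>G\<^esub>"
      "\<And>a b. a \<otimes>\<^bsub>G'\<^esub> b = g (g' a \<otimes>\<^bsub>G\<^esub> g' b)"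
      by (simp_all add: G'_def)
    have Kg: "group (G\<lparr>carrier := K\<rparr>)" using K.subgroup_is_group[OF G] .
    have G': "group G'"
    proof (rule groupI)
      fix a assume "a \<in> carrier G'"
      then obtain k where k: "k \<in> K" "a = g k" by auto
      then show "\<exists>b \<in> carrier G'. b \<otimes>\<^bsub>G'\<^esub> a = \<one>\<^bsub>G'\<^esub>"
        by (intro bexI[of _ "g (inv\<^bsub>G\<^esub> k)"]) (auto simp: g'g)
    qed (auto simp: g'g m_assoc)
    have ghom: "g \<in> hom (G\<lparr>carrier := K\<rparr>) G'"
      by (auto simp: hom_def g'g)
    have gK: "group_hom (G\<lparr>carrier := K\<rparr>) G' g"
      using Kg G' ghom by (simp add: group_hom_def group_hom_axioms_def)
    have g'hom: "g' \<in> hom G' G"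
      by (auto simp: hom_def g'g)
    have G'sub: "subgroup (carrier G') G'" by (rule group.subgroup_self[OF G'])
    have g'hom': "g' \<in> hom (G'\<lparr>carrier := carrier G'\<rparr>) G"
      using g'hom by (simp add: hom_def)
    have ghomA: "g \<in> hom (G\<lparr>carrier := A\<rparr>) G'"
      using ghom AK by (auto simp: hom_def)
    let ?f = "g \<circ> f"
    have fA: "?f ` carrier H = g ` A" by (auto simp: A_def)
    have fmon: "?f \<in> mon H G'"
    proof -
      have "f \<in> hom H G" "inj_on f (carrier H)" using f by (auto simp: mon_def)
      moreover have "f ` carrier H \<subseteq> K" using AK by (simp add: A_def)
      ultimately show ?thesis
        using inj_on_subset[OF g \<open>f ` carrier H \<subseteq> K\<close>]
        by (auto simp: mon_def hom_def g'g image_subset_iff Pi_iff intro: comp_inj_on)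
    qed
    have subA': "subgroup (g ` A) G'"
    proof -
      have "?f ` carrier H = g ` A" by (rule fA)
      moreover have "group_hom H G' ?f"
        using H G' fmon by (simp add: group_hom_def group_hom_axioms_def mon_def)
      ultimately show ?thesis using group_hom.img_is_subgroup by fastforce
    qed
    have vc': "verbally_closed_subgroup (?f ` carrier H) G'"
      unfolding verbally_closed_subgroup_def fA
    proof (intro conjI subA' allI ballI iffI)
      fix s w h
      assume w: "w \<in> words {} s" and h: "h \<in> g ` A"
        and "\<exists>y \<in> {..<s} \<rightarrow> carrier G'. word_val G' y w = h"
      then obtain y where y: "y \<in> {..<s} \<rightarrow> carrier G'" "word_val G' y w = h" by blast
      let ?w = "map (map_letter g') w"
      have w': "?w \<in> words {} s" by (rule map_letter_words[OF w]) simp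
      have "word_val G (\<lambda>i. g' (y i)) ?w = g' h"
        using word_val_hom[OF G' G G'sub g'hom' _ y(1) w] y(2) by simp
      moreover have "(\<lambda>i. g' (y i)) \<in> {..<s} \<rightarrow> carrier G"
        using y(1) hom_in_carrier[OF g'hom] unfolding Pi_iff by blast
      moreover have "g' h \<in> f ` carrier H"
        using h AK g'g by (auto simp: A_def subset_iff)
      ultimately obtain z where z: "z \<in> {..<s} \<rightarrow> A" "word_val G z ?w = g' h"
        using vc w' unfolding verbally_closed_subgroup_def A_def by blast
      have "map (map_letter g) ?w = w"
      proof -
        have "map_letter g (map_letter g' l) = l" if "l \<in> set w" for l
          using that w by (auto simp: words_def letters_def in_lists_conv_set)
        then show ?thesis by (auto intro!: map_idI)
      qed
      then have "word_val G' (\<lambda>i. g (z i)) w = g (g' h)"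
        using word_val_hom[OF G G' A ghomA _ z(1) w'] z(2) by simp
      moreover have "g (g' h) = h" using h AK g'g by (auto simp: subset_iff)
      moreover have "(\<lambda>i. g (z i)) \<in> {..<s} \<rightarrow> g ` A" using z(1) by auto
      ultimately show "\<exists>y \<in> {..<s} \<rightarrow> g ` A. word_val G' y w = h"
        by (intro bexI[of _ "\<lambda>i. g (z i)"]) simp_all
    next
      fix s w h
      assume "\<exists>y \<in> {..<s} \<rightarrow> g ` A. word_val G' y w = h"
      moreover have "{..<s} \<rightarrow> g ` A \<subseteq> {..<s} \<rightarrow> carrier G'"
        by (rule Pi_mono) (use AK in auto)
      ultimately show "\<exists>y \<in> {..<s} \<rightarrow> carrier G'. word_val G' y w = h" by blast
    qed
    then have ac': "algebraically_closed_subgroup (g ` A) G'"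
      using svc G' fmon unfolding strongly_verbally_closed_def fA[symmetric] by blast
    let ?S = "map (map_letter g) ` S"
    have S': "finite ?S" "?S \<subseteq> words (g ` A) r"
      using S map_letter_words[of _ A r g "g ` A"] by auto
    have "\<forall>w \<in> ?S. word_val G' (\<lambda>i. g (x i)) w = \<one>\<^bsub>G'\<^esub>"
      using sol S word_val_hom[OF G G' K ghom AK xK] by (auto simp: subset_iff)
    moreover have "(\<lambda>i. g (x i)) \<in> {..<r} \<rightarrow> carrier G'" using xK by auto
    ultimately have "\<exists>y \<in> {..<r} \<rightarrow> carrier G'. \<forall>w \<in> ?S. word_val G' y w = \<one>\<^bsub>G'\<^esub>"
      by (intro bexI[of _ "\<lambda>i. g (x i)"])
    moreover have "(\<exists>y \<in> {..<r} \<rightarrow> carrier G'. \<forall>w \<in> ?S. word_val G' y w = \<one>\<^bsub>G'\<^esub>) \<longleftrightarrow>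
        (\<exists>y \<in> {..<r} \<rightarrow> g ` A. \<forall>w \<in> ?S. word_val G' y w = \<one>\<^bsub>G'\<^esub>)"
      using ac'[unfolded algebraically_closed_subgroup_def, THEN conjunct2, rule_format,
          OF conjI[OF S']] .
    ultimately have "\<exists>y \<in> {..<r} \<rightarrow> g ` A. \<forall>w \<in> ?S. word_val G' y w = \<one>\<^bsub>G'\<^esub>"
      by (rule iffD1[rotated])
    then obtain y where y: "y \<in> {..<r} \<rightarrow> g ` A" "\<forall>w \<in> ?S. word_val G' y w = \<one>\<^bsub>G'\<^esub>"
      by (rule bexE)
    have "word_val G (\<lambda>i. g' (y i)) w = \<one>\<^bsub>G\<^esub>" if w: "w \<in> S" for w
    proof -
      have wA: "w \<in> words A r" using w S by auto
      have "map (map_letter g') (map (map_letter g) w) = w"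
      proof -
        have "map_letter g' (map_letter g l) = l" if "l \<in> set w" for l
          using that wA AK g'g by (auto simp: words_def letters_def in_lists_conv_set subset_iff)
        then show ?thesis by (auto intro!: map_idI)
      qed
      moreover have "y \<in> {..<r} \<rightarrow> carrier G'" "g ` A \<subseteq> carrier G'" using y(1) AK by auto
      moreover have "map (map_letter g) w \<in> words (g ` A) r" using S' w by auto
      ultimately have "word_val G (\<lambda>i. g' (y i)) w = g' (word_val G' y (map (map_letter g) w))"
        using word_val_hom[OF G' G G'sub g'hom', of "g ` A" y r "map (map_letter g) w"] by simp
      then show ?thesis using y(2) w g'g[OF K.one_closed] by simp
    qed
    moreover have "(\<lambda>i. g' (y i)) \<in> {..<r} \<rightarrow> A"
    proof
      fix i assume "i \<in> {..<r}"
      with y(1) obtain a where "a \<in> A" "y i = g a" by blast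
      then show "g' (y i) \<in> A" using AK g'g by auto
    qed
    ultimately show ?thesis by (intro bexI[of _ "\<lambda>i. g' (y i)"]) simp_all
  qed
  have "(\<exists>x \<in> {..<r} \<rightarrow> carrier G. \<forall>w \<in> S. word_val G x w = \<one>\<^bsub>G\<^esub>) \<longleftrightarrow>
        (\<exists>x \<in> {..<r} \<rightarrow> A. \<forall>w \<in> S. word_val G x w = \<one>\<^bsub>G\<^esub>)"
    if "finite S" "S \<subseteq> words A r" for r S
  proof
    assume "\<exists>x \<in> {..<r} \<rightarrow> A. \<forall>w \<in> S. word_val G x w = \<one>\<^bsub>G\<^esub>"
    then show "\<exists>x \<in> {..<r} \<rightarrow> carrier G. \<forall>w \<in> S. word_val G x w = \<one>\<^bsub>G\<^esub>"
      using Pi_mono[of "{..<r}" "\<lambda>_. A" "\<lambda>_. carrier G"] A.subset by blast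
  qed (use main that in blast)
  then show ?thesis using A unfolding algebraically_closed_subgroup_def A_def by blast
qed

end

theory Submission
  imports Defs
begin

text \<open>
  Let \<open>c = a\<^sup>q\<close> be central with \<open>q\<close> a prime power.  Consider \<open>G = (H\<^sup>k \<times> \<int>\<^sup>r) / N\<close> with \<open>H\<close> embedded
  diagonally, where \<open>N\<close> is spanned by the relations \<open>\<Prod>i. c\<^sub>i\<^sup>\<epsilon> = y\<^sup>-\<^sup>q\<close> (one for each row \<open>\<epsilon>\<close> of a
  0-1 matrix) between the copies \<open>c\<^sub>i\<close> of \<open>c\<close> and new central elements \<open>y\<close>.  If every integer
  combination of the rows has a coordinate divisible by \<open>q\<close>, then \<open>H\<close> is verbally closed in \<open>G\<close>:
  an equation solvable in \<open>G\<close> can be corrected in that coordinate by powers of \<open>c\<close>.  So the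
  decomposition of the diagonal into \<open>k\<close> commuting copies of \<open>H\<close>, together with the relations, can be
  imitated in \<open>H\<close>, which gives \<open>k\<close> commuting subgroups generating \<open>H\<close>.  Modulo the centre they are
  direct factors, so at most \<open>l\<close> of them are noncentral, with \<open>l\<close> independent of \<open>k\<close>.  If moreover on
  any \<open>l\<close> coordinates some combination of the rows is constantly 1, this combination expresses the
  noncentral part of \<open>c\<close> by \<open>q\<close>-th powers of central elements, and \<open>c\<close> is such a power as well.

  Such matrices arise from the evaluation of polynomials of degree at most \<open>l\<close> on a cube of large
  dimension.  For the bound \<open>l\<close>, the number of non-perfect factors is controlled by a finite quotient
  of the abelianization, and a perfect direct factor contains one of finitely many indecomposable
  factors (or is trivial in the solvable case).
\<close>

section \<open>Polynomials on the cube\<close>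

text \<open>The demands on the matrix pull in opposite directions. The first arises as follows. A
  word \<open>w\<close> without coefficients takes on the integers exactly the values in some
  m\<int>, so multiplying its arguments in \<open>H\<close> by powers of \<open>c\<close> changes
  its value by a power of \<open>c\<close> with an arbitrary exponent in m\<int>. A solution modulo
  \<open>N\<close> leaves the error \<open>c\<close> to the power \<open>F b i\<close> in coordinate
  i, with m dividing every \<open>q * b t\<close>; hence m must divide some \<open>F b i\<close>.
  The second demand is made for every set of at most l columns, because the set of noncentral
  factors is known only after \<open>H\<close> has solved the system. So k is chosen after l, and
  the hypotheses on \<open>H\<close> must supply an l that does not depend on k. Polynomials without
  constant term on the nonempty points of a cube satisfy both demands: low degree forces a value
  divisible by q, but still allows interpolation of 1 at l points. The test modulo p is the reason
  for taking q a prime power; coprime exponents are combined afterwards by a Bezout identity. Finite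
  generation of \<open>H\<close> is what turns centrality and the copying of \<open>H\<close> into
  finitely many equations.\<close>

inductive cube_poly :: "nat \<Rightarrow> (nat set \<Rightarrow> int) \<Rightarrow> bool" where
  monomial: "finite T \<Longrightarrow> card T \<le> d \<Longrightarrow> cube_poly d (\<lambda>S. of_bool (T \<subseteq> S))"
| add: "cube_poly d f \<Longrightarrow> cube_poly d g \<Longrightarrow> cube_poly d (\<lambda>S. f S + g S)"
| scale: "cube_poly d f \<Longrightarrow> cube_poly d (\<lambda>S. c * f S)"

lemma cube_poly_const: "cube_poly d (\<lambda>S. c)"
  using cube_poly.scale[OF cube_poly.monomial[of "{}" d], of c] by simp

lemma cube_poly_sum:
  assumes "finite A" "\<And>a. a \<in> A \<Longrightarrow> cube_poly d (f a)"
  shows "cube_poly d (\<lambda>S. \<Sum>a\<in>A. f a S)"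
  using assms by (induction A rule: finite_induct) (auto intro: cube_poly_const cube_poly.add)

text \<open>Coordinates are 0 or 1, so \<open>of_bool (T \<subseteq> S)\<close> is the squarefree
  monomial of \<open>T\<close> at the indicator vector of \<open>S\<close>, and two monomials
  multiply to that of \<open>T \<union> T'\<close>, of degree at most the sum.\<close>

lemma cube_poly_mult:
  assumes "cube_poly d f" "cube_poly e g"
  shows "cube_poly (d + e) (\<lambda>S. f S * g S)"
  using assms(1)
proof (induction rule: cube_poly.induct)
  case (monomial T d)
  from assms(2) show ?case
  proof (induction rule: cube_poly.induct)
    case (monomial T' e)
    have "card (T \<union> T') \<le> d + e"
      using card_Un_le[of T T'] monomial \<open>card T \<le> d\<close> by linarith
    then have "cube_poly (d + e) (\<lambda>S. of_bool (T \<union> T' \<subseteq> S))"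
      using monomial \<open>finite T\<close> by (intro cube_poly.monomial) auto
    moreover have "(of_bool (T \<union> T' \<subseteq> S) :: int) = of_bool (T \<subseteq> S) * of_bool (T' \<subseteq> S)" for S
      by auto
    ultimately show ?case by simp
  next
    case (add e f g)
    then show ?case using cube_poly.add by (fastforce simp: distrib_left)
  next
    case (scale e f c)
    then show ?case using cube_poly.scale[of "d + e" _ c] by (fastforce simp: mult.left_commute)
  qed
next
  case (add d f g)
  then show ?case using cube_poly.add by (fastforce simp: distrib_right)
next
  case (scale d f c)
  then show ?case using cube_poly.scale[of "d + e" _ c] by (fastforce simp: mult.assoc)
qed

text \<open>With \<open>c j = Suc j\<close> this is the rising product equal to n! times a binomial
  coefficient. Working with the multiple avoids writing the binomial coefficient itself as a
  polynomial.\<close>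

lemma cube_poly_prod:
  assumes "cube_poly d f"
  shows "cube_poly (d * n) (\<lambda>S. \<Prod>j<n. f S + c j)"
proof (induction n)
  case 0
  show ?case using cube_poly_const[of 0 1] by simp
next
  case (Suc n)
  have "cube_poly d (\<lambda>S. f S + c n)"
    by (intro cube_poly.add assms cube_poly_const)
  from cube_poly_mult[OF Suc this] show ?case by (simp add: add.commute)
qed

section \<open>Alternating sums over the cube and binomial coefficients\<close>

lemma sum_Pow_insert:
  fixes f :: "'b set \<Rightarrow> 'c :: comm_monoid_add"
  assumes "finite A" "x \<notin> A"
  shows "(\<Sum>S\<in>Pow (insert x A). f S) = (\<Sum>S\<in>Pow A. f S + f (insert x S))"
proof -
  have "inj_on (insert x) (Pow A)"
    using assms(2) by (intro inj_onI) (metis Pow_iff insert_ident subsetD)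
  moreover have "Pow A \<inter> insert x ` Pow A = {}" using assms(2) by auto
  ultimately show ?thesis
    using assms(1) by (simp add: Pow_insert sum.union_disjoint sum.reindex sum.distrib)
qed

text \<open>A monomial of degree less than \<open>card A\<close> misses some
  \<open>x \<in> A\<close>; the terms of S and \<open>insert x S\<close> then cancel.\<close>

lemma sum_alternating_cube_poly:
  assumes "cube_poly d f" "finite A" "d < card A"
  shows "(\<Sum>S\<in>Pow A. (-1) ^ card S * f S) = 0"
  using assms
proof (induction rule: cube_poly.induct)
  case (monomial T d)
  then obtain x where x: "x \<in> A" "x \<notin> T"
    by (metis card_mono not_less subsetI le_trans)
  define B where "B = A - {x}"
  have B: "A = insert x B" "x \<notin> B" "finite B" using x monomial by (auto simp: B_def)
  have "(-1) ^ card S * of_bool (T \<subseteq> S) + (-1) ^ card (insert x S) * of_bool (T \<subseteq> insert x S)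
      = (0 :: int)" if "S \<in> Pow B" for S
  proof -
    have "card (insert x S) = Suc (card S)" "T \<subseteq> insert x S \<longleftrightarrow> T \<subseteq> S"
      using that B x by (auto intro!: card_insert_disjoint intro: finite_subset)
    then show ?thesis by simp
  qed
  then show ?case unfolding B(1) by (subst sum_Pow_insert[OF B(3,2)]) simp
next
  case (add d f g)
  then show ?case by (simp add: distrib_left sum.distrib)
next
  case (scale d f c)
  then have "(\<Sum>S\<in>Pow A. c * ((-1) ^ card S * f S)) = 0"
    by (simp flip: sum_distrib_left)
  then show ?case by (simp add: mult.left_commute)
qed

text \<open>Write q for \<open>Suc n\<close>. The identity q * binomial (x+q, q) = (x+q) * binomial
  (x+n, n) shows that q divides x+q, hence x, as soon as p does not divide the last factor.\<close>

lemma prime_dvd_binomial_of_not_dvd: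
  fixes p x n :: nat
  assumes "Factorial_Ring.prime p" "Suc n = p ^ e" "\<not> Suc n dvd x"
  shows "p dvd (x + n) choose n"
proof (rule ccontr)
  assume "\<not> p dvd (x + n) choose n"
  then have "coprime (Suc n) ((x + n) choose n)"
    using assms by (simp add: prime_imp_coprime)
  moreover have "Suc n dvd Suc (x + n) * ((x + n) choose n)"
    using Suc_times_binomial[of n "x + n"] by (metis dvd_triv_left)
  ultimately have "Suc n dvd Suc (x + n)"
    by (rule iffD1[OF coprime_dvd_mult_left_iff])
  then have "Suc n dvd x + Suc n" by simp
  with assms(3) show False by (simp only: dvd_add_triv_right_iff)
qed

lemma fact_times_binomial_prod:
  "int (fact n * ((x + n) choose n)) = (\<Prod>j<n. int x + int (Suc j))"
proof -
  have "(fact n * ((x + n) choose n)) = (\<Prod>j<n. x + Suc j)"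
  proof (induction n)
    case (Suc n)
    have "fact (Suc n) * ((x + Suc n) choose Suc n) = fact n * (Suc n * (Suc (x + n) choose Suc n))"
      by (simp only: fact_Suc of_nat_id add_Suc_right mult_ac)
    also have "\<dots> = fact n * (Suc (x + n) * ((x + n) choose n))"
      by (simp only: Suc_times_binomial)
    also have "\<dots> = (fact n * ((x + n) choose n)) * (x + Suc n)"
      by (simp only: mult_ac add_Suc_right)
    finally show ?case unfolding Suc by simp
  qed simp
  then show ?thesis by (simp add: of_nat_prod add_ac del: fact_Suc)
qed

text \<open>
  A Chevalley-Warning argument on the cube: modulo \<open>p\<close>, the polynomial
  \<open>binomial (f + q - 1, q - 1)\<close> detects the points where \<open>q\<close> divides \<open>f\<close>, and its alternating sum
  over the cube vanishes because its degree is less than the dimension.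
\<close>

lemma cube_poly_prime_power_dvd:
  fixes p l e M :: nat and b :: "nat set \<Rightarrow> int"
  assumes p: "Factorial_Ring.prime p" and M: "l * (p ^ e - 1) < M"
    and J: "J = {T. T \<subseteq> {..<M} \<and> T \<noteq> {} \<and> card T \<le> l}"
  shows "\<exists>S. S \<subseteq> {..<M} \<and> S \<noteq> {} \<and> int (p ^ e) dvd (\<Sum>T\<in>J. b T * of_bool (T \<subseteq> S))"
proof (rule ccontr)
  assume neg: "\<not> ?thesis"
  define q where "q = p ^ e"
  have q: "q > 0" using p by (simp add: q_def prime_gt_0_nat)
  define n where "n = q - 1"
  have n: "Suc n = q" using q by (simp add: n_def)
  have finJ: "finite J" unfolding J by (rule finite_subset[of _ "Pow {..<M}"]) auto
  \<comment> \<open>Reducing the coefficients modulo q keeps divisibility by q and makes the values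
    natural numbers, so that \<open>prime_dvd_binomial_of_not_dvd\<close> applies to them.\<close>
  define a where "a T = nat (b T mod int q)" for T
  define F where "F S = (\<Sum>T\<in>J. a T * of_bool (T \<subseteq> S))" for S
  have Fb: "int q dvd int (F S) \<longleftrightarrow> int q dvd (\<Sum>T\<in>J. b T * of_bool (T \<subseteq> S))" for S
  proof -
    have "int (F S) mod int q = (\<Sum>T\<in>J. (b T mod int q) * of_bool (T \<subseteq> S)) mod int q"
      using q by (simp add: F_def a_def of_nat_sum)
    also have "\<dots> = (\<Sum>T\<in>J. b T * of_bool (T \<subseteq> S)) mod int q"
      by (subst (1 2) mod_sum_eq[symmetric]) (simp add: mod_mult_left_eq)
    finally show ?thesis by (simp add: dvd_eq_mod_eq_0)
  qed
  have poly: "cube_poly l (\<lambda>S. int (F S))"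
  proof -
    have "cube_poly l (\<lambda>S. \<Sum>T\<in>J. int (a T) * of_bool (T \<subseteq> S))"
      by (intro cube_poly_sum finJ cube_poly.scale cube_poly.monomial)
         (auto simp: J intro: finite_subset)
    then show ?thesis by (simp add: F_def of_nat_sum)
  qed
  \<comment> \<open>The product has degree at most \<open>l * n\<close>, which is below the
    dimension \<open>M\<close>. The factor n! is cancelled afterwards, over the integers.\<close>
  have "(\<Sum>S\<in>Pow {..<M}. (-1) ^ card S * (\<Prod>j<n. int (F S) + int (Suc j))) = 0"
    by (rule sum_alternating_cube_poly[OF cube_poly_prod[OF poly]])
       (use M in \<open>auto simp: n_def q_def\<close>)
  then have "fact n * (\<Sum>S\<in>Pow {..<M}. (-1) ^ card S * int ((F S + n) choose n)) = 0"
    unfolding fact_times_binomial_prod[symmetric]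
    by (simp add: sum_distrib_left mult_ac)
  then have 0: "(\<Sum>S\<in>Pow {..<M}. (-1) ^ card S * int ((F S + n) choose n)) = 0"
    by simp
  have "int p dvd (\<Sum>S\<in>Pow {..<M} - {{}}. (-1) ^ card S * int ((F S + n) choose n))"
  proof (intro dvd_sum dvd_mult)
    fix S assume "S \<in> Pow {..<M} - {{}}"
    then have "\<not> int q dvd int (F S)" using neg Fb by (auto simp: q_def)
    then have "\<not> Suc n dvd F S" by (metis int_dvd_int_iff n)
    then show "int p dvd int ((F S + n) choose n)"
      using prime_dvd_binomial_of_not_dvd[OF p, of n e] n
      by (simp add: q_def int_dvd_int_iff)
  qed
  \<comment> \<open>No monomial in \<open>J\<close> is constant, so at the empty set the binomial
    coefficient is 1, the only term that survives modulo p.\<close>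
  moreover have "F {} = 0" unfolding F_def J by (intro sum.neutral) auto
  ultimately have "int p dvd 1"
    using 0 by (simp add: sum.remove[of _ "{}"] eq_neg_iff_add_eq_0[symmetric])
  then show False using p by (metis not_prime_unit of_nat_1 int_dvd_int_iff)
qed

section \<open>Interpolation on the cube and the 0-1 matrices\<close>

lemma sum_alternating_Pow:
  fixes A :: "nat set"
  assumes "finite A" "A \<noteq> {}"
  shows "(\<Sum>S\<in>Pow A. (-1) ^ card S :: int) = 0"
  using sum_alternating_cube_poly[OF cube_poly_const[of 0 1] assms(1)] assms
  by (simp add: card_gt_0_iff)

text \<open>Pick a point in each member of \<open>L\<close> and let \<open>U\<close> be the set of
  these points. The polynomial 1 - \<Prod>(1 - x_u) over u \<in> \<open>U\<close> is 1 at every set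
  that meets \<open>U\<close>, has degree at most l and no constant term; \<open>b\<close> lists its
  coefficients.\<close>

lemma ex_cube_poly_one_on:
  fixes M l :: nat
  assumes L: "finite L" "card L \<le> l" "\<And>S. S \<in> L \<Longrightarrow> S \<subseteq> {..<M} \<and> S \<noteq> {}"
    and J: "J = {T. T \<subseteq> {..<M} \<and> T \<noteq> {} \<and> card T \<le> l}"
  shows "\<exists>b :: nat set \<Rightarrow> int. \<forall>S\<in>L. (\<Sum>T\<in>J. b T * of_bool (T \<subseteq> S)) = 1"
proof -
  have "\<forall>S\<in>L. \<exists>s. s \<in> S" using L(3) by auto
  then obtain s where s: "\<And>S. S \<in> L \<Longrightarrow> s S \<in> S" by metis
  define U where "U = s ` L"
  have U: "finite U" "card U \<le> l" "U \<subseteq> {..<M}"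
    using L s card_image_le[of L s] by (auto simp: U_def)
  have finJ: "finite J" unfolding J by (rule finite_subset[of _ "Pow {..<M}"]) auto
  define b :: "nat set \<Rightarrow> int" where "b T = - ((-1) ^ card T * of_bool (T \<subseteq> U))" for T
  have "(\<Sum>T\<in>J. b T * of_bool (T \<subseteq> S)) = 1" if S: "S \<in> L" for S
  proof -
    have sub: "Pow (U \<inter> S) - {{}} \<subseteq> J"
    proof
      fix T assume "T \<in> Pow (U \<inter> S) - {{}}"
      moreover from this have "card T \<le> card U" using U(1) by (auto intro: card_mono)
      ultimately show "T \<in> J" using U unfolding J by auto
    qed
    have "(\<Sum>T\<in>J. b T * of_bool (T \<subseteq> S)) = (\<Sum>T\<in>Pow (U \<inter> S) - {{}}. - ((-1) ^ card T))"
      by (rule sum.mono_neutral_cong_right[OF finJ sub]) (auto simp: b_def J)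
    also have "\<dots> = 1 - (\<Sum>T\<in>Pow (U \<inter> S). (-1) ^ card T)"
      using U(1) by (simp add: sum.remove[of _ "{}"] sum_negf)
    also have "(\<Sum>T\<in>Pow (U \<inter> S). (-1) ^ card T :: int) = 0"
      using U(1) s[OF S] S by (intro sum_alternating_Pow) (auto simp: U_def)
    finally show ?thesis by simp
  qed
  then show ?thesis by blast
qed

text \<open>Rows are the nonconstant monomials of degree at most l, columns the nonempty subsets of
  the cube, and the entries are evaluations. A combination of rows is therefore the value table of a
  polynomial without constant term. The empty set is no column, since all rows vanish there.\<close>

lemma ex_covering_code:
  fixes p e l :: nat
  assumes p: "Factorial_Ring.prime p"
  shows "\<exists>k r. \<exists>\<epsilon> :: nat \<Rightarrow> nat \<Rightarrow> nat. k > 0 \<and>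
     (\<forall>b :: nat \<Rightarrow> int. \<exists>i<k. int (p ^ e) dvd (\<Sum>t<r. b t * int (\<epsilon> t i))) \<and>
     (\<forall>L \<subseteq> {..<k}. card L \<le> l \<longrightarrow> (\<exists>b :: nat \<Rightarrow> int. \<forall>i\<in>L. (\<Sum>t<r. b t * int (\<epsilon> t i)) = 1))"
proof -
  \<comment> \<open>The least dimension that exceeds the degree \<open>l * (p ^ e - 1)\<close> of
    the binomial test.\<close>
  define M where "M = Suc (l * (p ^ e - 1))"
  have M: "l * (p ^ e - 1) < M" by (simp add: M_def)
  define I where "I = Pow {..<M} - {{}}"
  define J where "J = {T. T \<subseteq> {..<M} \<and> T \<noteq> {} \<and> card T \<le> l}"
  have finI: "finite I" by (simp add: I_def)
  have finJ: "finite J" unfolding J_def by (rule finite_subset[of _ "Pow {..<M}"]) auto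
  obtain \<sigma> where \<sigma>: "bij_betw \<sigma> {..<card I} I"
    using ex_bij_betw_nat_finite[OF finI] by (auto simp: atLeast0LessThan)
  obtain \<tau> where \<tau>: "bij_betw \<tau> {..<card J} J"
    using ex_bij_betw_nat_finite[OF finJ] by (auto simp: atLeast0LessThan)
  define \<tau>' where "\<tau>' = inv_into {..<card J} \<tau>"
  have \<tau>': "\<tau>' (\<tau> t) = t" if "t < card J" for t
    using that \<tau> by (simp add: \<tau>'_def bij_betw_def)
  define \<epsilon> :: "nat \<Rightarrow> nat \<Rightarrow> nat" where "\<epsilon> t i = of_bool (\<tau> t \<subseteq> \<sigma> i)" for t i
  have sum: "(\<Sum>t<card J. b (\<tau> t) * int (\<epsilon> t i)) = (\<Sum>T\<in>J. b T * of_bool (T \<subseteq> \<sigma> i))"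
    for b :: "nat set \<Rightarrow> int" and i
    using sum.reindex_bij_betw[OF \<tau>, of "\<lambda>T. b T * of_bool (T \<subseteq> \<sigma> i)"] by (simp add: \<epsilon>_def)
  have cardI: "card I > 0"
  proof -
    have "{0} \<in> I" using M by (auto simp: I_def)
    then show ?thesis using finI by (auto simp: card_gt_0_iff)
  qed
  have zero: "\<exists>i<card I. int (p ^ e) dvd (\<Sum>t<card J. b t * int (\<epsilon> t i))" for b
  proof -
    obtain S where S: "S \<subseteq> {..<M}" "S \<noteq> {}"
      "int (p ^ e) dvd (\<Sum>T\<in>J. b (\<tau>' T) * of_bool (T \<subseteq> S))"
      using cube_poly_prime_power_dvd[OF p M J_def, of "\<lambda>T. b (\<tau>' T)"] by (elim exE conjE)
    then have "S \<in> I" by (simp add: I_def)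
    then have "S \<in> \<sigma> ` {..<card I}"
      using bij_betw_imp_surj_on[OF \<sigma>] by simp
    then obtain i where "i < card I" "\<sigma> i = S" by auto
    then have "int (p ^ e) dvd (\<Sum>t<card J. b (\<tau>' (\<tau> t)) * int (\<epsilon> t i))"
      using S(3) sum[of "\<lambda>T. b (\<tau>' T)" i] by simp
    then have "int (p ^ e) dvd (\<Sum>t<card J. b t * int (\<epsilon> t i))"
      by (simp add: \<tau>')
    with \<open>i < card I\<close> show ?thesis by (intro exI[of _ i] conjI)
  qed
  have ones: "\<exists>b :: nat \<Rightarrow> int. \<forall>i\<in>L. (\<Sum>t<card J. b t * int (\<epsilon> t i)) = 1"
    if L: "L \<subseteq> {..<card I}" "card L \<le> l" for L
  proof -
    have "finite L" using L(1) by (rule finite_subset) simp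
    then have card: "card (\<sigma> ` L) \<le> l" using card_image_le[of L \<sigma>] L(2) by linarith
    have sub: "S \<subseteq> {..<M} \<and> S \<noteq> {}" if "S \<in> \<sigma> ` L" for S
    proof -
      have "S \<in> \<sigma> ` {..<card I}" using that L(1) by (rule subsetD[OF image_mono, rotated])
      then have "S \<in> I" using bij_betw_imp_surj_on[OF \<sigma>] by simp
      then show ?thesis by (simp add: I_def)
    qed
    have "\<exists>b :: nat set \<Rightarrow> int. \<forall>S\<in>\<sigma> ` L. (\<Sum>T\<in>J. b T * of_bool (T \<subseteq> S)) = 1"
      by (rule ex_cube_poly_one_on[OF finite_imageI[OF \<open>finite L\<close>] card _ J_def]) (rule sub)
    then obtain b :: "nat set \<Rightarrow> int" where
      "\<forall>S\<in>\<sigma> ` L. (\<Sum>T\<in>J. b T * of_bool (T \<subseteq> S)) = 1" by (elim exE)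
    then have "\<forall>i\<in>L. (\<Sum>t<card J. b (\<tau> t) * int (\<epsilon> t i)) = 1"
      unfolding sum by simp
    then show ?thesis by (rule exI[of _ "\<lambda>t. b (\<tau> t)"])
  qed
  show ?thesis
    by (rule exI[of _ "card I"], rule exI[of _ "card J"], rule exI[of _ \<epsilon>])
       (intro conjI allI impI cardI zero ones)
qed

section \<open>Direct factors of finitely generated groups\<close>

lemma (in group) internal_direct_product_iff:
  "internal_direct_product G A B \<longleftrightarrow>
     subgroup A G \<and> subgroup B G \<and> (\<forall>a\<in>A. \<forall>b\<in>B. a \<otimes> b = b \<otimes> a) \<and> A \<inter> B = {\<one>} \<and>
     (\<forall>x\<in>carrier G. \<exists>a\<in>A. \<exists>b\<in>B. x = a \<otimes> b)" (is "?L \<longleftrightarrow> ?R")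
proof
  assume L: ?L
  then have "A \<lhd> G" "B \<lhd> G" by (auto simp: internal_direct_product_def)
  then have "subgroup A G" "subgroup B G" by (auto intro: normal_imp_subgroup)
  moreover have "\<forall>a\<in>A. \<forall>b\<in>B. a \<otimes> b = b \<otimes> a"
    using L normal_imp_commuting[of A B] by (auto simp: internal_direct_product_def)
  moreover have "\<forall>x\<in>carrier G. \<exists>a\<in>A. \<exists>b\<in>B. x = a \<otimes> b"
    using L unfolding internal_direct_product_def set_mult_def by blast
  ultimately show ?R using L by (simp add: internal_direct_product_def)
next
  assume R: ?R
  then interpret A: subgroup A G by simp
  from R interpret B: subgroup B G by simp
  interpret group_disjoint_sum G A B by unfold_locales
  have sub: "carrier G \<subseteq> A <#> B" using R unfolding set_mult_def by blast
  have "A <#> B \<subseteq> carrier G" using A.subset B.subset unfolding set_mult_def by blast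
  then show ?L
    using R sub commuting_imp_normal1[OF sub] commuting_imp_normal2[OF sub]
    unfolding internal_direct_product_def by auto
qed

lemma (in group) internal_direct_product_commute:
  "internal_direct_product G A B \<longleftrightarrow> internal_direct_product G B A"
  unfolding internal_direct_product_iff by (fastforce simp: Int_commute)

text \<open>The projection is taken as an endomorphism of \<open>G\<close>, so that it acts on the
  derived subgroup and on congruences modulo it.\<close>

lemma (in group) ex_projection:
  assumes "internal_direct_product G A B"
  shows "\<exists>\<pi>. group_hom G G \<pi> \<and> (\<forall>x\<in>carrier G. \<pi> x \<in> A \<and> inv (\<pi> x) \<otimes> x \<in> B) \<and>
           (\<forall>a\<in>A. \<pi> a = a) \<and> (\<forall>b\<in>B. \<pi> b = \<one>)"
proof -
  have AB: "subgroup A G" "subgroup B G" "\<And>a b. a \<in> A \<Longrightarrow> b \<in> B \<Longrightarrow> a \<otimes> b = b \<otimes> a"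
    "A \<inter> B = {\<one>}" "\<And>x. x \<in> carrier G \<Longrightarrow> \<exists>a\<in>A. \<exists>b\<in>B. x = a \<otimes> b"
    using assms unfolding internal_direct_product_iff by blast+
  interpret A: subgroup A G by fact
  interpret B: subgroup B G by fact
  interpret group_disjoint_sum G A B by unfold_locales
  define \<pi> where "\<pi> x = (THE a. a \<in> A \<and> (\<exists>b\<in>B. x = a \<otimes> b))" for x
  have \<pi>: "\<pi> (a \<otimes> b) = a" if ab: "a \<in> A" "b \<in> B" for a b
    unfolding \<pi>_def
  proof (rule the_equality)
    fix a' assume "a' \<in> A \<and> (\<exists>b'\<in>B. a \<otimes> b = a' \<otimes> b')"
    then obtain b' where ab': "a' \<in> A" "b' \<in> B" "a \<otimes> b = a' \<otimes> b'" by blast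
    then show "a' = a" using cancel AB(4) ab by (metis subset_refl)
  qed (use ab in blast)
  have \<pi>A: "\<pi> a = a" if "a \<in> A" for a using \<pi>[OF that B.one_closed] that by simp
  have \<pi>B: "\<pi> b = \<one>" if "b \<in> B" for b using \<pi>[OF A.one_closed that] that by simp
  have "\<pi> \<in> hom G G"
  proof (rule homI)
    fix x assume "x \<in> carrier G"
    then show "\<pi> x \<in> carrier G" using AB(5)[of x] \<pi> by auto
  next
    fix x y assume "x \<in> carrier G" "y \<in> carrier G"
    then obtain a b c d where *: "a \<in> A" "b \<in> B" "x = a \<otimes> b" "c \<in> A" "d \<in> B" "y = c \<otimes> d"
      using AB(5) by metis
    then have cl: "a \<in> carrier G" "b \<in> carrier G" "c \<in> carrier G" "d \<in> carrier G" by auto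
    have "x \<otimes> y = a \<otimes> (b \<otimes> c) \<otimes> d" using * cl by (simp add: m_assoc)
    also have "b \<otimes> c = c \<otimes> b" using AB(3)[of c b] * by simp
    also have "a \<otimes> (c \<otimes> b) \<otimes> d = (a \<otimes> c) \<otimes> (b \<otimes> d)" using cl by (simp add: m_assoc)
    finally show "\<pi> (x \<otimes> y) = \<pi> x \<otimes> \<pi> y" using * \<pi> by simp
  qed
  then have "group_hom G G \<pi>" by unfold_locales
  moreover have "\<pi> x \<in> A \<and> inv (\<pi> x) \<otimes> x \<in> B" if "x \<in> carrier G" for x
  proof -
    obtain a b where *: "a \<in> A" "b \<in> B" "x = a \<otimes> b" using AB(5)[OF \<open>x \<in> carrier G\<close>] by blast
    then have "inv a \<otimes> (a \<otimes> b) = b" by (simp add: m_assoc[symmetric])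
    with * show ?thesis using \<pi> by simp
  qed
  ultimately show ?thesis using \<pi>A \<pi>B by blast
qed

section \<open>Finitely generated abelian groups modulo powers\<close>

lemma (in comm_group) generate_insert_decomposition:
  assumes "S \<subseteq> carrier G" "g \<in> carrier G" "x \<in> generate G (insert g S)"
  shows "\<exists>i :: int. \<exists>y\<in>generate G S. x = g [^] i \<otimes> y"
  using assms(3)
proof (induction rule: generate.induct)
  case one
  show ?case using generate.one[of G S] by (intro exI[of _ 0] bexI[of _ \<one>]) auto
next
  case (incl h)
  show ?case
  proof (cases "h = g")
    case True
    then show ?thesis using assms generate.one[of G S]
      by (intro exI[of _ 1] bexI[of _ \<one>]) auto
  next
    case False
    then have "h \<in> S" using incl by simp
    then show ?thesis using assms generate.incl[of h S G]
      by (intro exI[of _ 0] bexI[of _ h]) auto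
  qed
next
  case (inv h)
  show ?case
  proof (cases "h = g")
    case True
    then show ?thesis using assms generate.one[of G S]
      by (intro exI[of _ "-1"] bexI[of _ \<one>]) (auto simp: int_pow_neg)
  next
    case False
    then have "h \<in> S" using inv by simp
    then show ?thesis using assms generate.inv[of h S G]
      by (intro exI[of _ 0] bexI[of _ "inv h"]) auto
  qed
next
  case (eng h1 h2)
  then obtain i j :: int and y z where *: "y \<in> generate G S" "h1 = g [^] i \<otimes> y"
    "z \<in> generate G S" "h2 = g [^] j \<otimes> z" by blast
  then have "y \<in> carrier G" "z \<in> carrier G"
    using generate_in_carrier[OF assms(1)] by auto
  then have "h1 \<otimes> h2 = g [^] (i + j) \<otimes> (y \<otimes> z)"
    using * assms by (simp add: int_pow_mult m_ac)
  then show ?case using * by (blast intro: generate.eng)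
qed

text \<open>One exponent has to serve all subgroups at once. It is built generator by generator:
  torsion of the new generator modulo the old ones is absorbed into the exponent, and an infinite
  cyclic quotient has no nonzero subgroup divisible by an integer greater than 1.\<close>

lemma (in comm_group) ex_exponent_no_divisible_subgroup:
  assumes "finite S" "S \<subseteq> carrier G"
  shows "\<exists>e :: int. e > 1 \<and>
    (\<forall>C. subgroup C G \<and> C \<subseteq> generate G S \<and> (\<forall>c\<in>C. \<exists>x\<in>C. c = x [^] e) \<longrightarrow> C = {\<one>})"
  using assms
proof (induction S rule: finite_induct)
  case empty
  have "C = {\<one>}" if "subgroup C G" "C \<subseteq> generate G {}" for C
    using that subgroup.one_closed[of C G] by (auto simp: generate_empty)
  then show ?case by (intro exI[of _ 2]) auto
next
  case (insert g S)
  then have S: "S \<subseteq> carrier G" and g: "g \<in> carrier G" by auto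
  let ?S = "generate G S"
  interpret S: subgroup ?S G by (rule generate_is_subgroup[OF S])
  have Spow: "y [^] (i :: int) \<in> ?S" if "y \<in> ?S" for y i
    using subgroup_int_pow_closed[OF S.subgroup_axioms that] .
  obtain e :: int where e: "e > 1" and
    IH: "\<And>C. subgroup C G \<Longrightarrow> C \<subseteq> ?S \<Longrightarrow> (\<And>c. c \<in> C \<Longrightarrow> \<exists>x\<in>C. c = x [^] e) \<Longrightarrow> C = {\<one>}"
    using insert by auto
  have step: "C = {\<one>}"
    if C: "subgroup C G" "C \<subseteq> ?S" "\<And>c. c \<in> C \<Longrightarrow> \<exists>x\<in>C. c = x [^] (k * e)" for C k
  proof (rule IH[OF C(1,2)])
    fix c assume "c \<in> C"
    then obtain x where x: "x \<in> C" "c = x [^] (k * e)" using C(3) by blast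
    then have "x [^] k \<in> C" using subgroup_int_pow_closed[OF C(1)] by simp
    moreover have "c = (x [^] k) [^] e"
      using x subgroup.mem_carrier[OF C(1)] by (simp add: int_pow_pow)
    ultimately show "\<exists>x\<in>C. c = x [^] e" by blast
  qed
  show ?case
  proof (cases "\<exists>t :: int. t > 0 \<and> g [^] t \<in> ?S")
    case True
    \<comment> \<open>The t-th powers of elements of the larger group lie in \<open>?S\<close>, so a
      subgroup consisting of its own (t e)-th powers lies in \<open>?S\<close> already.\<close>
    then obtain t :: int where t: "t > 0" "g [^] t \<in> ?S" by blast
    have "C = {\<one>}"
      if C: "subgroup C G" "C \<subseteq> generate G (insert g S)" "\<And>c. c \<in> C \<Longrightarrow> \<exists>x\<in>C. c = x [^] (t * e)" for C
    proof (rule step[OF C(1) _ C(3)])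
      show "C \<subseteq> ?S"
      proof
        fix c assume "c \<in> C"
        then obtain x where x: "x \<in> C" "c = x [^] (t * e)" using C(3) by blast
        then obtain i :: int and y where y: "y \<in> ?S" "x = g [^] i \<otimes> y"
          using C(2) generate_insert_decomposition[OF S g] by blast
        then have "x [^] t = (g [^] t) [^] i \<otimes> y [^] t"
          using g by (simp add: int_pow_mult_distrib m_comm int_pow_pow mult.commute)
        then have "x [^] t \<in> ?S" using t y Spow by simp
        moreover have "x \<in> carrier G" using g y by simp
        ultimately show "c \<in> ?S" using x Spow[of "x [^] t" e] by (simp add: int_pow_pow)
      qed
    qed
    moreover have "1 * e \<le> t * e" using t e by (intro mult_right_mono) auto
    then have "t * e > 1" using e by linarith
    ultimately show ?thesis by blast
  next
    case False
    have zero: "i = 0" if "g [^] i \<in> ?S" for i :: int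
    proof (rule ccontr)
      assume "i \<noteq> 0"
      moreover have "g [^] (- i) \<in> ?S" using that g by (simp add: int_pow_neg)
      ultimately show False using False that
        by (cases "i > 0") (auto dest: spec[of _ i] spec[of _ "- i"])
    qed
    have "C = {\<one>}"
      if C: "subgroup C G" "C \<subseteq> generate G (insert g S)" "\<And>c. c \<in> C \<Longrightarrow> \<exists>x\<in>C. c = x [^] (2 * e)" for C
    proof (rule step[OF C(1) _ C(3)])
      \<comment> \<open>The g-exponent is well defined modulo \<open>?S\<close> by
        \<open>zero\<close>. A root inside \<open>C\<close> has the exponent i / (2 e), so a nonzero
        exponent would descend forever.\<close>
      have descent: "i = 0" if "y \<in> ?S" "g [^] i \<otimes> y \<in> C" for i :: int and y
        using that
      proof (induction "nat \<bar>i\<bar>" arbitrary: i y rule: less_induct)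
        case less
        obtain x where x: "x \<in> C" "g [^] i \<otimes> y = x [^] (2 * e)" using C(3) less.prems by blast
        then obtain j :: int and z where z: "z \<in> ?S" "x = g [^] j \<otimes> z"
          using C(2) generate_insert_decomposition[OF S g] by blast
        have cl: "y \<in> carrier G" "z \<in> carrier G" using less.prems z by auto
        have "g [^] i \<otimes> y = g [^] (j * (2 * e)) \<otimes> z [^] (2 * e)"
          using x z cl g by (simp add: int_pow_mult_distrib m_comm int_pow_pow)
        then have "g [^] (i - j * (2 * e)) = z [^] (2 * e) \<otimes> inv y"
          using g cl by (simp add: int_pow_diff inv_solve_right' m_ac)
             (metis (no_types, opaque_lifting) int_pow_closed inv_closed inv_solve_left m_closed m_comm)
        then have i: "i = j * (2 * e)" using zero[of "i - j * (2 * e)"] Spow z less.prems by simp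
        show ?case
        proof (rule ccontr)
          assume "i \<noteq> 0"
          then have "\<bar>j\<bar> * 1 < \<bar>j\<bar> * (2 * e)" using i e by (intro mult_strict_left_mono) auto
          moreover have "\<bar>i\<bar> = \<bar>j\<bar> * (2 * e)" using i e by (simp add: abs_mult)
          ultimately have "\<bar>j\<bar> < \<bar>i\<bar>" by linarith
          then have "nat \<bar>j\<bar> < nat \<bar>i\<bar>" by simp
          then have "j = 0" using less.hyps[of j z] z x by blast
          then show False using i \<open>i \<noteq> 0\<close> by simp
        qed
      qed
      show "C \<subseteq> ?S"
      proof
        fix c assume c: "c \<in> C"
        then obtain i :: int and y where y: "y \<in> ?S" "c = g [^] i \<otimes> y"
          using C(2) generate_insert_decomposition[OF S g] by blast
        then have "i = 0" using descent c by blast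
        then show "c \<in> ?S" using y by simp
      qed
    qed
    moreover have "2 * e > 1" using e by simp
    ultimately show ?thesis by blast
  qed
qed

text \<open>The exponent of each generator matters only modulo e. The number of representatives will
  bound the number of nonperfect factors.\<close>

lemma (in comm_group) finite_power_cosets:
  fixes e :: int
  assumes "finite S" "S \<subseteq> carrier G" "e > 0"
  shows "\<exists>R. finite R \<and> R \<subseteq> carrier G \<and> (\<forall>x\<in>generate G S. \<exists>r\<in>R. \<exists>y\<in>carrier G. x = r \<otimes> y [^] e)"
  using assms(1,2)
proof (induction S rule: finite_induct)
  case empty
  show ?case by (intro exI[of _ "{\<one>}"]) (auto simp: generate_empty intro!: bexI[of _ \<one>])
next
  case (insert g S)
  then have S: "S \<subseteq> carrier G" and g: "g \<in> carrier G" by auto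
  obtain R where R: "finite R" "R \<subseteq> carrier G"
    "\<And>x. x \<in> generate G S \<Longrightarrow> \<exists>r\<in>R. \<exists>y\<in>carrier G. x = r \<otimes> y [^] e"
    using insert by auto
  define R' where "R' = (\<lambda>(i, r). g [^] i \<otimes> r) ` ({0..<e} \<times> R)"
  have "\<exists>r\<in>R'. \<exists>y\<in>carrier G. x = r \<otimes> y [^] e" if x: "x \<in> generate G (insert g S)" for x
  proof -
    obtain i :: int and z where z: "z \<in> generate G S" "x = g [^] i \<otimes> z"
      using generate_insert_decomposition[OF S g x] by blast
    obtain r y where ry: "r \<in> R" "y \<in> carrier G" "z = r \<otimes> y [^] e" using R(3)[OF z(1)] by blast
    have "g [^] i = g [^] (i mod e) \<otimes> (g [^] (i div e)) [^] e"
      using g by (simp add: int_pow_pow flip: int_pow_mult)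
    then have "x = (g [^] (i mod e) \<otimes> r) \<otimes> (g [^] (i div e) \<otimes> y) [^] e"
      using z ry R(2) g by (simp add: int_pow_mult_distrib m_comm m_ac subset_iff)
    moreover have "g [^] (i mod e) \<otimes> r \<in> R'"
      using ry assms(3) unfolding R'_def by (intro image_eqI[of _ _ "(i mod e, r)"]) auto
    ultimately show ?thesis using g ry by blast
  qed
  moreover have "finite R'" "R' \<subseteq> carrier G" using R g by (auto simp: R'_def)
  ultimately show ?case by blast
qed

section \<open>Families of direct factors and the nonperfect ones among them\<close>

definition orthogonal_factors ::
    "('a, 'b) monoid_scheme \<Rightarrow> nat set \<Rightarrow> (nat \<Rightarrow> 'a set) \<Rightarrow> (nat \<Rightarrow> 'a set) \<Rightarrow> bool" where
  "orthogonal_factors G I C D \<longleftrightarrow> finite I \<and> (\<forall>i\<in>I. internal_direct_product G (C i) (D i)) \<and>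
     (\<forall>i\<in>I. \<forall>j\<in>I. i \<noteq> j \<longrightarrow> C j \<subseteq> D i)"

text \<open>Applied to a projection onto a factor, this shows that elements of the factor in the
  derived subgroup of \<open>G\<close> lie in the derived subgroup of the factor. So a nonperfect
  factor survives in the abelianization.\<close>

lemma (in group) derived_hom_subset:
  assumes "group_hom G G \<pi>" "\<pi> ` carrier G \<subseteq> A" "x \<in> derived G (carrier G)"
  shows "\<pi> x \<in> derived G A"
proof -
  interpret \<pi>: group_hom G G \<pi> by fact
  have "\<pi> x \<in> derived G (\<pi> ` carrier G)" using assms(3) \<pi>.derived_img[of "carrier G"] by auto
  then show ?thesis using mono_derived[OF assms(2)] by blast
qed

text \<open>
  Modulo \<open>e\<close>-th powers and commutators, elements chosen in distinct non-perfect factors lie in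
  distinct cosets, because projecting to one of the factors kills the other one.
\<close>

lemma (in group) bounded_nonperfect_factors:
  assumes "finitely_generated G"
  shows "\<exists>m. \<forall>I C D. orthogonal_factors G I C D \<longrightarrow> (\<forall>i\<in>I. derived G (C i) \<noteq> C i) \<longrightarrow> card I \<le> m"
proof -
  obtain S where S: "finite S" "S \<subseteq> carrier G" "generate G S = carrier G"
    using assms by (auto simp: finitely_generated_def)
  define K where "K = derived G (carrier G)"
  interpret K: normal K G unfolding K_def by (rule derived_self_is_normal)
  define B where "B = G Mod K"
  interpret B: comm_group B unfolding B_def K_def by (rule derived_quot_is_comm_group)
  define h where "h = (\<lambda>a. K #> a)"
  interpret h: group_hom G B h
    using K.r_coset_hom_Mod unfolding h_def B_def
    by (intro group_hom.intro group_hom_axioms.intro K.factorgroup_is_group) auto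
  have surj: "\<exists>x\<in>carrier G. y = h x" if "y \<in> carrier B" for y
    using that by (auto simp: B_def h_def carrier_FactGroup)
  have hone: "h x = \<one>\<^bsub>B\<^esub> \<longleftrightarrow> x \<in> K" if "x \<in> carrier G" for x
    using that coset_join1[OF _ _ K.subgroup_axioms] coset_join2[OF _ K.subgroup_axioms]
    by (auto simp: B_def h_def)
  have gen: "generate B (h ` S) = carrier B"
  proof -
    have "h ` carrier G = carrier B" using surj h.hom_closed by blast
    then show ?thesis using h.generate_img[OF S(2)] S(3) by simp
  qed
  have hS: "finite (h ` S)" "h ` S \<subseteq> carrier B" using S by auto
  obtain e :: int where e: "e > 1" and e_no_div:
    "\<forall>C. subgroup C B \<and> C \<subseteq> carrier B \<and> (\<forall>c\<in>C. \<exists>x\<in>C. c = x [^]\<^bsub>B\<^esub> e) \<longrightarrow> C = {\<one>\<^bsub>B\<^esub>}"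
    using B.ex_exponent_no_divisible_subgroup[OF hS] unfolding gen by (elim exE conjE)
  have no_div: "C = {\<one>\<^bsub>B\<^esub>}"
    if "subgroup C B" "\<And>c. c \<in> C \<Longrightarrow> \<exists>x\<in>C. c = x [^]\<^bsub>B\<^esub> e" for C
    using e_no_div[rule_format, of C] subgroup.subset[OF that(1)] that by simp
  obtain R where R: "finite R" "R \<subseteq> carrier B"
    "\<And>x. x \<in> carrier B \<Longrightarrow> \<exists>r\<in>R. \<exists>y\<in>carrier B. x = r \<otimes>\<^bsub>B\<^esub> y [^]\<^bsub>B\<^esub> e"
    using B.finite_power_cosets[OF hS, of e] e unfolding gen by auto
  \<comment> \<open>Being an e-th power modulo \<open>K\<close> is inherited by images under
    endomorphisms, since these map the derived subgroup \<open>K\<close> into itself.\<close>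
  have project: "h (\<pi> c) = h (\<pi> y) [^]\<^bsub>B\<^esub> e"
    if \<pi>: "group_hom G G \<pi>" and cy: "c \<in> carrier G" "y \<in> carrier G" "h c = h y [^]\<^bsub>B\<^esub> e" for \<pi> c y
  proof -
    interpret \<pi>: group_hom G G \<pi> by fact
    have "h (c \<otimes> inv (y [^] e)) = \<one>\<^bsub>B\<^esub>" using cy by (simp add: h.hom_int_pow)
    moreover have "c \<otimes> inv (y [^] e) \<in> carrier G" using cy by simp
    ultimately have "c \<otimes> inv (y [^] e) \<in> K" using hone by blast
    then have "\<pi> (c \<otimes> inv (y [^] e)) \<in> K"
      unfolding K_def by (rule derived_hom_subset[OF \<pi>, rotated]) auto
    then have "\<pi> c \<otimes> inv (\<pi> y [^] e) \<in> K" using cy by (simp add: \<pi>.hom_int_pow)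
    moreover have "\<pi> c \<otimes> inv (\<pi> y [^] e) \<in> carrier G" using cy by simp
    ultimately have "h (\<pi> c \<otimes> inv (\<pi> y [^] e)) = \<one>\<^bsub>B\<^esub>" using hone by blast
    then have "h (\<pi> c) \<otimes>\<^bsub>B\<^esub> inv\<^bsub>B\<^esub> (h (\<pi> y) [^]\<^bsub>B\<^esub> e) = \<one>\<^bsub>B\<^esub>"
      using cy by (simp add: h.hom_int_pow)
    then show ?thesis using cy by (simp add: B.inv_solve_right')
  qed
  have "card I \<le> card R"
    if orth: "orthogonal_factors G I C D" and np: "\<And>i. i \<in> I \<Longrightarrow> derived G (C i) \<noteq> C i" for I C D
  proof -
    \<comment> \<open>Otherwise projecting the e-th roots into \<open>C i\<close> makes the image of
      \<open>C i\<close> consist of its own e-th powers, hence trivial by the choice of e. Then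
      \<open>C i \<subseteq> K\<close>, and projecting once more makes \<open>C i\<close>
      perfect.\<close>
    have "\<exists>x\<in>C i. \<forall>y\<in>carrier B. h x \<noteq> y [^]\<^bsub>B\<^esub> e" if i: "i \<in> I" for i
    proof (rule ccontr)
      assume "\<not> ?thesis"
      then have V: "\<And>x. x \<in> C i \<Longrightarrow> \<exists>y\<in>carrier B. h x = y [^]\<^bsub>B\<^esub> e" by blast
      have dp: "internal_direct_product G (C i) (D i)"
        using orth i by (simp add: orthogonal_factors_def)
      then have Ci: "subgroup (C i) G" by (simp add: internal_direct_product_iff)
      obtain \<pi> where \<pi>: "group_hom G G \<pi>" "\<And>x. x \<in> carrier G \<Longrightarrow> \<pi> x \<in> C i" "\<And>a. a \<in> C i \<Longrightarrow> \<pi> a = a"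
        using ex_projection[OF dp] by blast
      have "h ` C i = {\<one>\<^bsub>B\<^esub>}"
      proof (rule no_div)
        show "subgroup (h ` C i) B" by (rule h.subgroup_img_is_subgroup[OF Ci])
        fix c' assume "c' \<in> h ` C i"
        then obtain c where c: "c \<in> C i" "c' = h c" by blast
        obtain y' where y': "y' \<in> carrier B" "h c = y' [^]\<^bsub>B\<^esub> e" using V[OF c(1)] by blast
        obtain y where y: "y \<in> carrier G" "h c = h y [^]\<^bsub>B\<^esub> e" using surj[OF y'(1)] y'(2) by blast
        have "h (\<pi> c) = h (\<pi> y) [^]\<^bsub>B\<^esub> e"
          by (rule project[OF \<pi>(1) subgroup.mem_carrier[OF Ci c(1)] y])
        then have "c' = h (\<pi> y) [^]\<^bsub>B\<^esub> e" using c \<pi>(3) by simp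
        then show "\<exists>x\<in>h ` C i. c' = x [^]\<^bsub>B\<^esub> e"
          using \<pi>(2)[OF y(1)] by (rule bexI[OF _ imageI])
      qed
      then have "h c = \<one>\<^bsub>B\<^esub>" if "c \<in> C i" for c using that by auto
      then have "C i \<subseteq> K" using hone subgroup.mem_carrier[OF Ci] by auto
      then have "C i \<subseteq> derived G (C i)"
      proof (intro subsetI)
        fix c assume c: "c \<in> C i"
        then have "c \<in> derived G (carrier G)" using \<open>C i \<subseteq> K\<close> by (auto simp: K_def)
        then have "\<pi> c \<in> derived G (C i)"
          by (rule derived_hom_subset[OF \<pi>(1), rotated]) (use \<pi>(2) in auto)
        then show "c \<in> derived G (C i)" using \<pi>(3)[OF c] by simp
      qed
      moreover have "derived G (C i) \<subseteq> C i" by (rule derived_incl[OF order_refl Ci])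
      ultimately show False using np[OF i] by blast
    qed
    then obtain x where x: "\<And>i. i \<in> I \<Longrightarrow> x i \<in> C i"
      "\<And>i y. i \<in> I \<Longrightarrow> y \<in> carrier B \<Longrightarrow> h (x i) \<noteq> y [^]\<^bsub>B\<^esub> e" by metis
    have dp: "internal_direct_product G (C i) (D i)" if "i \<in> I" for i
      using orth that by (simp add: orthogonal_factors_def)
    then have xG: "x i \<in> carrier G" if "i \<in> I" for i
      using subgroup.mem_carrier[of "C i" G "x i"] dp[OF that] x(1)[OF that]
      unfolding internal_direct_product_iff by simp
    have "\<exists>r\<in>R. \<exists>y\<in>carrier B. h (x i) = r \<otimes>\<^bsub>B\<^esub> y [^]\<^bsub>B\<^esub> e" if "i \<in> I" for i
      using R(3)[of "h (x i)"] xG[OF that] by simp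
    then obtain r y where ry: "\<And>i. i \<in> I \<Longrightarrow> r i \<in> R" "\<And>i. i \<in> I \<Longrightarrow> y i \<in> carrier B"
      "\<And>i. i \<in> I \<Longrightarrow> h (x i) = r i \<otimes>\<^bsub>B\<^esub> y i [^]\<^bsub>B\<^esub> e" by metis
    have "inj_on r I"
    proof (rule inj_onI, rule ccontr)
      fix i j assume ij: "i \<in> I" "j \<in> I" "r i = r j" "i \<noteq> j"
      obtain \<pi> where \<pi>: "group_hom G G \<pi>" "\<And>x. x \<in> carrier G \<Longrightarrow> \<pi> x \<in> C i"
        "\<And>a. a \<in> C i \<Longrightarrow> \<pi> a = a" "\<And>b. b \<in> D i \<Longrightarrow> \<pi> b = \<one>"
        using ex_projection[OF dp[OF ij(1)]] by blast
      interpret \<pi>: group_hom G G \<pi> by fact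
      have "C j \<subseteq> D i" using orth ij unfolding orthogonal_factors_def by blast
      then have xj: "x j \<in> D i" using x(1)[OF ij(2)] by blast
      have rB: "r j \<in> carrier B" using ry(1) R(2) ij by auto
      obtain z where z: "z \<in> carrier G" "y i \<otimes>\<^bsub>B\<^esub> inv\<^bsub>B\<^esub> (y j) = h z"
        using surj[of "y i \<otimes>\<^bsub>B\<^esub> inv\<^bsub>B\<^esub> (y j)"] ry(2) ij by auto
      \<comment> \<open>Equal representatives cancel in the quotient of \<open>h (x i)\<close> by
        \<open>h (x j)\<close>, leaving an e-th power; its projection to \<open>C i\<close> is
        \<open>h (x i)\<close>, contrary to the choice of \<open>x i\<close>.\<close>
      have cancel: "r j \<otimes>\<^bsub>B\<^esub> (inv\<^bsub>B\<^esub> (r j) \<otimes>\<^bsub>B\<^esub> Y) = Y" if "Y \<in> carrier B" for Y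
        using that rB by (simp add: B.m_assoc[symmetric])
      have "h (x i \<otimes> inv (x j)) = h (x i) \<otimes>\<^bsub>B\<^esub> inv\<^bsub>B\<^esub> (h (x j))"
        using xG ij by simp
      also have "\<dots> = y i [^]\<^bsub>B\<^esub> e \<otimes>\<^bsub>B\<^esub> inv\<^bsub>B\<^esub> (y j [^]\<^bsub>B\<^esub> e)"
        using ry ij rB by (simp add: B.inv_mult_group B.m_ac cancel)
      also have "\<dots> = (y i \<otimes>\<^bsub>B\<^esub> inv\<^bsub>B\<^esub> (y j)) [^]\<^bsub>B\<^esub> e"
        using ry ij rB by (simp add: B.int_pow_mult_distrib B.m_comm B.int_pow_inv)
      finally have "h (x i \<otimes> inv (x j)) = h z [^]\<^bsub>B\<^esub> e" using z by simp
      then have "h (\<pi> (x i \<otimes> inv (x j))) = h (\<pi> z) [^]\<^bsub>B\<^esub> e"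
        by (rule project[OF \<pi>(1) _ z(1), rotated]) (use xG ij in simp)
      then have "h (x i) = h (\<pi> z) [^]\<^bsub>B\<^esub> e"
        using xG ij x \<pi>(3)[of "x i"] \<pi>(4)[OF xj] by simp
      then show False using x(2)[OF ij(1), of "h (\<pi> z)"] z by simp
    qed
    then show ?thesis using ry(1) R(1) by (intro card_inj_on_le[of r]) auto
  qed
  then show ?thesis by blast
qed

section \<open>Perfect direct factors\<close>

lemma (in group) projection_perfect_normal:
  assumes M: "M \<lhd> G" "derived G M = M" and dp: "internal_direct_product G E E'"
    and \<pi>: "group_hom G G \<pi>" "\<And>x. x \<in> carrier G \<Longrightarrow> \<pi> x \<in> E \<and> inv (\<pi> x) \<otimes> x \<in> E'"
    and x: "x \<in> M"
  shows "\<pi> x \<in> M"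
proof -
  interpret M: normal M G by fact
  interpret \<pi>: group_hom G G \<pi> by fact
  have E': "subgroup E' G" and comm: "\<And>a b. a \<in> E \<Longrightarrow> b \<in> E' \<Longrightarrow> a \<otimes> b = b \<otimes> a"
    using dp unfolding internal_direct_product_iff by blast+
  \<comment> \<open>Perfectness passes to the image, so it suffices to place commutators of images
    in \<open>M\<close>; normality of \<open>M\<close> will do that.\<close>
  have "\<pi> ` M = derived G (\<pi> ` M)"
    using \<pi>.derived_img[OF M.subset] M(2) by simp
  also have "\<dots> \<subseteq> M" unfolding derived_def
  proof (rule generate_subgroup_incl[OF _ M.subgroup_axioms], safe)
    fix m n assume mn: "m \<in> M" "n \<in> M"
    then have cl: "m \<in> carrier G" "n \<in> carrier G" by auto
    define a where "a = \<pi> m"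
    define b where "b = \<pi> n"
    define c where "c = inv a \<otimes> m"
    have ab: "a \<in> carrier G" "b \<in> carrier G" "b \<in> E" "c \<in> E'" using cl \<pi>(2) by (auto simp: a_def b_def c_def)
    then have c: "c \<in> carrier G" using subgroup.mem_carrier[OF E'] by blast
    have m: "m = a \<otimes> c" using ab cl by (simp add: c_def m_assoc[symmetric])
    \<comment> \<open>The component \<open>c\<close> of m in \<open>E'\<close> centralizes
      \<open>b\<close>, so the commutator of \<open>a\<close> and \<open>b\<close> equals that of m
      and \<open>b\<close>, and one entry in the normal subgroup \<open>M\<close> is enough.\<close>
    have "c \<otimes> b \<otimes> inv c = b \<otimes> c \<otimes> inv c" using comm[of b c] ab by simp
    then have "c \<otimes> b \<otimes> inv c = b" using ab c by (simp add: m_assoc)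
    then have "m \<otimes> b \<otimes> inv m = a \<otimes> b \<otimes> inv a"
      using ab c by (simp add: m inv_mult_group m_assoc[symmetric]) (simp add: m_assoc)
    then have "m \<otimes> (b \<otimes> inv m \<otimes> inv b) = a \<otimes> b \<otimes> inv a \<otimes> inv b"
      using ab cl by (simp add: m_assoc[symmetric])
    moreover have "m \<otimes> (b \<otimes> inv m \<otimes> inv b) \<in> M"
      using mn ab M.inv_op_closed2[of b "inv m"] by simp
    ultimately show "\<pi> m \<otimes> \<pi> n \<otimes> inv \<pi> m \<otimes> inv \<pi> n \<in> M" by (simp add: a_def b_def)
  qed
  finally show ?thesis using x by blast
qed

lemma (in group) commuting_set_mult_subgroup:
  assumes "subgroup A G" "subgroup B G" "\<And>a b. a \<in> A \<Longrightarrow> b \<in> B \<Longrightarrow> a \<otimes> b = b \<otimes> a"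
  shows "subgroup (A <#> B) G"
proof -
  interpret A: subgroup A G by fact
  interpret B: subgroup B G by fact
  have mem: "x \<in> A <#> B \<longleftrightarrow> (\<exists>a\<in>A. \<exists>b\<in>B. x = a \<otimes> b)" for x
    by (auto simp: set_mult_def)
  show ?thesis
  proof (rule subgroupI)
    show "A <#> B \<subseteq> carrier G" by (auto simp: mem)
    have "\<one> \<in> A <#> B" unfolding mem by (intro bexI[of _ \<one>]) auto
    then show "A <#> B \<noteq> {}" by blast
  next
    fix x assume "x \<in> A <#> B"
    then obtain a b where *: "a \<in> A" "b \<in> B" "x = a \<otimes> b" by (auto simp: mem)
    then have "inv x = inv a \<otimes> inv b"
      using assms(3)[of a b] by (simp add: inv_mult_group[symmetric])
    moreover have "inv a \<in> A" "inv b \<in> B" using * by auto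
    ultimately show "inv x \<in> A <#> B" unfolding mem by blast
  next
    fix x y assume "x \<in> A <#> B" "y \<in> A <#> B"
    then obtain a b c d where *: "a \<in> A" "b \<in> B" "x = a \<otimes> b" "c \<in> A" "d \<in> B" "y = c \<otimes> d"
      by (auto simp: mem)
    then have cl: "a \<in> carrier G" "b \<in> carrier G" "c \<in> carrier G" "d \<in> carrier G" by auto
    have "x \<otimes> y = a \<otimes> (b \<otimes> c) \<otimes> d" using * cl by (simp add: m_assoc)
    also have "b \<otimes> c = c \<otimes> b" using assms(3)[of c b] * by simp
    also have "a \<otimes> (c \<otimes> b) \<otimes> d = (a \<otimes> c) \<otimes> (b \<otimes> d)" using cl by (simp add: m_assoc)
    finally have "x \<otimes> y = (a \<otimes> c) \<otimes> (b \<otimes> d)" .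
    moreover have "a \<otimes> c \<in> A" "b \<otimes> d \<in> B" using * by auto
    ultimately show "x \<otimes> y \<in> A <#> B" unfolding mem by blast
  qed
qed

text \<open>By \<open>projection_perfect_normal\<close> both components of an element of
  \<open>M\<close> lie in \<open>M\<close>, so \<open>M\<close> splits as (M \<inter> E)(M \<inter>
  E'). Perfectness thus makes \<open>M\<close> compatible with a decomposition unrelated to
  it.\<close>

lemma (in group) perfect_factor_Int:
  assumes M: "internal_direct_product G M M'" "derived G M = M"
    and E: "internal_direct_product G E E'"
  shows "\<exists>W. internal_direct_product (G\<lparr>carrier := E\<rparr>) (M \<inter> E) W"
proof -
  have M': "subgroup M G" "subgroup M' G" "\<And>a b. a \<in> M \<Longrightarrow> b \<in> M' \<Longrightarrow> a \<otimes> b = b \<otimes> a"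
    "M \<inter> M' = {\<one>}" "\<And>x. x \<in> carrier G \<Longrightarrow> \<exists>a\<in>M. \<exists>b\<in>M'. x = a \<otimes> b"
    using M(1) unfolding internal_direct_product_iff by blast+
  have E': "subgroup E G" "subgroup E' G" "\<And>a b. a \<in> E \<Longrightarrow> b \<in> E' \<Longrightarrow> a \<otimes> b = b \<otimes> a"
    "E \<inter> E' = {\<one>}"
    using E unfolding internal_direct_product_iff by blast+
  interpret M: subgroup M G by fact
  interpret M': subgroup M' G by (fact M'(2))
  interpret E: subgroup E G by fact
  interpret E': subgroup E' G by (fact E'(2))
  have normal: "M \<lhd> G" using M(1) by (simp add: internal_direct_product_def)
  obtain \<pi> where \<pi>: "group_hom G G \<pi>" "\<And>x. x \<in> carrier G \<Longrightarrow> \<pi> x \<in> E \<and> inv (\<pi> x) \<otimes> x \<in> E'"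
    using ex_projection[OF E] by blast
  note \<pi>M = projection_perfect_normal[OF normal M(2) E \<pi>]
  \<comment> \<open>With \<open>M\<close> split this way, \<open>G\<close> is the product of M
    \<inter> E and (M \<inter> E') M'. Since the first lies in \<open>E\<close>, the trace of the
    second on \<open>E\<close> is its complement there.\<close>
  define W where "W = {x \<in> E. \<exists>b \<in> M \<inter> E'. \<exists>m\<in>M'. x = b \<otimes> m}"
  interpret GE: group "G\<lparr>carrier := E\<rparr>" by (rule E.subgroup_is_group[OF group_axioms])
  have "subgroup ((M \<inter> E') <#> M') G"
    by (rule commuting_set_mult_subgroup[OF subgroup_Int[OF M'(1) E'(2)] M'(2)]) (use M'(3) in blast)
  from subgroup_Int[OF E'(1) this] have subW: "subgroup W G"
    by (rule back_subst[of "\<lambda>S. subgroup S G"]) (auto simp: W_def set_mult_def)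
  have "internal_direct_product (G\<lparr>carrier := E\<rparr>) (M \<inter> E) W"
    unfolding GE.internal_direct_product_iff
  proof (intro conjI ballI)
    show "subgroup (M \<inter> E) (G\<lparr>carrier := E\<rparr>)"
      by (rule subgroup_incl[OF subgroup_Int[OF M'(1) E'(1)] E'(1)]) simp
    show "subgroup W (G\<lparr>carrier := E\<rparr>)"
      by (rule subgroup_incl[OF subW E'(1)]) (auto simp: W_def)
  next
    fix a w assume "a \<in> M \<inter> E" "w \<in> W"
    then obtain b m where *: "a \<in> M" "a \<in> E" "b \<in> M" "b \<in> E'" "m \<in> M'" "w = b \<otimes> m"
      by (auto simp: W_def)
    then have cl: "a \<in> carrier G" "b \<in> carrier G" "m \<in> carrier G" by auto
    have "a \<otimes> w = (a \<otimes> b) \<otimes> m" using * cl by (simp add: m_assoc)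
    also have "a \<otimes> b = b \<otimes> a" using E'(3)[of a b] * by blast
    also have "b \<otimes> a \<otimes> m = b \<otimes> (a \<otimes> m)" using cl by (simp add: m_assoc)
    also have "a \<otimes> m = m \<otimes> a" using M'(3)[of a m] * by blast
    finally show "a \<otimes>\<^bsub>G\<lparr>carrier := E\<rparr>\<^esub> w = w \<otimes>\<^bsub>G\<lparr>carrier := E\<rparr>\<^esub> a"
      using * cl by (simp add: m_assoc)
  next
    have "x = \<one>" if x: "x \<in> M" "x \<in> W" for x
    proof -
      obtain b m where *: "x \<in> E" "b \<in> M" "b \<in> E'" "m \<in> M'" "x = b \<otimes> m"
        using x by (auto simp: W_def)
      then have "inv b \<otimes> x = m" by (simp add: m_assoc[symmetric])
      moreover have "inv b \<otimes> x \<in> M" by (rule M.m_closed[OF M.m_inv_closed[OF *(2)] x(1)])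
      ultimately have "m = \<one>" using * M'(4) by blast
      then have "x \<in> E'" using * by simp
      then show ?thesis using * E'(4) by blast
    qed
    moreover have "\<one> \<in> W" by (rule subgroup.one_closed[OF subW])
    ultimately show "M \<inter> E \<inter> W = {\<one>\<^bsub>G\<lparr>carrier := E\<rparr>\<^esub>}" by auto
  next
    fix x assume "x \<in> carrier (G\<lparr>carrier := E\<rparr>)"
    then have x: "x \<in> E" "x \<in> carrier G" by auto
    then obtain m m' where m: "m \<in> M" "m' \<in> M'" "x = m \<otimes> m'" using M'(5) by blast
    then have cl: "m \<in> carrier G" "m' \<in> carrier G" by auto
    define a where "a = \<pi> m"
    define b where "b = inv a \<otimes> m"
    have a: "a \<in> M" "a \<in> E" "b \<in> E'" using m cl \<pi>M \<pi>(2) by (auto simp: a_def b_def)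
    then have b: "b \<in> M" using m by (simp add: b_def)
    have eq: "inv a \<otimes> x = b \<otimes> m'" using a m cl by (simp add: b_def m_assoc)
    have "inv a \<otimes> x \<in> E" using a x by simp
    then have "b \<otimes> m' \<in> W" using a b m eq unfolding W_def by auto
    moreover have "x = a \<otimes> (b \<otimes> m')" using a x by (simp add: eq[symmetric] m_assoc[symmetric])
    ultimately show "\<exists>a\<in>M \<inter> E. \<exists>b\<in>W. x = a \<otimes>\<^bsub>G\<lparr>carrier := E\<rparr>\<^esub> b" using a by auto
  qed
  then show ?thesis by blast
qed

text \<open>The common consequence of the two decomposability conditions. Generation by the factors
  suffices for what follows, so no direct product structure is recorded.\<close>

definition indecomposable_generation :: "('a, 'b) monoid_scheme \<Rightarrow> 'a set set \<Rightarrow> bool" where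
  "indecomposable_generation G \<E> \<longleftrightarrow> finite \<E> \<and> generate G (\<Union>\<E>) = carrier G \<and>
     (\<forall>E\<in>\<E>. direct_factor E G \<and> indecomposable (G\<lparr>carrier := E\<rparr>))"

lemma (in group) centralizer_subgroup:
  assumes "S \<subseteq> carrier G"
  shows "subgroup {g \<in> carrier G. \<forall>x\<in>S. g \<otimes> x = x \<otimes> g} G"
proof (rule subgroupI)
  show "{g \<in> carrier G. \<forall>x\<in>S. g \<otimes> x = x \<otimes> g} \<noteq> {}" using assms by (auto intro!: exI[of _ \<one>])
next
  fix g assume g: "g \<in> {g \<in> carrier G. \<forall>x\<in>S. g \<otimes> x = x \<otimes> g}"
  have "inv g \<otimes> x = x \<otimes> inv g" if "x \<in> S" for x
  proof -
    have x: "x \<in> carrier G" using that assms by blast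
    have "inv g \<otimes> x = inv g \<otimes> (x \<otimes> g) \<otimes> inv g" using g x by (simp add: m_assoc)
    also have "\<dots> = inv g \<otimes> (g \<otimes> x) \<otimes> inv g" using g that by simp
    also have "\<dots> = x \<otimes> inv g" using g x by (simp add: m_assoc[symmetric])
    finally show ?thesis .
  qed
  then show "inv g \<in> {g \<in> carrier G. \<forall>x\<in>S. g \<otimes> x = x \<otimes> g}" using g by simp
next
  fix g h assume gh: "g \<in> {g \<in> carrier G. \<forall>x\<in>S. g \<otimes> x = x \<otimes> g}"
    "h \<in> {g \<in> carrier G. \<forall>x\<in>S. g \<otimes> x = x \<otimes> g}"
  have "g \<otimes> h \<otimes> x = x \<otimes> (g \<otimes> h)" if "x \<in> S" for x
  proof -
    have x: "x \<in> carrier G" using that assms by blast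
    have "g \<otimes> h \<otimes> x = g \<otimes> (h \<otimes> x)" using gh x by (simp add: m_assoc)
    also have "h \<otimes> x = x \<otimes> h" using gh that by simp
    also have "g \<otimes> (x \<otimes> h) = (g \<otimes> x) \<otimes> h" using gh x by (simp add: m_assoc)
    also have "g \<otimes> x = x \<otimes> g" using gh that by simp
    also have "x \<otimes> g \<otimes> h = x \<otimes> (g \<otimes> h)" using gh x by (simp add: m_assoc)
    finally show ?thesis .
  qed
  then show "g \<otimes> h \<in> {g \<in> carrier G. \<forall>x\<in>S. g \<otimes> x = x \<otimes> g}" using gh by simp
qed auto

lemma (in group) commute_generate:
  assumes "S \<subseteq> carrier G" "T \<subseteq> carrier G" "\<And>x y. x \<in> S \<Longrightarrow> y \<in> T \<Longrightarrow> x \<otimes> y = y \<otimes> x"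
    and "x \<in> generate G S" "y \<in> generate G T"
  shows "x \<otimes> y = y \<otimes> x"
proof -
  have 1: "generate G S \<subseteq> {g \<in> carrier G. \<forall>y\<in>T. g \<otimes> y = y \<otimes> g}"
    by (rule generate_subgroup_incl[OF _ centralizer_subgroup[OF assms(2)]]) (use assms(1,3) in auto)
  have "generate G T \<subseteq> {g \<in> carrier G. \<forall>x\<in>generate G S. g \<otimes> x = x \<otimes> g}"
    by (rule generate_subgroup_incl[OF _ centralizer_subgroup[OF generate_incl[OF assms(1)]]])
       (use 1 assms(2) in force)
  then show ?thesis using assms(4,5) by force
qed

text \<open>Each indecomposable \<open>E\<close> is contained in \<open>M\<close> or meets it
  trivially, by \<open>perfect_factor_Int\<close>. If all met it trivially, normality would make
  \<open>M\<close> commute with all of them, hence be central and abelian; a perfect abelian group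
  is trivial.\<close>

lemma (in group) perfect_factor_contains_indecomposable:
  assumes \<E>: "indecomposable_generation G \<E>"
    and M: "internal_direct_product G M M'" "derived G M = M" "M \<noteq> {\<one>}"
  shows "\<exists>E\<in>\<E>. E \<subseteq> M"
proof (rule ccontr)
  assume neg: "\<not> ?thesis"
  have MG: "subgroup M G" "M \<lhd> G"
    using M(1) by (simp_all add: internal_direct_product_def normal_imp_subgroup)
  interpret M: subgroup M G by fact
  have E: "E \<lhd> G" "M \<inter> E = {\<one>}" if "E \<in> \<E>" for E
  proof -
    have df: "direct_factor E G" and indec: "indecomposable (G\<lparr>carrier := E\<rparr>)"
      using that \<E> by (simp_all add: indecomposable_generation_def)
    from df obtain E' where E': "internal_direct_product G E E'"
      unfolding direct_factor_def by (elim exE)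
    then show "E \<lhd> G" by (simp add: internal_direct_product_def)
    have sub: "subgroup E G" using E' by (simp add: internal_direct_product_iff)
    interpret GE: group "G\<lparr>carrier := E\<rparr>" by (rule subgroup.subgroup_is_group[OF sub group_axioms])
    obtain W where W: "internal_direct_product (G\<lparr>carrier := E\<rparr>) (M \<inter> E) W"
      using perfect_factor_Int[OF M(1,2) E'] by blast
    then consider "M \<inter> E = {\<one>}" | "W = {\<one>}"
      using indec unfolding indecomposable_def by auto
    then show "M \<inter> E = {\<one>}"
    proof cases
      case 2
      then have "E \<subseteq> M"
        using W subgroup.mem_carrier[OF sub] unfolding GE.internal_direct_product_iff by auto
      then show ?thesis using neg that by blast
    qed
  qed
  have EG: "\<Union>\<E> \<subseteq> carrier G" using E(1) normal_imp_subgroup subgroup.subset by blast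
  have "carrier G \<subseteq> {g \<in> carrier G. \<forall>x\<in>M. g \<otimes> x = x \<otimes> g}"
  proof -
    have "\<Union>\<E> \<subseteq> {g \<in> carrier G. \<forall>x\<in>M. g \<otimes> x = x \<otimes> g}"
    proof clarify
      fix x E assume x: "x \<in> E" "E \<in> \<E>"
      then have "x \<in> carrier G" using EG by blast
      moreover have "x \<otimes> m = m \<otimes> x" if "m \<in> M" for m
        using normal_imp_commuting[OF MG(2) E(1)[OF x(2)], of m x] E(2)[OF x(2)] that x(1) by simp
      ultimately show "x \<in> carrier G \<and> (\<forall>m\<in>M. x \<otimes> m = m \<otimes> x)" by blast
    qed
    from generate_subgroup_incl[OF this centralizer_subgroup[OF M.subset]] show ?thesis
      using \<E> by (simp add: indecomposable_generation_def)
  qed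
  then have comm: "g \<otimes> x = x \<otimes> g" if "g \<in> carrier G" "x \<in> M" for g x using that by blast
  have "derived G M \<subseteq> {\<one>}" unfolding derived_def
  proof (rule generate_subgroup_incl[OF _ triv_subgroup], safe)
    fix m n assume mn: "m \<in> M" "n \<in> M"
    then have "m \<otimes> n = n \<otimes> m" "m \<in> carrier G" "n \<in> carrier G" using comm by auto
    then have "m \<otimes> n \<otimes> inv m \<otimes> inv n = n \<otimes> m \<otimes> inv m \<otimes> inv n" by simp
    then show "m \<otimes> n \<otimes> inv m \<otimes> inv n = \<one>" using \<open>m \<in> carrier G\<close> \<open>n \<in> carrier G\<close> by (simp add: m_assoc)
  qed
  then show False using M(2,3) M.one_closed by blast
qed

lemma (in group) solvable_no_perfect_subgroup:
  assumes "solvable G" "subgroup M G" "derived G M = M"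
  shows "M = {\<one>}"
proof -
  obtain n where n: "(derived G ^^ n) (carrier G) = {\<one>}"
    using assms(1) solvable_iff_trivial_derived_seq by blast
  have "(derived G ^^ n) M = M" by (induction n) (simp_all add: assms(3))
  then have "M \<subseteq> {\<one>}" using mono_exp_of_derived[OF subgroup.subset[OF assms(2)], of n] n by simp
  then show ?thesis using subgroup.one_closed[OF assms(2)] by blast
qed

section \<open>Bounds on families of nontrivial factors\<close>

definition bounded_factors :: "('a, 'b) monoid_scheme \<Rightarrow> bool" where
  "bounded_factors G \<longleftrightarrow> (\<exists>l. \<forall>I C D. orthogonal_factors G I C D \<longrightarrow>
     (\<forall>i\<in>I. C i \<noteq> {\<one>\<^bsub>G\<^esub>}) \<longrightarrow> card I \<le> l)"

text \<open>The factors of such a family need not generate the group, which is what permits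
  separating the perfect members from the others.\<close>

lemma orthogonal_factors_subset:
  "orthogonal_factors G I C D \<Longrightarrow> J \<subseteq> I \<Longrightarrow> orthogonal_factors G J C D"
  unfolding orthogonal_factors_def by (blast intro: finite_subset)

text \<open>The nonperfect members are counted by \<open>bounded_nonperfect_factors\<close>, so only
  families of perfect factors are left to bound.\<close>

lemma (in group) bounded_factorsI:
  assumes fg: "finitely_generated G"
    and perfect: "\<And>I C D. orthogonal_factors G I C D \<Longrightarrow>
      (\<And>i. i \<in> I \<Longrightarrow> C i \<noteq> {\<one>}) \<Longrightarrow> (\<And>i. i \<in> I \<Longrightarrow> derived G (C i) = C i) \<Longrightarrow> card I \<le> l"
  shows "bounded_factors G"
proof -
  obtain m where m: "\<And>I C D. orthogonal_factors G I C D \<Longrightarrow> \<forall>i\<in>I. derived G (C i) \<noteq> C i \<Longrightarrow> card I \<le> m"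
    using bounded_nonperfect_factors[OF fg] by blast
  have "card I \<le> l + m" if orth: "orthogonal_factors G I C D" and nt: "\<forall>i\<in>I. C i \<noteq> {\<one>}" for I C D
  proof -
    define P where "P = {i \<in> I. derived G (C i) = C i}"
    have fin: "finite I" using orth by (simp add: orthogonal_factors_def)
    have "P \<subseteq> I" by (auto simp: P_def)
    have "card P \<le> l"
      by (rule perfect[OF orthogonal_factors_subset[OF orth \<open>P \<subseteq> I\<close>]]) (use nt in \<open>auto simp: P_def\<close>)
    moreover have "card (I - P) \<le> m"
      by (rule m[OF orthogonal_factors_subset[OF orth Diff_subset]]) (auto simp: P_def)
    moreover have "card I = card P + card (I - P)"
      using fin \<open>P \<subseteq> I\<close> by (metis card_Diff_subset card_mono finite_subset le_add_diff_inverse)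
    ultimately show ?thesis by linarith
  qed
  then show ?thesis unfolding bounded_factors_def by blast
qed

lemma (in group) solvable_imp_bounded_factors:
  assumes "finitely_generated G" "solvable G"
  shows "bounded_factors G"
proof (rule bounded_factorsI[OF assms(1), of 0])
  fix I C D
  assume *: "orthogonal_factors G I C D" "\<And>i. i \<in> I \<Longrightarrow> C i \<noteq> {\<one>}" "\<And>i. i \<in> I \<Longrightarrow> derived G (C i) = C i"
  have "I = {}"
  proof (rule ccontr)
    assume "I \<noteq> {}"
    then obtain i where i: "i \<in> I" by blast
    then have "subgroup (C i) G" using *(1)
      by (auto simp: orthogonal_factors_def internal_direct_product_iff)
    then show False using solvable_no_perfect_subgroup[OF assms(2) _ *(3)[OF i]] *(2)[OF i] by blast
  qed
  then show "card I \<le> 0" by simp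
qed

lemma (in group) indecomposable_generation_imp_bounded_factors:
  assumes "finitely_generated G" "indecomposable_generation G \<E>"
  shows "bounded_factors G"
proof (rule bounded_factorsI[OF assms(1), of "card \<E>"])
  fix I C D
  assume *: "orthogonal_factors G I C D" "\<And>i. i \<in> I \<Longrightarrow> C i \<noteq> {\<one>}" "\<And>i. i \<in> I \<Longrightarrow> derived G (C i) = C i"
  have dp: "internal_direct_product G (C i) (D i)" if "i \<in> I" for i
    using *(1) that by (simp add: orthogonal_factors_def)
  have "\<exists>E\<in>\<E>. E \<subseteq> C i" if "i \<in> I" for i
    by (rule perfect_factor_contains_indecomposable[OF assms(2) dp[OF that] *(3)[OF that] *(2)[OF that]])
  then obtain E where E: "\<And>i. i \<in> I \<Longrightarrow> E i \<in> \<E>" "\<And>i. i \<in> I \<Longrightarrow> E i \<subseteq> C i" by metis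
  \<comment> \<open>Two orthogonal factors cannot contain the same nontrivial subgroup, as one lies
    in a complement of the other.\<close>
  have "inj_on E I"
  proof (rule inj_onI, rule ccontr)
    fix i j assume ij: "i \<in> I" "j \<in> I" "E i = E j" "i \<noteq> j"
    then have "C j \<subseteq> D i" using *(1) unfolding orthogonal_factors_def by blast
    then have "E i \<subseteq> C i \<inter> D i" using E(2)[OF ij(1)] E(2)[OF ij(2)] ij(3) by blast
    moreover have "C i \<inter> D i = {\<one>}" using dp[OF ij(1)] by (simp add: internal_direct_product_def)
    ultimately have sub: "E i \<subseteq> {\<one>}" by blast
    have "direct_factor (E i) G" "E i \<noteq> {\<one>}"
      using E(1)[OF ij(1)] assms(2) by (auto simp: indecomposable_generation_def indecomposable_def)
    then have "\<one> \<in> E i" by (auto simp: direct_factor_def internal_direct_product_def)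
    then show False using sub \<open>E i \<noteq> {\<one>}\<close> by blast
  qed
  moreover have "finite \<E>" using assms(2) by (simp add: indecomposable_generation_def)
  ultimately show "card I \<le> card \<E>" using E(1) by (intro card_inj_on_le[of E]) auto
qed

section \<open>Splitting off indecomposable factors\<close>

lemma (in group) internal_direct_product_assoc:
  assumes C: "internal_direct_product G C W"
    and AB: "internal_direct_product (G\<lparr>carrier := C\<rparr>) A B"
  shows "internal_direct_product G A (B <#> W)"
proof -
  have C': "subgroup C G" "subgroup W G" "\<And>a b. a \<in> C \<Longrightarrow> b \<in> W \<Longrightarrow> a \<otimes> b = b \<otimes> a"
    "C \<inter> W = {\<one>}" "\<And>x. x \<in> carrier G \<Longrightarrow> \<exists>a\<in>C. \<exists>b\<in>W. x = a \<otimes> b"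
    using C unfolding internal_direct_product_iff by blast+
  interpret C: subgroup C G by fact
  interpret W: subgroup W G by fact
  interpret GC: group "G\<lparr>carrier := C\<rparr>" by (rule C.subgroup_is_group[OF group_axioms])
  have AB': "subgroup A (G\<lparr>carrier := C\<rparr>)" "subgroup B (G\<lparr>carrier := C\<rparr>)"
    "\<And>a b. a \<in> A \<Longrightarrow> b \<in> B \<Longrightarrow> a \<otimes> b = b \<otimes> a"
    "A \<inter> B = {\<one>}" "\<And>x. x \<in> C \<Longrightarrow> \<exists>a\<in>A. \<exists>b\<in>B. x = a \<otimes> b"
    using AB unfolding GC.internal_direct_product_iff by auto
  then have sub: "subgroup A G" "subgroup B G" "A \<subseteq> C" "B \<subseteq> C"
    using incl_subgroup[OF C'(1)] subgroup.subset by force+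
  interpret A: subgroup A G by fact
  interpret B: subgroup B G by fact
  have mem: "x \<in> B <#> W \<longleftrightarrow> (\<exists>a\<in>B. \<exists>b\<in>W. x = a \<otimes> b)" for x
    by (auto simp: set_mult_def)
  have BW: "subgroup (B <#> W) G"
    by (rule commuting_set_mult_subgroup[OF sub(2) C'(2)]) (use C'(3) sub(4) in blast)
  show ?thesis unfolding internal_direct_product_iff
  proof (intro conjI ballI sub BW)
    fix a x assume a: "a \<in> A" and "x \<in> B <#> W"
    then obtain b w where *: "b \<in> B" "w \<in> W" "x = b \<otimes> w" by (auto simp: mem)
    have "a \<otimes> x = (a \<otimes> b) \<otimes> w" using a * by (simp add: m_assoc)
    also have "a \<otimes> b = b \<otimes> a" using AB'(3) a * by blast
    also have "b \<otimes> a \<otimes> w = b \<otimes> (a \<otimes> w)" using a * by (simp add: m_assoc)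
    also have "a \<otimes> w = w \<otimes> a" using C'(3)[of a w] a * sub(3) by blast
    finally show "a \<otimes> x = x \<otimes> a" using a * by (simp add: m_assoc)
  next
    have "x = \<one>" if x: "x \<in> A" "x \<in> B <#> W" for x
    proof -
      obtain b w where *: "b \<in> B" "w \<in> W" "x = b \<otimes> w" using x by (auto simp: mem)
      then have "inv b \<otimes> x = w" by (simp add: m_assoc[symmetric])
      moreover have "inv b \<in> C" using B.m_inv_closed[OF *(1)] sub(4) by blast
      then have "inv b \<otimes> x \<in> C" using x(1) sub(3) by blast
      ultimately have "w = \<one>" using * C'(4) by blast
      then have "x \<in> B" using * by simp
      then show ?thesis using x AB'(4) by blast
    qed
    moreover have "\<one> \<in> B <#> W" by (rule subgroup.one_closed[OF BW])
    ultimately show "A \<inter> (B <#> W) = {\<one>}" by auto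
  next
    fix x assume "x \<in> carrier G"
    then obtain c w where *: "c \<in> C" "w \<in> W" "x = c \<otimes> w" using C'(5) by blast
    obtain a b where **: "a \<in> A" "b \<in> B" "c = a \<otimes> b" using AB'(5)[OF *(1)] by blast
    have "x = a \<otimes> (b \<otimes> w)" using * ** by (simp add: m_assoc)
    moreover have "b \<otimes> w \<in> B <#> W" using * ** unfolding mem by blast
    ultimately show "\<exists>a\<in>A. \<exists>b\<in>B <#> W. x = a \<otimes> b" using **(1) by blast
  qed
qed

lemma (in group) generate_subgroup_self: "subgroup E G \<Longrightarrow> generate G E = E"
  using generate_subgroup_incl[of E E] by (auto intro: generate.incl)

text \<open>Splitting forever produces descending factors, while the hypothesis is about ascending
  chains. The chain to use is that of the complements.\<close>

lemma (in group) max_condition_imp_indecomposable_generation: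
  assumes max: "max_condition_direct_factors G"
  shows "\<exists>\<E>. indecomposable_generation G \<E>"
proof (rule ccontr)
  assume no: "\<not> ?thesis"
  define good where "good A \<longleftrightarrow> (\<exists>\<E>. finite \<E> \<and> generate G (\<Union>\<E>) = A \<and>
    (\<forall>E\<in>\<E>. direct_factor E G \<and> indecomposable (G\<lparr>carrier := E\<rparr>)))" for A
  \<comment> \<open>The complement is carried along with the factor so that consecutive complements
    are nested: when C = A \<times> B with complement W, the next complement is
    \<open>B <#> W\<close>.\<close>
  define bad where "bad s \<longleftrightarrow> internal_direct_product G (fst s) (snd s) \<and> \<not> good (fst s)" for s
  have step: "\<exists>t. bad t \<and> snd s \<subset> snd t" if s: "bad s" for s
  proof -
    obtain C W where CW: "s = (C, W)" by (cases s)
    have C: "internal_direct_product G C W" "\<not> good C" using s by (auto simp: bad_def CW)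
    have sub: "subgroup C G" "subgroup W G" using C(1) by (simp_all add: internal_direct_product_iff)
    interpret C: subgroup C G by fact
    interpret W: subgroup W G by fact
    interpret GC: group "G\<lparr>carrier := C\<rparr>" by (rule C.subgroup_is_group[OF group_axioms])
    have "good {\<one>}" unfolding good_def by (intro exI[of _ "{}"]) (simp add: generate_empty)
    then have "C \<noteq> {\<one>}" using C(2) by blast
    moreover have "\<not> indecomposable (G\<lparr>carrier := C\<rparr>)"
    proof
      assume "indecomposable (G\<lparr>carrier := C\<rparr>)"
      moreover have "direct_factor C G" using C(1) unfolding direct_factor_def by (rule exI)
      ultimately have "good C" unfolding good_def
        using generate_subgroup_self[OF sub(1)] by (intro exI[of _ "{C}"]) simp
      then show False using C(2) by simp
    qed
    ultimately obtain A B where AB: "internal_direct_product (G\<lparr>carrier := C\<rparr>) A B" "A \<noteq> {\<one>}" "B \<noteq> {\<one>}"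
      using GC.group_axioms unfolding indecomposable_def by auto
    have BA: "internal_direct_product (G\<lparr>carrier := C\<rparr>) B A"
      using AB(1) by (simp add: GC.internal_direct_product_commute)
    have "\<not> (good A \<and> good B)"
    proof
      assume "good A \<and> good B"
      then obtain \<E> \<F> where EF: "finite \<E>" "generate G (\<Union>\<E>) = A" "finite \<F>" "generate G (\<Union>\<F>) = B"
        "\<forall>E\<in>\<E>. direct_factor E G \<and> indecomposable (G\<lparr>carrier := E\<rparr>)"
        "\<forall>E\<in>\<F>. direct_factor E G \<and> indecomposable (G\<lparr>carrier := E\<rparr>)"
        unfolding good_def by blast
      have ABC: "A \<subseteq> C" "B \<subseteq> C"
        using AB(1) BA subgroup.subset unfolding GC.internal_direct_product_iff by force+
      have "generate G (\<Union>(\<E> \<union> \<F>)) = C"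
      proof
        have "\<Union>\<E> \<subseteq> A" "\<Union>\<F> \<subseteq> B" using EF(2,4) by (auto intro: generate.incl)
        then show "generate G (\<Union>(\<E> \<union> \<F>)) \<subseteq> C"
          using ABC by (intro generate_subgroup_incl[OF _ sub(1)]) auto
      next
        show "C \<subseteq> generate G (\<Union>(\<E> \<union> \<F>))"
        proof
          fix x assume "x \<in> C"
          then obtain a b where ab: "a \<in> A" "b \<in> B" "x = a \<otimes> b"
            using AB(1) unfolding GC.internal_direct_product_iff by auto
          have "a \<in> generate G (\<Union>(\<E> \<union> \<F>))" "b \<in> generate G (\<Union>(\<E> \<union> \<F>))"
            using ab EF(2,4) mono_generate[of "\<Union>\<E>" "\<Union>(\<E> \<union> \<F>)"] mono_generate[of "\<Union>\<F>" "\<Union>(\<E> \<union> \<F>)"]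
            by blast+
          then show "x \<in> generate G (\<Union>(\<E> \<union> \<F>))" using ab(3) by (simp add: generate.eng)
        qed
      qed
      then have "good C" unfolding good_def using EF by (intro exI[of _ "\<E> \<union> \<F>"]) auto
      then show False using C(2) by simp
    qed
    \<comment> \<open>The dropped piece \<open>T\<close> lies in \<open>C\<close>, which meets
      \<open>W\<close> trivially, so a nontrivial \<open>T\<close> makes the complement strictly
      larger.\<close>
    moreover have grow: "W \<subset> T <#> W" if ST: "internal_direct_product (G\<lparr>carrier := C\<rparr>) S T" "T \<noteq> {\<one>}" for S T
    proof -
      have T: "subgroup T (G\<lparr>carrier := C\<rparr>)" using ST(1) by (simp add: GC.internal_direct_product_iff)
      then have T': "subgroup T G" "T \<subseteq> C" using incl_subgroup[OF sub(1)] subgroup.subset by force+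
      interpret T: subgroup T G by fact
      have mem: "x \<in> T <#> W \<longleftrightarrow> (\<exists>a\<in>T. \<exists>b\<in>W. x = a \<otimes> b)" for x
        by (auto simp: set_mult_def)
      have "W \<subseteq> T <#> W"
      proof
        fix w assume "w \<in> W"
        then have "w = \<one> \<otimes> w" by simp
        then show "w \<in> T <#> W" unfolding mem using \<open>w \<in> W\<close> T.one_closed by blast
      qed
      moreover obtain t where t: "t \<in> T" "t \<noteq> \<one>" using ST(2) T.one_closed by blast
      have "t \<in> T <#> W" unfolding mem using t by (intro bexI[of _ t] bexI[of _ \<one>]) auto
      moreover have "t \<notin> W"
      proof
        assume "t \<in> W"
        moreover have "t \<in> C" using t T'(2) by blast
        moreover have "C \<inter> W = {\<one>}" using C(1) by (simp add: internal_direct_product_def)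
        ultimately show False using t(2) by blast
      qed
      ultimately show ?thesis by blast
    qed
    ultimately consider "\<not> good A" | "\<not> good B" by blast
    then show ?thesis
    proof cases
      case 1
      then show ?thesis using internal_direct_product_assoc[OF C(1) AB(1)] grow[OF AB(1,3)]
        by (intro exI[of _ "(A, B <#> W)"]) (simp add: bad_def CW)
    next
      case 2
      then show ?thesis using internal_direct_product_assoc[OF C(1) BA] grow[OF BA AB(2)]
        by (intro exI[of _ "(B, A <#> W)"]) (simp add: bad_def CW)
    qed
  qed
  have "internal_direct_product G (carrier G) {\<one>}"
    unfolding internal_direct_product_iff using subgroup_self triv_subgroup by auto
  moreover have "\<not> good (carrier G)"
    using no unfolding good_def indecomposable_generation_def by simp
  ultimately have "bad (carrier G, {\<one>})" by (simp add: bad_def)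
  then have "\<exists>s. bad s" by (rule exI)
  then have "\<exists>f. \<forall>n :: nat. bad (f n) \<and> snd (f n) \<subset> snd (f (Suc n))"
    by (rule dependent_nat_choice) (rule step)
  then obtain f where f: "\<And>n :: nat. bad (f n)" "\<And>n. snd (f n) \<subset> snd (f (Suc n))" by metis
  have "direct_factor (snd (f n)) G" for n
  proof -
    have "internal_direct_product G (fst (f n)) (snd (f n))" using f(1)[of n] by (simp add: bad_def)
    then have "internal_direct_product G (snd (f n)) (fst (f n))"
      by (simp add: internal_direct_product_commute)
    then show ?thesis unfolding direct_factor_def by (rule exI)
  qed
  then show False using max f(2) unfolding max_condition_direct_factors_def
    by (elim notE) (intro exI[of _ "\<lambda>n. snd (f n)"] conjI allI)
qed

section \<open>Transport along isomorphisms and external products\<close>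

lemma iso_internal_direct_product:
  assumes G: "group G" and H: "group H" and \<phi>: "\<phi> \<in> iso G H" and dp: "internal_direct_product G A B"
  shows "internal_direct_product H (\<phi> ` A) (\<phi> ` B)"
proof -
  interpret G: group G by fact
  interpret H: group H by fact
  interpret \<phi>: group_hom G H \<phi>
    using \<phi> G H by (simp add: group_hom_def group_hom_axioms_def iso_def)
  have bij: "bij_betw \<phi> (carrier G) (carrier H)" using \<phi> by (simp add: iso_def)
  have AB: "subgroup A G" "subgroup B G" "\<And>a b. a \<in> A \<Longrightarrow> b \<in> B \<Longrightarrow> a \<otimes>\<^bsub>G\<^esub> b = b \<otimes>\<^bsub>G\<^esub> a"
    "A \<inter> B = {\<one>\<^bsub>G\<^esub>}" "\<And>x. x \<in> carrier G \<Longrightarrow> \<exists>a\<in>A. \<exists>b\<in>B. x = a \<otimes>\<^bsub>G\<^esub> b"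
    using dp unfolding G.internal_direct_product_iff by blast+
  then have AB': "A \<subseteq> carrier G" "B \<subseteq> carrier G" by (auto dest: subgroup.subset)
  show ?thesis unfolding H.internal_direct_product_iff
  proof (intro conjI ballI)
    show "subgroup (\<phi> ` A) H" "subgroup (\<phi> ` B) H"
      using AB \<phi>.subgroup_img_is_subgroup by auto
  next
    fix a b assume "a \<in> \<phi> ` A" "b \<in> \<phi> ` B"
    then obtain a' b' where *: "a' \<in> A" "b' \<in> B" "a = \<phi> a'" "b = \<phi> b'" by blast
    then have "a' \<in> carrier G" "b' \<in> carrier G" using AB' by auto
    then show "a \<otimes>\<^bsub>H\<^esub> b = b \<otimes>\<^bsub>H\<^esub> a" using AB(3)[OF *(1,2)] * by (metis \<phi>.hom_mult)
  next
    have "\<phi> ` A \<inter> \<phi> ` B = \<phi> ` (A \<inter> B)"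
      using bij AB' by (metis bij_betw_def inj_on_image_Int)
    then show "\<phi> ` A \<inter> \<phi> ` B = {\<one>\<^bsub>H\<^esub>}" using AB(4) by simp
  next
    fix x assume "x \<in> carrier H"
    then obtain y where y: "y \<in> carrier G" "x = \<phi> y" using bij by (auto simp: bij_betw_def)
    obtain a b where ab: "a \<in> A" "b \<in> B" "y = a \<otimes>\<^bsub>G\<^esub> b" using AB(5)[OF y(1)] by blast
    then have "a \<in> carrier G" "b \<in> carrier G" using AB' by auto
    then have "x = \<phi> a \<otimes>\<^bsub>H\<^esub> \<phi> b" using y(2) ab(3) by simp
    then show "\<exists>a\<in>\<phi> ` A. \<exists>b\<in>\<phi> ` B. x = a \<otimes>\<^bsub>H\<^esub> b" using ab by blast
  qed
qed

lemma iso_indecomposable: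
  assumes H: "group H" and \<phi>: "\<phi> \<in> iso G H" and G: "indecomposable G"
  shows "indecomposable H"
proof -
  have G': "group G" using G by (simp add: indecomposable_def)
  interpret \<phi>: group_hom G H \<phi>
    using \<phi> G' H by (simp add: group_hom_def group_hom_axioms_def iso_def)
  have bij: "bij_betw \<phi> (carrier G) (carrier H)" using \<phi> by (simp add: iso_def)
  define \<psi> where "\<psi> = inv_into (carrier G) \<phi>"
  have \<psi>: "\<psi> \<in> iso H G" unfolding \<psi>_def by (rule group.iso_set_sym[OF G' \<phi>])
  have one: "\<psi> ` A = {\<one>\<^bsub>G\<^esub>} \<Longrightarrow> A = {\<one>\<^bsub>H\<^esub>}" if "A \<subseteq> carrier H" for A
  proof -
    assume A: "\<psi> ` A = {\<one>\<^bsub>G\<^esub>}"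
    have "\<phi> ` \<psi> ` A = A" using that bij by (force simp: \<psi>_def bij_betw_def f_inv_into_f)
    then show ?thesis using A by simp
  qed
  have "carrier H \<noteq> {\<one>\<^bsub>H\<^esub>}"
  proof
    assume "carrier H = {\<one>\<^bsub>H\<^esub>}"
    then have "\<And>x. x \<in> carrier G \<Longrightarrow> \<phi> x = \<phi> \<one>\<^bsub>G\<^esub>" using \<phi>.hom_closed by simp
    then have "carrier G = {\<one>\<^bsub>G\<^esub>}" using bij by (auto simp: bij_betw_def inj_on_def)
    then show False using G by (simp add: indecomposable_def)
  qed
  moreover have "A = {\<one>\<^bsub>H\<^esub>} \<or> B = {\<one>\<^bsub>H\<^esub>}" if AB: "internal_direct_product H A B" for A B
  proof -
    have "A \<subseteq> carrier H" "B \<subseteq> carrier H"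
      using AB by (auto simp: internal_direct_product_def dest: normal_imp_subgroup subgroup.subset)
    moreover have "\<psi> ` A = {\<one>\<^bsub>G\<^esub>} \<or> \<psi> ` B = {\<one>\<^bsub>G\<^esub>}"
      using iso_internal_direct_product[OF H G' \<psi> AB] G unfolding indecomposable_def by blast
    ultimately show ?thesis using one by blast
  qed
  ultimately show ?thesis using H unfolding indecomposable_def by blast
qed

lemma (in group) finite_product_imp_indecomposable_generation:
  assumes "finite_product_of_indecomposables G"
  shows "\<exists>\<E>. indecomposable_generation G \<E>"
proof -
  obtain n :: nat and K :: "nat \<Rightarrow> 'a monoid" where K: "\<And>i. i < n \<Longrightarrow> indecomposable (K i)"
    and "product_group {..<n} K \<cong> G"
    using assms unfolding finite_product_of_indecomposables_def by blast
  then obtain \<phi> where \<phi>: "\<phi> \<in> iso (product_group {..<n} K) G"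
    unfolding is_iso_def by blast
  define P where "P = product_group {..<n} K"
  have Kg: "group (K i)" if "i < n" for i using K[OF that] by (simp add: indecomposable_def)
  have P: "group P" unfolding P_def by (rule product_group) (simp add: Kg)
  interpret P: group P by fact
  note \<phi> = \<phi>[folded P_def]
  interpret \<phi>: group_hom P G \<phi>
    using \<phi> P group_axioms by (simp add: group_hom_def group_hom_axioms_def iso_def)
  have bij: "bij_betw \<phi> (carrier P) (carrier G)" using \<phi> by (simp add: iso_def)
  define \<iota> where "\<iota> t k = (\<lambda>i\<in>{..<n}. if i = t then k else \<one>\<^bsub>K i\<^esub>)" for t k
  have \<iota>_in: "\<iota> t k \<in> carrier P" if "t < n" "k \<in> carrier (K t)" for t k
    using that Kg group.is_monoid monoid.one_closed by (fastforce simp: P_def \<iota>_def)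
  have \<iota>_mult: "\<iota> t (k \<otimes>\<^bsub>K t\<^esub> l) = \<iota> t k \<otimes>\<^bsub>P\<^esub> \<iota> t l"
    if "t < n" "k \<in> carrier (K t)" "l \<in> carrier (K t)" for t k l
    using that Kg by (auto simp: P_def \<iota>_def group.is_monoid fun_eq_iff)
  define E where "E t = \<phi> ` \<iota> t ` carrier (K t)" for t
  have \<iota>_hom: "group_hom (K t) P (\<iota> t)" if "t < n" for t
    using that \<iota>_in \<iota>_mult Kg P by (auto simp: group_hom_def group_hom_axioms_def hom_def)
  have sub: "subgroup (\<iota> t ` carrier (K t)) P" if "t < n" for t
    using group_hom.img_is_subgroup[OF \<iota>_hom[OF that]] .
  have factor: "direct_factor (E t) G" if t: "t < n" for t
  proof -
    define D where "D = {x \<in> carrier P. x t = \<one>\<^bsub>K t\<^esub>}"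
    interpret Kt: group "K t" by (rule Kg[OF t])
    have proj: "group_hom P (K t) (\<lambda>x. x t)"
      using t P Kt.group_axioms by (auto simp: group_hom_def group_hom_axioms_def hom_def P_def)
    interpret proj: group_hom P "K t" "\<lambda>x. x t" by (rule proj)
    have D: "D = kernel P (K t) (\<lambda>x. x t)" by (simp add: D_def kernel_def)
    have "internal_direct_product P (\<iota> t ` carrier (K t)) D"
      unfolding P.internal_direct_product_iff
    proof (intro conjI ballI sub t)
      show "subgroup D P" unfolding D by (rule proj.subgroup_kernel)
    next
      fix a b assume "a \<in> \<iota> t ` carrier (K t)" "b \<in> D"
      then obtain k where k: "k \<in> carrier (K t)" "a = \<iota> t k" by blast
      have b: "b i \<in> carrier (K i)" if "i < n" for i
        using PiE_mem[of b "{..<n}" "\<lambda>i. carrier (K i)" i] \<open>b \<in> D\<close> that by (simp add: D_def P_def)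
      show "a \<otimes>\<^bsub>P\<^esub> b = b \<otimes>\<^bsub>P\<^esub> a"
      proof (rule ext)
        fix i
        have "b t = \<one>\<^bsub>K t\<^esub>" using \<open>b \<in> D\<close> by (simp add: D_def)
        then show "(a \<otimes>\<^bsub>P\<^esub> b) i = (b \<otimes>\<^bsub>P\<^esub> a) i"
          using k(1) b[of i] Kg[of i] by (auto simp: k(2) P_def \<iota>_def group.is_monoid)
      qed
    next
      have "x = \<one>\<^bsub>P\<^esub>" if x: "x \<in> \<iota> t ` carrier (K t)" "x \<in> D" for x
      proof -
        obtain k where k: "x = \<iota> t k" using x(1) by blast
        moreover have "x t = \<one>\<^bsub>K t\<^esub>" using x(2) by (simp add: D_def)
        ultimately have "k = \<one>\<^bsub>K t\<^esub>" using t by (simp add: \<iota>_def)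
        then show ?thesis unfolding k by (auto simp: \<iota>_def P_def)
      qed
      moreover have "\<one>\<^bsub>P\<^esub> \<in> D" unfolding D by (rule subgroup.one_closed[OF proj.subgroup_kernel])
      ultimately show "\<iota> t ` carrier (K t) \<inter> D = {\<one>\<^bsub>P\<^esub>}"
        using subgroup.one_closed[OF sub[OF t]] by blast
    next
      fix x assume x: "x \<in> carrier P"
      define y where "y = (\<lambda>i\<in>{..<n}. if i = t then \<one>\<^bsub>K t\<^esub> else x i)"
      have xi: "x i \<in> carrier (K i)" if "i < n" for i
        using PiE_mem[of x "{..<n}" "\<lambda>i. carrier (K i)" i] x that by (simp add: P_def)
      have "y \<in> carrier P" unfolding P_def carrier_product_group y_def
        by (rule restrict_PiE_iff[THEN iffD2]) (use xi in auto)
      then have "y \<in> D" using t by (simp add: D_def y_def)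
      moreover have "x t \<in> carrier (K t)" by (rule xi[OF t])
      moreover have "x = \<iota> t (x t) \<otimes>\<^bsub>P\<^esub> y"
      proof
        fix i
        have "\<not> i < n \<Longrightarrow> x i = undefined"
          using PiE_arb[of x "{..<n}" "\<lambda>i. carrier (K i)" i] x by (simp add: P_def)
        with xi[of i] show "x i = (\<iota> t (x t) \<otimes>\<^bsub>P\<^esub> y) i"
          using t Kg[of i] by (auto simp: P_def \<iota>_def y_def group.is_monoid)
      qed
      ultimately show "\<exists>a\<in>\<iota> t ` carrier (K t). \<exists>b\<in>D. x = a \<otimes>\<^bsub>P\<^esub> b" by blast
    qed
    then have "internal_direct_product G (E t) (\<phi> ` D)" unfolding E_def
      by (rule iso_internal_direct_product[OF P group_axioms \<phi>])
    then show ?thesis unfolding direct_factor_def by (rule exI)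
  qed
  have indec: "indecomposable (G\<lparr>carrier := E t\<rparr>)" if t: "t < n" for t
  proof (rule iso_indecomposable[OF _ _ K[OF t]])
    have "subgroup (E t) G" unfolding E_def by (rule \<phi>.subgroup_img_is_subgroup[OF sub[OF t]])
    then show "group (G\<lparr>carrier := E t\<rparr>)" using subgroup.subgroup_is_group group_axioms by blast
    interpret \<iota>: group_hom "K t" P "\<iota> t" by (rule \<iota>_hom[OF t])
    have "inj_on (\<iota> t) (carrier (K t))"
    proof (rule inj_onI)
      fix k l assume "\<iota> t k = \<iota> t l"
      then have "\<iota> t k t = \<iota> t l t" by simp
      then show "k = l" using t by (simp add: \<iota>_def)
    qed
    moreover have "inj_on \<phi> (\<iota> t ` carrier (K t))"
      by (rule inj_on_subset[OF bij_betw_imp_inj_on[OF bij]]) (use \<iota>_in[OF t] in auto)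
    ultimately have "inj_on (\<phi> \<circ> \<iota> t) (carrier (K t))" by (rule comp_inj_on)
    then show "\<phi> \<circ> \<iota> t \<in> iso (K t) (G\<lparr>carrier := E t\<rparr>)"
      by (auto simp: iso_def hom_def bij_betw_def E_def image_comp)
  qed
  define \<E> where "\<E> = E ` {..<n}"
  have EG: "\<Union>\<E> \<subseteq> carrier G" using \<iota>_in by (auto simp: \<E>_def E_def)
  have "carrier G \<subseteq> generate G (\<Union>\<E>)"
  proof
    fix g assume "g \<in> carrier G"
    then obtain x where x: "x \<in> carrier P" "g = \<phi> x" using bij by (auto simp: bij_betw_def)
    \<comment> \<open>The truncation of x to its first m coordinates: passing from m to m + 1
      multiplies by one element of an embedded factor.\<close>
    define y where "y m = (\<lambda>i\<in>{..<n}. if i < m then x i else \<one>\<^bsub>K i\<^esub>)" for m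
    have "y m \<in> carrier P \<and> \<phi> (y m) \<in> generate G (\<Union>\<E>)" if "m \<le> n" for m
      using that
    proof (induction m)
      case 0
      have "y 0 = \<one>\<^bsub>P\<^esub>" by (auto simp: y_def P_def)
      then show ?case by (simp add: generate.one)
    next
      case (Suc m)
      then have IH: "y m \<in> carrier P" "\<phi> (y m) \<in> generate G (\<Union>\<E>)" and m: "m < n" by auto
      have xm: "x m \<in> carrier (K m)"
        using PiE_mem[of x "{..<n}" "\<lambda>i. carrier (K i)" m] x(1) m by (simp add: P_def)
      have eq: "y (Suc m) = y m \<otimes>\<^bsub>P\<^esub> \<iota> m (x m)"
      proof
        fix i
        have "i < n \<Longrightarrow> x i \<in> carrier (K i)"
          using PiE_mem[of x "{..<n}" "\<lambda>i. carrier (K i)" i] x(1) by (simp add: P_def)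
        then show "y (Suc m) i = (y m \<otimes>\<^bsub>P\<^esub> \<iota> m (x m)) i"
          using m Kg[of i] by (auto simp: P_def \<iota>_def y_def group.is_monoid less_Suc_eq)
      qed
      have "\<phi> (\<iota> m (x m)) \<in> \<Union>\<E>" using m xm by (auto simp: \<E>_def E_def)
      then show ?case using IH \<iota>_in[OF m xm] by (simp add: eq generate.eng generate.incl)
    qed
    moreover have "y n = x"
    proof
      fix i
      have "\<not> i < n \<Longrightarrow> x i = undefined"
        using PiE_arb[of x "{..<n}" "\<lambda>i. carrier (K i)" i] x(1) by (simp add: P_def)
      then show "y n i = x i" by (simp add: y_def)
    qed
    ultimately show "g \<in> generate G (\<Union>\<E>)" using x by auto
  qed
  then have "generate G (\<Union>\<E>) = carrier G" using generate_incl[OF EG] by blast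
  moreover have "finite \<E>" by (simp add: \<E>_def)
  ultimately show ?thesis
    unfolding indecomposable_generation_def using factor indec
    by (intro exI[of _ \<E>]) (auto simp: \<E>_def)
qed

section \<open>Passage to the central quotient\<close>

lemma (in group) centre_subgroup: "subgroup (centre G) G"
  using centralizer_subgroup[OF order_refl] by (simp add: centre_def)

lemma (in group) centre_normal: "centre G \<lhd> G"
proof (rule normal_invI[OF centre_subgroup])
  fix x h assume "x \<in> carrier G" "h \<in> centre G"
  moreover from this have "h \<in> carrier G" "x \<otimes> h = h \<otimes> x" unfolding centre_def by auto
  ultimately have "x \<otimes> h \<otimes> inv x = h" by (simp add: m_assoc)
  then show "x \<otimes> h \<otimes> inv x \<in> centre G" using \<open>h \<in> centre G\<close> by simp
qed

text \<open>
  Pairwise commuting subgroups that generate the group become direct factors modulo the centre.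
\<close>

lemma (in group) bounded_noncentral_commuting_subgroups:
  assumes bounded: "bounded_factors (G Mod centre G)"
  shows "\<exists>l :: nat. \<forall>(k :: nat) A. (\<forall>i<k. subgroup (A i) G) \<longrightarrow>
    (\<forall>i<k. \<forall>j<k. i \<noteq> j \<longrightarrow> (\<forall>a\<in>A i. \<forall>b\<in>A j. a \<otimes> b = b \<otimes> a)) \<longrightarrow>
    generate G (\<Union>i<k. A i) = carrier G \<longrightarrow> card {i. i < k \<and> \<not> A i \<subseteq> centre G} \<le> l"
proof -
  define Z where "Z = centre G"
  interpret Z: normal Z G unfolding Z_def by (rule centre_normal)
  define Q where "Q = G Mod Z"
  interpret Q: group Q unfolding Q_def by (rule Z.factorgroup_is_group)
  define h where "h = (\<lambda>a. Z #> a)"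
  interpret h: group_hom G Q h
    using Z.r_coset_hom_Mod unfolding h_def Q_def
    by (intro group_hom.intro group_hom_axioms.intro Z.factorgroup_is_group) auto
  have hone: "h x = \<one>\<^bsub>Q\<^esub> \<longleftrightarrow> x \<in> Z" if "x \<in> carrier G" for x
    using that coset_join1[OF _ _ Z.subgroup_axioms] coset_join2[OF _ Z.subgroup_axioms]
    by (auto simp: Q_def h_def)
  have ZC: "z \<otimes> g = g \<otimes> z" if "z \<in> Z" "g \<in> carrier G" for z g
    using that unfolding Z_def centre_def by blast
  obtain l where l0: "\<forall>I C D. orthogonal_factors Q I C D \<longrightarrow> (\<forall>i\<in>I. C i \<noteq> {\<one>\<^bsub>Q\<^esub>}) \<longrightarrow> card I \<le> l"
    using bounded unfolding bounded_factors_def Q_def Z_def by (elim exE)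
  have l: "card I \<le> l" if "orthogonal_factors Q I C D" "\<forall>i\<in>I. C i \<noteq> {\<one>\<^bsub>Q\<^esub>}" for I C D
    using l0[THEN spec, THEN spec, THEN spec, THEN mp, THEN mp, OF that] .
  have main: "card {i. i < k \<and> \<not> A i \<subseteq> Z} \<le> l"
    if sub: "\<And>i. i < k \<Longrightarrow> subgroup (A i) G"
      and comm: "\<And>i j a b. i < k \<Longrightarrow> j < k \<Longrightarrow> i \<noteq> j \<Longrightarrow> a \<in> A i \<Longrightarrow> b \<in> A j \<Longrightarrow> a \<otimes> b = b \<otimes> a"
      and gen: "generate G (\<Union>i<k. A i) = carrier G" for k :: nat and A
  proof -
    \<comment> \<open>The other subgroups together; modulo the centre this becomes the complement of
      \<open>A i\<close>.\<close>
    define B where "B i = generate G (\<Union>j\<in>{..<k} - {i}. A j)" for i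
    have AG: "A i \<subseteq> carrier G" if "i < k" for i using sub[OF that] by (rule subgroup.subset)
    then have UG: "(\<Union>j\<in>{..<k} - {i}. A j) \<subseteq> carrier G" for i by blast
    have B: "subgroup (B i) G" for i unfolding B_def by (rule generate_is_subgroup[OF UG])
    have ABcomm: "a \<otimes> b = b \<otimes> a" if "i < k" "a \<in> A i" "b \<in> B i" for i a b
      by (rule commute_generate[OF AG[OF that(1)] UG[of i]])
         (use that comm in \<open>auto simp: B_def intro: generate.incl\<close>)
    have AB: "carrier G \<subseteq> A i <#> B i" if i: "i < k" for i
    proof -
      have S: "subgroup (A i <#> B i) G"
        by (rule commuting_set_mult_subgroup[OF sub[OF i] B]) (use ABcomm[OF i] in blast)
      have "A j \<subseteq> A i <#> B i" if j: "j < k" for j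
      proof
        fix x assume x: "x \<in> A j"
        then have xG: "x \<in> carrier G" using AG[OF j] by blast
        show "x \<in> A i <#> B i"
        proof (cases "j = i")
          case True
          then have "x \<otimes> \<one> \<in> A i <#> B i"
            using x subgroup.one_closed[OF B] unfolding set_mult_def by blast
          then show ?thesis using xG by simp
        next
          case False
          then have "x \<in> B i" unfolding B_def using x j by (intro generate.incl) auto
          then have "\<one> \<otimes> x \<in> A i <#> B i"
            using subgroup.one_closed[OF sub[OF i]] unfolding set_mult_def by blast
          then show ?thesis using xG by simp
        qed
      qed
      then have "generate G (\<Union>i<k. A i) \<subseteq> A i <#> B i"
        by (intro generate_subgroup_incl[OF _ S]) auto
      then show ?thesis using gen by simp
    qed
    define I where "I = {i. i < k \<and> \<not> A i \<subseteq> Z}"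
    have Ik: "i < k" if "i \<in> I" for i using that by (simp add: I_def)
    have "orthogonal_factors Q I (\<lambda>i. h ` A i) (\<lambda>i. h ` B i)"
      unfolding orthogonal_factors_def
    proof (intro conjI ballI impI)
      show "finite I" by (simp add: I_def)
    next
      fix i j assume "i \<in> I" "j \<in> I" "i \<noteq> j"
      then have "A j \<subseteq> B i" unfolding B_def using Ik by (auto intro: generate.incl)
      then show "h ` A j \<subseteq> h ` B i" by (rule image_mono)
    next
      fix i assume "i \<in> I"
      then have i: "i < k" by (rule Ik)
      note BG = subgroup.subset[OF B[of i]]
      show "internal_direct_product Q (h ` A i) (h ` B i)"
        unfolding Q.internal_direct_product_iff
      proof (intro conjI ballI)
        show "subgroup (h ` A i) Q" "subgroup (h ` B i) Q"
          using h.subgroup_img_is_subgroup sub[OF i] B by auto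
      next
        fix x y assume "x \<in> h ` A i" "y \<in> h ` B i"
        then obtain a b where *: "a \<in> A i" "b \<in> B i" "x = h a" "y = h b" by blast
        moreover from this have "a \<in> carrier G" "b \<in> carrier G" using AG[OF i] BG by auto
        ultimately show "x \<otimes>\<^bsub>Q\<^esub> y = y \<otimes>\<^bsub>Q\<^esub> x" using ABcomm[OF i *(1,2)] by (metis h.hom_mult)
      next
        have "x = \<one>\<^bsub>Q\<^esub>" if x: "x \<in> h ` A i" "x \<in> h ` B i" for x
        proof -
          obtain a b where *: "a \<in> A i" "b \<in> B i" "x = h a" "x = h b" using x by blast
          then have cl: "a \<in> carrier G" "b \<in> carrier G" using AG[OF i] BG by auto
          define z where "z = a \<otimes> inv b"
          have "h z = \<one>\<^bsub>Q\<^esub>" unfolding z_def using * cl by simp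
          moreover have "z \<in> carrier G" using cl by (simp add: z_def)
          ultimately have z: "z \<in> Z" using hone by blast
          have a: "a = z \<otimes> b" using cl by (simp add: z_def m_assoc)
          \<comment> \<open>As a member of \<open>A i\<close>, a commutes with \<open>B i\<close>;
            as z b with z central and b in \<open>B i\<close>, it commutes with \<open>A i\<close>.
            The two generate \<open>G\<close>.\<close>
          have "a \<otimes> g = g \<otimes> a" if g: "g \<in> carrier G" for g
          proof -
            obtain a' b' where g': "a' \<in> A i" "b' \<in> B i" "g = a' \<otimes> b'"
              using g AB[OF i] unfolding set_mult_def by blast
            then have cl': "a' \<in> carrier G" "b' \<in> carrier G" using AG[OF i] BG by auto
            have zG: "z \<in> carrier G" using z by simp
            have "a \<otimes> a' = z \<otimes> (b \<otimes> a')" using a zG cl cl' by (simp add: m_assoc)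
            also have "b \<otimes> a' = a' \<otimes> b" using ABcomm[OF i g'(1) *(2)] by simp
            also have "z \<otimes> (a' \<otimes> b) = (z \<otimes> a') \<otimes> b" using zG cl cl' by (simp add: m_assoc)
            also have "z \<otimes> a' = a' \<otimes> z" by (rule ZC[OF z cl'(1)])
            also have "a' \<otimes> z \<otimes> b = a' \<otimes> a" using a zG cl cl' by (simp add: m_assoc)
            finally have "a \<otimes> a' = a' \<otimes> a" .
            then have "a \<otimes> g = a' \<otimes> (a \<otimes> b')" using g' cl cl' by (simp add: m_assoc[symmetric])
            also have "a \<otimes> b' = b' \<otimes> a" by (rule ABcomm[OF i *(1) g'(2)])
            finally show ?thesis using g' cl cl' by (simp add: m_assoc)
          qed
          then have "a \<in> Z" using cl(1) unfolding Z_def centre_def by blast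
          then show ?thesis using hone cl * by simp
        qed
        then show "h ` A i \<inter> h ` B i = {\<one>\<^bsub>Q\<^esub>}"
          using subgroup.one_closed[OF h.subgroup_img_is_subgroup[OF sub[OF i]]]
            subgroup.one_closed[OF h.subgroup_img_is_subgroup[OF B]] by blast
      next
        fix x assume "x \<in> carrier Q"
        then obtain g where g: "g \<in> carrier G" "x = h g" by (auto simp: Q_def h_def carrier_FactGroup)
        then obtain a b where ab: "a \<in> A i" "b \<in> B i" "g = a \<otimes> b"
          using AB[OF i] unfolding set_mult_def by blast
        then have "a \<in> carrier G" "b \<in> carrier G" using AG[OF i] BG by auto
        then have "x = h a \<otimes>\<^bsub>Q\<^esub> h b" using g ab by simp
        then show "\<exists>a\<in>h ` A i. \<exists>b\<in>h ` B i. x = a \<otimes>\<^bsub>Q\<^esub> b" using ab by blast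
      qed
    qed
    moreover have "\<forall>i\<in>I. h ` A i \<noteq> {\<one>\<^bsub>Q\<^esub>}"
    proof
      fix i assume "i \<in> I"
      then obtain a where a: "a \<in> A i" "a \<notin> Z" and i: "i < k" by (auto simp: I_def)
      then have "h a \<noteq> \<one>\<^bsub>Q\<^esub>" using hone AG[OF i] by auto
      then show "h ` A i \<noteq> {\<one>\<^bsub>Q\<^esub>}" using a by blast
    qed
    ultimately show ?thesis unfolding I_def by (rule l)
  qed
  show ?thesis unfolding Z_def[symmetric]
  proof (rule exI[of _ l], intro allI impI, goal_cases)
    case (1 k A)
    then show ?case by (intro main) blast+
  qed
qed

lemma (in group) finitely_generated_Mod:
  assumes "finitely_generated G" "N \<lhd> G"
  shows "finitely_generated (G Mod N)"
proof -
  interpret N: normal N G by fact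
  interpret h: group_hom G "G Mod N" "\<lambda>a. N #> a"
    using N.r_coset_hom_Mod by (intro group_hom.intro group_hom_axioms.intro N.factorgroup_is_group) auto
  obtain S where S: "finite S" "S \<subseteq> carrier G" "generate G S = carrier G"
    using assms(1) by (auto simp: finitely_generated_def)
  have "generate (G Mod N) ((\<lambda>a. N #> a) ` S) = carrier (G Mod N)"
    using h.generate_img[OF S(2)] S(3) by (simp add: carrier_FactGroup)
  moreover have "(\<lambda>a. N #> a) ` S \<subseteq> carrier (G Mod N)" using S(2) by (auto simp: carrier_FactGroup)
  ultimately show ?thesis using S(1) unfolding finitely_generated_def by blast
qed

lemma (in group) solvable_Mod:
  assumes "solvable G" "N \<lhd> G"
  shows "solvable (G Mod N)"
proof -
  interpret N: normal N G by fact
  interpret h: group_hom G "G Mod N" "\<lambda>a. N #> a"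
    using N.r_coset_hom_Mod by (intro group_hom.intro group_hom_axioms.intro N.factorgroup_is_group) auto
  show ?thesis using h.solvable_imp_solvable_img[of "carrier G"] assms(1)
    by (simp add: solvable_def carrier_FactGroup)
qed

lemma (in group) bounded_factors_Mod_centre:
  assumes fg: "finitely_generated G"
    and "max_condition_direct_factors (G Mod centre G) \<or>
         finite_product_of_indecomposables (G Mod centre G) \<or> solvable G"
  shows "bounded_factors (G Mod centre G)"
proof -
  interpret Z: normal "centre G" G by (rule centre_normal)
  interpret Q: group "G Mod centre G" by (rule Z.factorgroup_is_group)
  note fgQ = finitely_generated_Mod[OF fg centre_normal]
  from assms(2) consider "\<exists>\<E>. indecomposable_generation (G Mod centre G) \<E>" | "solvable G"
    using Q.max_condition_imp_indecomposable_generation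
      Q.finite_product_imp_indecomposable_generation by blast
  then show ?thesis
  proof cases
    case 1
    then show ?thesis using Q.indecomposable_generation_imp_bounded_factors[OF fgQ] by blast
  next
    case 2
    then show ?thesis
      using Q.solvable_imp_bounded_factors[OF fgQ] solvable_Mod[OF _ centre_normal] by blast
  qed
qed

section \<open>Words and products\<close>

text \<open>The product in the order of the indices, for groups that need not be
  commutative.\<close>

primrec mprod :: "('a, 'b) monoid_scheme \<Rightarrow> (nat \<Rightarrow> 'a) \<Rightarrow> nat \<Rightarrow> 'a" where
  "mprod G f 0 = \<one>\<^bsub>G\<^esub>"
| "mprod G f (Suc n) = mprod G f n \<otimes>\<^bsub>G\<^esub> f n"

lemma mprod_cong: "(\<And>i. i < n \<Longrightarrow> f i = g i) \<Longrightarrow> mprod G f n = mprod G g n"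
  by (induction n) auto

lemma (in monoid) mprod_closed [simp, intro]:
  "(\<And>i. i < n \<Longrightarrow> f i \<in> carrier G) \<Longrightarrow> mprod G f n \<in> carrier G"
  by (induction n) auto

lemma (in group_hom) hom_mprod:
  "(\<And>i. i < n \<Longrightarrow> f i \<in> carrier G) \<Longrightarrow> h (mprod G f n) = mprod H (\<lambda>i. h (f i)) n"
  by (induction n) auto

lemma (in monoid) mprod_one: "(\<And>i. i < n \<Longrightarrow> f i = \<one>) \<Longrightarrow> mprod G f n = \<one>"
  by (induction n) auto

lemma (in monoid) mprod_single:
  assumes "j < n" "f j \<in> carrier G" "\<And>i. i < n \<Longrightarrow> i \<noteq> j \<Longrightarrow> f i = \<one>"
  shows "mprod G f n = f j"
  using assms
proof (induction n)
  case (Suc n)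
  show ?case
  proof (cases "j = n")
    case True
    then have "mprod G f n = \<one>" using Suc.prems by (intro mprod_one) auto
    then show ?thesis using True Suc.prems by simp
  next
    case False
    then show ?thesis using Suc by simp
  qed
qed simp

section \<open>Words without coefficients\<close>

lemma word_val_cong:
  assumes "w \<in> words A r" "\<And>i. i < r \<Longrightarrow> x i = y i"
  shows "word_val G x w = word_val G y w"
  using assms(1)
proof (induction w)
  case (Cons l w)
  then have "l \<in> letters A r" "w \<in> words A r" by (auto simp: words_def)
  moreover from this have "letter_val G x l = letter_val G y l"
    using assms(2) by (auto simp: letters_def)
  ultimately show ?case using Cons.IH by simp
qed simp

text \<open>Without coefficients \<open>map_letter f\<close> changes only the type of a word. The
  function is therefore arbitrary, and \<open>undefined\<close> fills its place when a word is moved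
  between groups.\<close>

lemma map_letter_free_cong:
  "w \<in> words {} r \<Longrightarrow> map (map_letter f) w = map (map_letter g) w"
  by (induction w) (auto simp: words_def letters_def)

lemma map_letter_free_id:
  "w \<in> words {} r \<Longrightarrow> map (map_letter f) (map (map_letter g) w) = w"
  by (induction w) (auto simp: words_def letters_def)

lemma map_letter_free_self: "w \<in> words {} r \<Longrightarrow> map (map_letter f) w = w"
  by (induction w) (auto simp: words_def letters_def)

lemma map_letter_free: "w \<in> words {} r \<Longrightarrow> map (map_letter f) w \<in> words {} r"
  by (rule map_letter_words) auto

lemma word_val_hom_full:
  assumes "group_hom G G' \<phi>" "A \<subseteq> carrier G" "x \<in> {..<r} \<rightarrow> carrier G" "w \<in> words A r"
  shows "word_val G' (\<lambda>i. \<phi> (x i)) (map (map_letter \<phi>) w) = \<phi> (word_val G x w)"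
proof -
  interpret \<phi>: group_hom G G' \<phi> by fact
  show ?thesis
    using word_val_hom[OF \<phi>.G.group_axioms \<phi>.H.group_axioms \<phi>.G.subgroup_self _ assms(2,3,4)] by simp
qed

lemma word_val_free_hom:
  assumes "group_hom G G' \<phi>" "x \<in> {..<r} \<rightarrow> carrier G" "w \<in> words {} r"
  shows "word_val G' (\<lambda>i. \<phi> (x i)) (map (map_letter f) w) = \<phi> (word_val G x w)"
  by (subst map_letter_free_cong[OF assms(3), of f \<phi>])
     (rule word_val_hom_full[OF assms(1) empty_subsetI assms(2,3)])

text \<open>Since c is central, (g, n) \<mapsto> g c^n is a homomorphism from H \<times> \<int> to
  \<open>H\<close>. Evaluating the word in H \<times> \<int> and applying this map and the two
  projections gives the formula.\<close>

lemma word_val_free_central_shift: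
  fixes w :: "'a letter list"
  assumes H: "group H" and c: "c \<in> centre H" and x: "x \<in> {..<r} \<rightarrow> carrier H" and w: "w \<in> words {} r"
  shows "word_val H (\<lambda>j. x j \<otimes>\<^bsub>H\<^esub> c [^]\<^bsub>H\<^esub> (v j :: int)) w =
    word_val H x w \<otimes>\<^bsub>H\<^esub> c [^]\<^bsub>H\<^esub> word_val integer_group v (map (map_letter f) w)"
proof -
  interpret group H by fact
  have cH: "c \<in> carrier H" and cc: "\<And>g. g \<in> carrier H \<Longrightarrow> c \<otimes>\<^bsub>H\<^esub> g = g \<otimes>\<^bsub>H\<^esub> c"
    using c unfolding centre_def by blast+
  have comm: "c [^]\<^bsub>H\<^esub> n \<otimes>\<^bsub>H\<^esub> g = g \<otimes>\<^bsub>H\<^esub> c [^]\<^bsub>H\<^esub> n" if g: "g \<in> carrier H" for g and n :: int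
  proof -
    have 1: "c [^]\<^bsub>H\<^esub> (n :: nat) \<otimes>\<^bsub>H\<^esub> g = g \<otimes>\<^bsub>H\<^esub> c [^]\<^bsub>H\<^esub> n" for n
      by (rule group_commutes_pow[OF cc[OF g] cH g])
    show ?thesis
    proof (cases "n \<ge> 0")
      case True
      then show ?thesis using 1[of "nat n"] unfolding int_pow_def2 by simp
    next
      case False
      define d where "d = c [^]\<^bsub>H\<^esub> nat (- n)"
      have d: "d \<in> carrier H" "d \<otimes>\<^bsub>H\<^esub> g = g \<otimes>\<^bsub>H\<^esub> d"
        using cH unfolding d_def by (simp, intro 1)
      have "inv\<^bsub>H\<^esub> d \<otimes>\<^bsub>H\<^esub> (g \<otimes>\<^bsub>H\<^esub> d) \<otimes>\<^bsub>H\<^esub> inv\<^bsub>H\<^esub> d = inv\<^bsub>H\<^esub> d \<otimes>\<^bsub>H\<^esub> (d \<otimes>\<^bsub>H\<^esub> g) \<otimes>\<^bsub>H\<^esub> inv\<^bsub>H\<^esub> d"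
        using d by simp
      also have "inv\<^bsub>H\<^esub> d \<otimes>\<^bsub>H\<^esub> (d \<otimes>\<^bsub>H\<^esub> g) \<otimes>\<^bsub>H\<^esub> inv\<^bsub>H\<^esub> d = g \<otimes>\<^bsub>H\<^esub> inv\<^bsub>H\<^esub> d"
        using d(1) g by (simp add: m_assoc[symmetric])
      finally have *: "inv\<^bsub>H\<^esub> d \<otimes>\<^bsub>H\<^esub> g = g \<otimes>\<^bsub>H\<^esub> inv\<^bsub>H\<^esub> d"
        using d(1) g by (simp add: m_assoc)
      have pow: "c [^]\<^bsub>H\<^esub> n = inv\<^bsub>H\<^esub> d" using False unfolding int_pow_def2 d_def by simp
      show ?thesis unfolding pow by (rule *)
    qed
  qed
  define D where "D = H \<times>\<times> integer_group"
  have D: "group D" unfolding D_def by (rule DirProd_group[OF H group_integer_group])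
  define \<mu> where "\<mu> = (\<lambda>p. fst p \<otimes>\<^bsub>H\<^esub> c [^]\<^bsub>H\<^esub> (snd p :: int))"
  have "\<mu> \<in> hom D H"
  proof (rule homI)
    fix p assume "p \<in> carrier D"
    then show "\<mu> p \<in> carrier H" using cH by (auto simp: D_def \<mu>_def)
  next
    fix p p' assume "p \<in> carrier D" "p' \<in> carrier D"
    then obtain g n g' n' where *: "p = (g, n)" "p' = (g', n')" "g \<in> carrier H" "g' \<in> carrier H"
      by (auto simp: D_def)
    then have "\<mu> p \<otimes>\<^bsub>H\<^esub> \<mu> p' = g \<otimes>\<^bsub>H\<^esub> (c [^]\<^bsub>H\<^esub> n \<otimes>\<^bsub>H\<^esub> g') \<otimes>\<^bsub>H\<^esub> c [^]\<^bsub>H\<^esub> n'"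
      using cH by (simp add: \<mu>_def m_assoc)
    also have "c [^]\<^bsub>H\<^esub> n \<otimes>\<^bsub>H\<^esub> g' = g' \<otimes>\<^bsub>H\<^esub> c [^]\<^bsub>H\<^esub> n" by (rule comm[OF *(4)])
    also have "g \<otimes>\<^bsub>H\<^esub> (g' \<otimes>\<^bsub>H\<^esub> c [^]\<^bsub>H\<^esub> n) \<otimes>\<^bsub>H\<^esub> c [^]\<^bsub>H\<^esub> n' = \<mu> (p \<otimes>\<^bsub>D\<^esub> p')"
      using * cH by (simp add: \<mu>_def D_def m_assoc int_pow_mult)
    finally show "\<mu> (p \<otimes>\<^bsub>D\<^esub> p') = \<mu> p \<otimes>\<^bsub>H\<^esub> \<mu> p'" by simp
  qed
  then have \<mu>: "group_hom D H \<mu>"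
    using D H by (simp add: group_hom_def group_hom_axioms_def)
  have fst: "group_hom D H fst" and snd: "group_hom D integer_group snd"
    using D H by (auto simp: group_hom_def group_hom_axioms_def hom_def D_def)
  define wD where "wD = map (map_letter (\<lambda>_. undefined :: 'a \<times> int)) w"
  have wD: "wD \<in> words {} r" unfolding wD_def by (rule map_letter_free[OF w])
  have wD_map: "map (map_letter g) wD = map (map_letter f') w" for g :: "'a \<times> int \<Rightarrow> 'c" and f'
    unfolding wD_def map_map comp_def letter.map_comp
    using map_letter_free_cong[OF w, of "\<lambda>a. g undefined" f'] by (simp add: comp_def)
  have id: "map (map_letter (\<lambda>a. a)) w = w" by (rule map_letter_free_self[OF w])
  have xv: "(\<lambda>j. (x j, v j)) \<in> {..<r} \<rightarrow> carrier D" using x by (auto simp: D_def)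
  let ?W = "word_val D (\<lambda>j. (x j, v j)) wD"
  have "fst ?W = word_val H x w"
    using word_val_free_hom[OF fst xv wD, of undefined] wD_map[of undefined "\<lambda>a. a"] id by simp
  moreover have "snd ?W = word_val integer_group v (map (map_letter f) w)"
    using word_val_free_hom[OF snd xv wD, of undefined] wD_map[of undefined f] by simp
  moreover have "\<mu> ?W = word_val H (\<lambda>j. x j \<otimes>\<^bsub>H\<^esub> c [^]\<^bsub>H\<^esub> v j) w"
    using word_val_free_hom[OF \<mu> xv wD, of undefined] wD_map[of undefined "\<lambda>a. a"] id by (simp add: \<mu>_def)
  ultimately show ?thesis by (simp add: \<mu>_def)
qed

section \<open>Values of words on the integers\<close>

lemma int_closed_minus_principal:
  fixes S :: "int set"
  assumes ne: "S \<noteq> {}" and minus: "\<And>a b. a \<in> S \<Longrightarrow> b \<in> S \<Longrightarrow> a - b \<in> S"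
  shows "\<exists>m. S = {x. m dvd x}"
proof -
  have 0: "0 \<in> S" using ne minus by (metis diff_self ex_in_conv)
  have neg: "- a \<in> S" if "a \<in> S" for a using minus[OF 0 that] by simp
  have add: "a + b \<in> S" if "a \<in> S" "b \<in> S" for a b using minus[OF that(1) neg[OF that(2)]] by simp
  have mult: "int n * a \<in> S" if "a \<in> S" for n a
    by (induction n) (use 0 add that in \<open>auto simp: distrib_right\<close>)
  have mult': "z * a \<in> S" if "a \<in> S" for z a
  proof (cases "z \<ge> 0")
    case True
    have "int (nat z) * a \<in> S" by (rule mult[OF that])
    with True show ?thesis by simp
  next
    case False
    have "- (int (nat (- z)) * a) \<in> S" by (rule neg[OF mult[OF that]])
    with False show ?thesis by simp
  qed
  show ?thesis
  proof (cases "\<exists>n::nat. n > 0 \<and> int n \<in> S")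
    case True
    define m where "m = (LEAST n::nat. n > 0 \<and> int n \<in> S)"
    have m: "m > 0" "int m \<in> S" unfolding m_def using LeastI_ex[OF True] by auto
    have "int m dvd x" if x: "x \<in> S" for x
    proof -
      have "x - (x div int m) * int m \<in> S" using minus[OF x mult'[OF m(2)]] .
      then have "int (nat (x mod int m)) \<in> S" using m by (simp add: minus_div_mult_eq_mod)
      moreover have "nat (x mod int m) < m" using m by (simp add: nat_less_iff)
      moreover have "m \<le> nat (x mod int m)"
        if "nat (x mod int m) > 0" "int (nat (x mod int m)) \<in> S"
        unfolding m_def by (rule Least_le) (use that in \<open>simp only: m_def\<close>)
      ultimately have "nat (x mod int m) = 0" by (metis not_le gr0I)
      moreover have "x mod int m \<ge> 0" using m by simp
      ultimately show ?thesis by (simp add: dvd_eq_mod_eq_0)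
    qed
    then have "S = {x. int m dvd x}" using mult'[OF m(2)] by (auto simp: dvd_def mult.commute)
    then show ?thesis by blast
  next
    case False
    have "x = 0" if x: "x \<in> S" for x
    proof (rule ccontr)
      assume "x \<noteq> 0"
      then show False using False x neg[OF x]
        by (cases "x > 0") (auto dest: spec[of _ "nat x"] spec[of _ "nat (- x)"])
    qed
    then have "S = {x. 0 dvd x}" using 0 by auto
    then show ?thesis by blast
  qed
qed

text \<open>Subtraction is a homomorphism from \<int> \<times> \<int> because \<int> is abelian, so
  the set of values is closed under it. Up to sign, m is the gcd of the exponent sums of the
  variables.\<close>

lemma word_val_integer_group_range:
  fixes w :: "int letter list"
  assumes w: "w \<in> words {} r"
  shows "\<exists>m. range (\<lambda>v. word_val integer_group v w) = {z. m dvd z}"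
proof (rule int_closed_minus_principal)
  fix a b assume "a \<in> range (\<lambda>v. word_val integer_group v w)" "b \<in> range (\<lambda>v. word_val integer_group v w)"
  then obtain v v' where v: "a = word_val integer_group v w" "b = word_val integer_group v' w" by blast
  define D where "D = integer_group \<times>\<times> integer_group"
  have D: "group D" unfolding D_def by (intro DirProd_group group_integer_group)
  have hom: "group_hom D integer_group fst" "group_hom D integer_group snd"
    "group_hom D integer_group (\<lambda>p. fst p - snd p)"
    using D by (auto simp: group_hom_def group_hom_axioms_def hom_def D_def)
  define wD where "wD = map (map_letter (\<lambda>_. undefined :: int \<times> int)) w"
  have wD: "wD \<in> words {} r" unfolding wD_def by (rule map_letter_free[OF w])
  have wD_map: "map (map_letter g) wD = w" for g unfolding wD_def by (rule map_letter_free_id[OF w])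
  have vv: "(\<lambda>j. (v j, v' j)) \<in> {..<r} \<rightarrow> carrier D" by (auto simp: D_def)
  have "a - b = word_val integer_group (\<lambda>j. v j - v' j) w"
    using word_val_free_hom[OF hom(1) vv wD, of undefined] word_val_free_hom[OF hom(2) vv wD, of undefined]
      word_val_free_hom[OF hom(3) vv wD, of undefined] by (simp add: wD_map v)
  then show "a - b \<in> range (\<lambda>v. word_val integer_group v w)" by blast
qed simp

text \<open>Write m = g m' with g = gcd(m, q). The hypothesis forces m' to divide every b t, and the
  code condition for the quotients b t / m' supplies a column whose sum is divisible by q, hence by
  g.\<close>

lemma dvd_covering_code:
  fixes \<epsilon> :: "nat \<Rightarrow> nat \<Rightarrow> nat" and m :: int and q k :: nat
  assumes q: "q > 0"
    and code: "\<And>b :: nat \<Rightarrow> int. \<exists>i<k. int q dvd (\<Sum>t<r. b t * int (\<epsilon> t i))"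
    and m: "\<And>t. t < r \<Longrightarrow> m dvd int q * b t"
  shows "\<exists>i<k. m dvd (\<Sum>t<r. b t * int (\<epsilon> t i))"
proof -
  define g where "g = gcd m (int q)"
  define m' where "m' = m div g"
  define q' where "q' = int q div g"
  have g: "g > 0" "m = g * m'" "int q = g * q'" using q by (auto simp: g_def m'_def q'_def)
  have cop: "coprime m' q'" unfolding m'_def q'_def g_def using q by (intro div_gcd_coprime) auto
  have b: "m' dvd b t" if "t < r" for t
  proof -
    have "g * m' dvd g * (q' * b t)" using m[OF that] g by (simp add: mult.assoc)
    then have "m' dvd q' * b t" using g(1) by simp
    then show ?thesis using cop by (simp add: coprime_dvd_mult_right_iff)
  qed
  define b' where "b' t = b t div m'" for t
  obtain i where i: "i < k" "int q dvd (\<Sum>t<r. b' t * int (\<epsilon> t i))" using code by blast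
  have "(\<Sum>t<r. b t * int (\<epsilon> t i)) = m' * (\<Sum>t<r. b' t * int (\<epsilon> t i))"
    unfolding sum_distrib_left
  proof (rule sum.cong)
    fix t assume "t \<in> {..<r}"
    then have "b t = m' * b' t" using b[of t] by (simp add: b'_def)
    then show "b t * int (\<epsilon> t i) = m' * (b' t * int (\<epsilon> t i))" by simp
  qed simp
  moreover have "g dvd (\<Sum>t<r. b' t * int (\<epsilon> t i))"
    using i(2) g(3) by (metis dvd_mult_left)
  ultimately have "m dvd (\<Sum>t<r. b t * int (\<epsilon> t i))"
    using g(2) by (metis mult.commute mult_dvd_mono dvd_refl)
  then show ?thesis using i(1) by blast
qed

section \<open>A verbally closed extension\<close>

text \<open>
  The group is \<open>(H\<^sup>k \<times> \<int>\<^sup>r) / N\<close>, where \<open>N\<close> consists of the elements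
  \<open>((c\<^sup>F\<^sup>i)\<^sub>i, (q b\<^sub>t)\<^sub>t)\<close> with \<open>b \<in> \<int>\<^sup>r\<close> and \<open>F\<^sub>i = (\<Sum>t<r. b t * \<epsilon> t i)\<close>, and \<open>H\<close> is embedded diagonally.
\<close>

lemma ex_verbally_closed_extension:
  fixes H :: "('a, 'b) monoid_scheme" and q k r :: nat and \<epsilon> :: "nat \<Rightarrow> nat \<Rightarrow> nat"
  assumes H: "group H" and c: "c \<in> centre H" and q: "q > 0" and k: "k > 0"
    and code: "\<And>b :: nat \<Rightarrow> int. \<exists>i<k. int q dvd (\<Sum>t<r. b t * int (\<epsilon> t i))"
  shows "\<exists>(G :: ((nat \<Rightarrow> 'a) \<times> (nat \<Rightarrow> int)) set monoid) f \<iota> \<upsilon>.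
    group G \<and> f \<in> mon H G \<and> verbally_closed_subgroup (f ` carrier H) G \<and>
    (\<forall>i<k. \<iota> i \<in> hom H G) \<and>
    (\<forall>i<k. \<forall>j<k. i \<noteq> j \<longrightarrow> (\<forall>a\<in>carrier H. \<forall>b\<in>carrier H. \<iota> i a \<otimes>\<^bsub>G\<^esub> \<iota> j b = \<iota> j b \<otimes>\<^bsub>G\<^esub> \<iota> i a)) \<and>
    (\<forall>h\<in>carrier H. mprod G (\<lambda>i. \<iota> i h) k = f h) \<and>
    (\<forall>t<r. \<upsilon> t \<in> centre G \<and> mprod G (\<lambda>i. \<iota> i (c [^]\<^bsub>H\<^esub> \<epsilon> t i)) k \<otimes>\<^bsub>G\<^esub> \<upsilon> t [^]\<^bsub>G\<^esub> q = \<one>\<^bsub>G\<^esub>)"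
proof -
  interpret H: group H by fact
  have cH: "c \<in> carrier H" and cc: "\<And>g. g \<in> carrier H \<Longrightarrow> c \<otimes>\<^bsub>H\<^esub> g = g \<otimes>\<^bsub>H\<^esub> c"
    using c unfolding centre_def by blast+
  have Z: "subgroup (centre H) H" by (rule H.centre_subgroup)
  have cpow: "c [^]\<^bsub>H\<^esub> (n :: int) \<otimes>\<^bsub>H\<^esub> g = g \<otimes>\<^bsub>H\<^esub> c [^]\<^bsub>H\<^esub> n" if "g \<in> carrier H" for n g
    using H.subgroup_int_pow_closed[OF Z c, of n] that unfolding centre_def by blast
  define P where "P = product_group {..<k} (\<lambda>_. H) \<times>\<times> product_group {..<r} (\<lambda>_. integer_group)"
  have "group P" unfolding P_def by (intro DirProd_group product_group H group_integer_group)
  then interpret P: group P .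
  have P_carrier: "p \<in> carrier P \<longleftrightarrow> fst p \<in> {..<k} \<rightarrow>\<^sub>E carrier H \<and> snd p \<in> {..<r} \<rightarrow>\<^sub>E UNIV" for p
    by (cases p) (simp add: P_def)
  have P_mult: "p \<otimes>\<^bsub>P\<^esub> p' = (\<lambda>i\<in>{..<k}. fst p i \<otimes>\<^bsub>H\<^esub> fst p' i, \<lambda>t\<in>{..<r}. snd p t + snd p' t)" for p p'
    by (cases p; cases p') (simp add: P_def)
  have P_one: "\<one>\<^bsub>P\<^esub> = (\<lambda>i\<in>{..<k}. \<one>\<^bsub>H\<^esub>, \<lambda>t\<in>{..<r}. 0)" by (simp add: P_def)
  have P_fst: "fst p i \<in> carrier H" if "p \<in> carrier P" "i < k" for p i
    using that by (auto simp: P_carrier)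
  have P_ext: "p = p'"
    if p: "p \<in> carrier P" "p' \<in> carrier P" "\<And>i. i < k \<Longrightarrow> fst p i = fst p' i" "\<And>t. t < r \<Longrightarrow> snd p t = snd p' t"
    for p p'
  proof (rule prod_eqI)
    show "fst p = fst p'" by (rule PiE_ext[of _ "{..<k}" "\<lambda>_. carrier H"]) (use p in \<open>simp_all add: P_carrier\<close>)
    show "snd p = snd p'" by (rule PiE_ext[of _ "{..<r}" "\<lambda>_. UNIV"]) (use p in \<open>simp_all add: P_carrier\<close>)
  qed
  have prH: "group_hom P H (\<lambda>p. fst p i)" if "i < k" for i
    using that P_fst by (auto simp: group_hom_def group_hom_axioms_def hom_def P_mult P.group_axioms H)
  have prZ: "group_hom P integer_group (\<lambda>p. snd p t)" if "t < r" for t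
    using that by (auto simp: group_hom_def group_hom_axioms_def hom_def P_mult P.group_axioms)

  define F where "F b i = (\<Sum>t<r. b t * int (\<epsilon> t i))" for b :: "nat \<Rightarrow> int" and i
  \<comment> \<open>Parametrizing \<open>N\<close> by \<int>^r makes it the image of a homomorphism;
    its elements are central because c is.\<close>
  define \<nu> where "\<nu> b = (\<lambda>i\<in>{..<k}. c [^]\<^bsub>H\<^esub> F b i, \<lambda>t\<in>{..<r}. int q * b t)" for b
  have \<nu>_in: "\<nu> b \<in> carrier P" for b using cH by (auto simp: P_carrier \<nu>_def)
  have \<nu>_mult: "\<nu> b \<otimes>\<^bsub>P\<^esub> \<nu> b' = \<nu> (\<lambda>t. b t + b' t)" for b b'
  proof -
    have "F (\<lambda>t. b t + b' t) i = F b i + F b' i" for i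
      by (simp add: F_def sum.distrib distrib_right)
    then show ?thesis using cH by (auto simp: P_mult \<nu>_def H.int_pow_mult distrib_left fun_eq_iff)
  qed
  have \<nu>_zero: "\<nu> (\<lambda>_. 0) = \<one>\<^bsub>P\<^esub>" by (auto simp: P_one \<nu>_def F_def fun_eq_iff)
  have \<nu>_comm: "\<nu> b \<otimes>\<^bsub>P\<^esub> p = p \<otimes>\<^bsub>P\<^esub> \<nu> b" if p: "p \<in> carrier P" for b p
    unfolding P_mult
  proof (intro arg_cong2[where f = Pair] restrict_ext)
    fix i assume "i \<in> {..<k}"
    then show "fst (\<nu> b) i \<otimes>\<^bsub>H\<^esub> fst p i = fst p i \<otimes>\<^bsub>H\<^esub> fst (\<nu> b) i"
      using cpow[OF P_fst[OF p]] by (simp add: \<nu>_def)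
  qed simp
  define N where "N = range \<nu>"
  have N: "N \<lhd> P"
  proof (rule P.normal_invI)
    show "subgroup N P"
    proof (rule P.subgroupI)
      show "N \<subseteq> carrier P" "N \<noteq> {}" using \<nu>_in by (auto simp: N_def)
    next
      fix n assume "n \<in> N"
      then obtain b where b: "n = \<nu> b" by (auto simp: N_def)
      have "\<nu> (\<lambda>t. - b t) \<otimes>\<^bsub>P\<^esub> \<nu> b = \<one>\<^bsub>P\<^esub>" by (simp add: \<nu>_mult \<nu>_zero)
      then have "inv\<^bsub>P\<^esub> n = \<nu> (\<lambda>t. - b t)" unfolding b by (rule P.inv_equality) (rule \<nu>_in)+
      then show "inv\<^bsub>P\<^esub> n \<in> N" by (simp add: N_def)
    next
      fix n n' assume "n \<in> N" "n' \<in> N"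
      then show "n \<otimes>\<^bsub>P\<^esub> n' \<in> N" by (auto simp: N_def \<nu>_mult)
    qed
    fix p n assume p: "p \<in> carrier P" and "n \<in> N"
    then obtain b where b: "n = \<nu> b" by (auto simp: N_def)
    have "p \<otimes>\<^bsub>P\<^esub> n \<otimes>\<^bsub>P\<^esub> inv\<^bsub>P\<^esub> p = n"
      unfolding b \<nu>_comm[OF p, symmetric] using p \<nu>_in[of b] by (simp add: P.m_assoc)
    then show "p \<otimes>\<^bsub>P\<^esub> n \<otimes>\<^bsub>P\<^esub> inv\<^bsub>P\<^esub> p \<in> N" using \<open>n \<in> N\<close> by simp
  qed
  interpret N: normal N P by (rule N)
  define G where "G = P Mod N"
  interpret G: group G unfolding G_def by (rule N.factorgroup_is_group)
  define \<kappa> where "\<kappa> = (\<lambda>p. N #>\<^bsub>P\<^esub> p)"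
  have \<kappa>: "group_hom P G \<kappa>"
    using N.r_coset_hom_Mod unfolding \<kappa>_def G_def
    by (intro group_hom.intro group_hom_axioms.intro N.factorgroup_is_group) auto
  interpret \<kappa>: group_hom P G \<kappa> by (rule \<kappa>)
  have \<kappa>_surj: "\<exists>p\<in>carrier P. y = \<kappa> p" if "y \<in> carrier G" for y
    using that by (auto simp: G_def \<kappa>_def carrier_FactGroup)
  have \<kappa>_one: "\<kappa> p = \<one>\<^bsub>G\<^esub> \<longleftrightarrow> p \<in> N" if "p \<in> carrier P" for p
    using P.coset_join1[OF _ that N.subgroup_axioms] P.coset_join2[OF that N.subgroup_axioms]
    unfolding G_def \<kappa>_def one_FactGroup by (rule iffI)

  define e where "e i a = (\<lambda>j\<in>{..<k}. if j = i then a else \<one>\<^bsub>H\<^esub>, \<lambda>t\<in>{..<r}. 0 :: int)" for i a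
  have e_in: "e i a \<in> carrier P" if "a \<in> carrier H" for i a
    using that by (auto simp: P_carrier e_def)
  have e_mult: "e i (a \<otimes>\<^bsub>H\<^esub> b) = e i a \<otimes>\<^bsub>P\<^esub> e i b" if "a \<in> carrier H" "b \<in> carrier H" for i a b
    using that by (auto simp: P_mult e_def fun_eq_iff)
  define \<iota> where "\<iota> i a = \<kappa> (e i a)" for i a
  have e_mprod: "mprod P (\<lambda>i. e i (a i)) k = (\<lambda>i\<in>{..<k}. a i, \<lambda>t\<in>{..<r}. 0)" (is "?L = ?R")
    if a: "\<And>i. i < k \<Longrightarrow> a i \<in> carrier H" for a
  proof (rule P_ext)
    have e: "e i (a i) \<in> carrier P" if "i < k" for i by (rule e_in[OF a[OF that]])
    show "?L \<in> carrier P" by (rule P.mprod_closed[OF e])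
    show "?R \<in> carrier P" using a by (auto simp: P_carrier)
    show "fst ?L j = fst ?R j" if j: "j < k" for j
    proof -
      have "fst ?L j = mprod H (\<lambda>i. fst (e i (a i)) j) k"
        by (rule group_hom.hom_mprod[OF prH[OF j] e])
      also have "\<dots> = fst (e j (a j)) j"
        by (rule H.mprod_single[OF j]) (use j a in \<open>auto simp: e_def\<close>)
      finally show ?thesis using j by (simp add: e_def)
    qed
    show "snd ?L t = snd ?R t" if t: "t < r" for t
    proof -
      have "snd ?L t = mprod integer_group (\<lambda>i. snd (e i (a i)) t) k"
        by (rule group_hom.hom_mprod[OF prZ[OF t] e])
      also have "\<dots> = \<one>\<^bsub>integer_group\<^esub>"
        by (rule monoid.mprod_one[OF group.is_monoid[OF group_integer_group]]) (use t in \<open>simp add: e_def\<close>)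
      finally show ?thesis using t by simp
    qed
  qed
  have \<iota>_mprod: "mprod G (\<lambda>i. \<iota> i (a i)) k = \<kappa> (\<lambda>i\<in>{..<k}. a i, \<lambda>t\<in>{..<r}. 0)"
    if a: "\<And>i. i < k \<Longrightarrow> a i \<in> carrier H" for a
    using \<kappa>.hom_mprod[of k "\<lambda>i. e i (a i)"] e_in[OF a] e_mprod[OF a] by (simp add: \<iota>_def)
  define \<delta> where "\<delta> h = (\<lambda>i\<in>{..<k}. h, \<lambda>t\<in>{..<r}. 0 :: int)" for h :: 'a
  have \<delta>_in: "\<delta> h \<in> carrier P" if "h \<in> carrier H" for h
    using that by (auto simp: P_carrier \<delta>_def)
  define f where "f h = \<kappa> (\<delta> h)" for h
  have \<delta>_mult: "\<delta> (h \<otimes>\<^bsub>H\<^esub> h') = \<delta> h \<otimes>\<^bsub>P\<^esub> \<delta> h'" for h h'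
    by (auto simp: \<delta>_def P_mult fun_eq_iff)
  have f_hom: "group_hom H G f"
    using \<delta>_in by (auto simp: group_hom_def group_hom_axioms_def hom_def f_def H G.group_axioms \<delta>_mult)
  interpret f: group_hom H G f by (rule f_hom)
  have f_inj: "inj_on f (carrier H)"
    unfolding f.inj_on_one_iff
  proof (intro allI impI)
    fix h assume h: "h \<in> carrier H" "f h = \<one>\<^bsub>G\<^esub>"
    then have "\<delta> h \<in> N" using \<kappa>_one[OF \<delta>_in] by (simp add: f_def)
    then obtain b where b: "\<delta> h = \<nu> b" by (auto simp: N_def)
    \<comment> \<open>The integer coordinates force b = 0 because q > 0; coordinate 0, which exists
      because k > 0, then gives h = 1.\<close>
    have "b t = 0" if "t < r" for t
      using arg_cong[OF b, of "\<lambda>p. snd p t"] that q by (simp add: \<delta>_def \<nu>_def)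
    then have "F b 0 = 0" by (simp add: F_def)
    then show "h = \<one>\<^bsub>H\<^esub>"
      using arg_cong[OF b, of "\<lambda>p. fst p 0"] k by (simp add: \<delta>_def \<nu>_def)
  qed
  have f_mon: "f \<in> mon H G" using f_inj f.homh by (simp add: mon_def)

  have vc: "verbally_closed_subgroup (f ` carrier H) G"
    unfolding verbally_closed_subgroup_def
  proof (intro conjI allI ballI iffI)
    show "subgroup (f ` carrier H) G" by (rule f.img_is_subgroup)
  next
    fix s w g
    assume "\<exists>y \<in> {..<s} \<rightarrow> f ` carrier H. word_val G y w = g"
    moreover have "{..<s} \<rightarrow> f ` carrier H \<subseteq> {..<s} \<rightarrow> carrier G" by (rule Pi_mono) auto
    ultimately show "\<exists>y \<in> {..<s} \<rightarrow> carrier G. word_val G y w = g" by blast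
  next
    fix s g and w :: "((nat \<Rightarrow> 'a) \<times> (nat \<Rightarrow> int)) set letter list"
    assume w: "w \<in> words {} s" and g: "g \<in> f ` carrier H"
      and "\<exists>y \<in> {..<s} \<rightarrow> carrier G. word_val G y w = g"
    then obtain y where y: "y \<in> {..<s} \<rightarrow> carrier G" "word_val G y w = g" by blast
    obtain h where h: "h \<in> carrier H" "g = f h" using g by blast
    have "\<forall>j\<in>{..<s}. \<exists>p\<in>carrier P. y j = \<kappa> p" using y(1) \<kappa>_surj by blast
    then obtain p where p: "\<And>j. j \<in> {..<s} \<Longrightarrow> p j \<in> carrier P" "\<And>j. j \<in> {..<s} \<Longrightarrow> y j = \<kappa> (p j)"
      by metis
    then have pP: "p \<in> {..<s} \<rightarrow> carrier P" by blast
    \<comment> \<open>The same word with the coefficient types of \<open>P\<close>, of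
      \<open>H\<close> and of the integers, to be evaluated coordinatewise.\<close>
    define wP where "wP = map (map_letter (\<lambda>_. undefined :: (nat \<Rightarrow> 'a) \<times> (nat \<Rightarrow> int))) w"
    define wH where "wH = map (map_letter (\<lambda>_. undefined :: 'a)) w"
    define wZ where "wZ = map (map_letter (\<lambda>_. undefined :: int)) w"
    have wP: "wP \<in> words {} s" and wH: "wH \<in> words {} s" and wZ: "wZ \<in> words {} s"
      unfolding wP_def wH_def wZ_def by (rule map_letter_free[OF w])+
    have wPG: "map (map_letter u) wP = w" and wHG: "map (map_letter u') wH = w" for u u'
      unfolding wP_def wH_def by (rule map_letter_free_id[OF w])+
    have wPH: "map (map_letter u) wP = wH" and wPZ: "map (map_letter v) wP = wZ" and wHZ: "map (map_letter v') wH = wZ" for u v v'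
      unfolding wP_def wH_def wZ_def using map_letter_free_cong[OF w]
      by (simp_all only: map_map comp_def letter.map_comp)
    let ?W = "word_val P p wP"
    have W: "?W \<in> carrier P" using word_val_closed[OF P.group_axioms _ pP wP] by blast
    have "g = \<kappa> ?W"
      using word_val_free_hom[OF \<kappa> pP wP, of undefined] word_val_cong[OF w, of y "\<lambda>j. \<kappa> (p j)" G] p(2) y(2)
      by (simp add: wPG)
    then have "\<kappa> (?W \<otimes>\<^bsub>P\<^esub> inv\<^bsub>P\<^esub> \<delta> h) = \<one>\<^bsub>G\<^esub>"
      using W \<delta>_in[OF h(1)] h(2) by (simp add: f_def)
    then have "?W \<otimes>\<^bsub>P\<^esub> inv\<^bsub>P\<^esub> \<delta> h \<in> N"
      using \<kappa>_one[of "?W \<otimes>\<^bsub>P\<^esub> inv\<^bsub>P\<^esub> \<delta> h"] W \<delta>_in[OF h(1)] P.m_closed P.inv_closed by blast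
    then obtain b where "?W \<otimes>\<^bsub>P\<^esub> inv\<^bsub>P\<^esub> \<delta> h = \<nu> b" by (auto simp: N_def)
    then have W_eq: "?W = \<nu> b \<otimes>\<^bsub>P\<^esub> \<delta> h"
      using W \<delta>_in[OF h(1)] \<nu>_in[of b] by (simp add: P.inv_solve_right')
    have WH: "word_val H (\<lambda>j. fst (p j) i) wH = c [^]\<^bsub>H\<^esub> F b i \<otimes>\<^bsub>H\<^esub> h" if i: "i < k" for i
      using word_val_free_hom[OF prH[OF i] pP wP, of undefined] i
      by (simp add: wPH W_eq P_mult) (simp add: \<nu>_def \<delta>_def)
    have WZ: "word_val integer_group (\<lambda>j. snd (p j) t) wZ = int q * b t" if t: "t < r" for t
      using word_val_free_hom[OF prZ[OF t] pP wP, of undefined] t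
      by (simp add: wPZ W_eq P_mult) (simp add: \<nu>_def \<delta>_def)
    \<comment> \<open>The integer coordinates of the lifted solution show that each
      \<open>q * b t\<close> is a value of the word on \<int>, hence a multiple of m.\<close>
    obtain m where m: "range (\<lambda>v. word_val integer_group v wZ) = {z. m dvd z}"
      using word_val_integer_group_range[OF wZ] by (elim exE)
    have "m dvd int q * b t" if "t < r" for t
    proof -
      have "int q * b t \<in> range (\<lambda>v. word_val integer_group v wZ)"
        unfolding WZ[OF that, symmetric] by (rule rangeI)
      then show ?thesis unfolding m by simp
    qed
    then obtain i where i: "i < k" "m dvd F b i"
      using dvd_covering_code[OF q code, of m b] unfolding F_def by blast
    then have "- F b i \<in> range (\<lambda>v. word_val integer_group v wZ)" unfolding m by simp
    then obtain v where v: "word_val integer_group v wZ = - F b i" by auto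
    \<comment> \<open>By \<open>WH\<close>, coordinate i of the lift solves the equation up to the
      factor c^(F b i). Multiplying the arguments by powers of c with exponents \<open>v\<close>
      cancels it, since the word takes the value - F b i at \<open>v\<close>.\<close>
    define x where "x j = fst (p j) i \<otimes>\<^bsub>H\<^esub> c [^]\<^bsub>H\<^esub> v j" for j
    have pH: "(\<lambda>j. fst (p j) i) \<in> {..<s} \<rightarrow> carrier H" using P_fst[OF p(1) i(1)] by blast
    have x: "x \<in> {..<s} \<rightarrow> carrier H" using P_fst[OF p(1) i(1)] cH by (auto simp: x_def)
    have "word_val H x wH = c [^]\<^bsub>H\<^esub> F b i \<otimes>\<^bsub>H\<^esub> h \<otimes>\<^bsub>H\<^esub> c [^]\<^bsub>H\<^esub> (- F b i)"
      using word_val_free_central_shift[OF H c pH wH, of v undefined] WH[OF i(1)]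
      by (simp add: wHZ v x_def[abs_def])
    also have "c [^]\<^bsub>H\<^esub> F b i \<otimes>\<^bsub>H\<^esub> h = h \<otimes>\<^bsub>H\<^esub> c [^]\<^bsub>H\<^esub> F b i" by (rule cpow[OF h(1)])
    also have "h \<otimes>\<^bsub>H\<^esub> c [^]\<^bsub>H\<^esub> F b i \<otimes>\<^bsub>H\<^esub> c [^]\<^bsub>H\<^esub> (- F b i) = h"
      using cH h(1) by (simp add: H.m_assoc H.int_pow_neg)
    finally have "word_val G (\<lambda>j. f (x j)) w = g"
      using word_val_free_hom[OF f_hom x wH, of undefined] h(2) by (simp add: wHG)
    moreover have "(\<lambda>j. f (x j)) \<in> {..<s} \<rightarrow> f ` carrier H" using x by auto
    ultimately show "\<exists>y \<in> {..<s} \<rightarrow> f ` carrier H. word_val G y w = g" by blast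
  qed

  define d where "d t = (\<lambda>i\<in>{..<k}. \<one>\<^bsub>H\<^esub>, \<lambda>t'\<in>{..<r}. if t' = t then 1 else 0 :: int)" for t
  have d_in: "d t \<in> carrier P" for t by (auto simp: P_carrier d_def)
  define \<upsilon> where "\<upsilon> t = \<kappa> (d t)" for t
  have \<iota>_hom: "\<iota> i \<in> hom H G" if "i < k" for i
    by (rule homI) (simp_all add: \<iota>_def e_in e_mult)
  have \<iota>_comm: "\<iota> i a \<otimes>\<^bsub>G\<^esub> \<iota> j b = \<iota> j b \<otimes>\<^bsub>G\<^esub> \<iota> i a"
    if "i \<noteq> j" "a \<in> carrier H" "b \<in> carrier H" for i j a b
  proof -
    have "e i a \<otimes>\<^bsub>P\<^esub> e j b = e j b \<otimes>\<^bsub>P\<^esub> e i a"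
      using that by (auto simp: P_mult e_def fun_eq_iff)
    then show ?thesis using e_in that by (simp add: \<iota>_def flip: \<kappa>.hom_mult)
  qed
  have f_mprod: "mprod G (\<lambda>i. \<iota> i h) k = f h" if "h \<in> carrier H" for h
    using \<iota>_mprod[of "\<lambda>_. h"] that by (simp add: f_def \<delta>_def)
  have \<upsilon>_centre: "\<upsilon> t \<in> centre G" for t
  proof -
    have "\<upsilon> t \<otimes>\<^bsub>G\<^esub> g = g \<otimes>\<^bsub>G\<^esub> \<upsilon> t" if g: "g \<in> carrier G" for g
    proof -
      obtain p where p: "p \<in> carrier P" "g = \<kappa> p" using \<kappa>_surj[OF g] by blast
      have "d t \<otimes>\<^bsub>P\<^esub> p = p \<otimes>\<^bsub>P\<^esub> d t"
        using P_fst[OF p(1)] by (auto simp: P_mult d_def fun_eq_iff)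
      then show ?thesis using p d_in by (simp add: \<upsilon>_def flip: \<kappa>.hom_mult)
    qed
    then show ?thesis using d_in unfolding centre_def \<upsilon>_def by simp
  qed
  have rel: "mprod G (\<lambda>i. \<iota> i (c [^]\<^bsub>H\<^esub> \<epsilon> t i)) k \<otimes>\<^bsub>G\<^esub> \<upsilon> t [^]\<^bsub>G\<^esub> q = \<one>\<^bsub>G\<^esub>" if t: "t < r" for t
  proof -
    define p where "p = (\<lambda>i\<in>{..<k}. c [^]\<^bsub>H\<^esub> \<epsilon> t i, \<lambda>t\<in>{..<r}. 0 :: int)"
    have p: "p \<in> carrier P" using cH by (auto simp: P_carrier p_def)
    \<comment> \<open>The unit vector at t: the corresponding element of \<open>N\<close> is the
      relation of row t.\<close>
    define b :: "nat \<Rightarrow> int" where "b t' = of_bool (t' = t)" for t'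
    have Fb: "F b i = int (\<epsilon> t i)" for i
      using t by (simp add: F_def b_def of_bool_def if_distrib[of "\<lambda>x. x * _"] sum.If_cases cong: if_cong)
    have "p \<otimes>\<^bsub>P\<^esub> d t [^]\<^bsub>P\<^esub> q = \<nu> b"
    proof (rule P_ext)
      show "p \<otimes>\<^bsub>P\<^esub> d t [^]\<^bsub>P\<^esub> q \<in> carrier P" using p d_in by simp
      show "\<nu> b \<in> carrier P" by (rule \<nu>_in)
      show "fst (p \<otimes>\<^bsub>P\<^esub> d t [^]\<^bsub>P\<^esub> q) i = fst (\<nu> b) i" if i: "i < k" for i
        using group_hom.hom_nat_pow[OF prH[OF i] d_in, of t q] i cH
        by (simp add: P_mult) (simp add: p_def d_def \<nu>_def Fb int_pow_int)
      show "snd (p \<otimes>\<^bsub>P\<^esub> d t [^]\<^bsub>P\<^esub> q) t' = snd (\<nu> b) t'" if t': "t' < r" for t'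
      proof -
        have "snd (d t [^]\<^bsub>P\<^esub> q) t' = snd (d t) t' [^]\<^bsub>integer_group\<^esub> q"
          by (rule group_hom.hom_nat_pow[OF prZ[OF t'] d_in])
        also have "\<dots> = int q * snd (d t) t'"
          using group_int_pow_integer_group[of "snd (d t) t'" "int q"] by (simp add: int_pow_int mult.commute)
        finally show ?thesis using t' by (simp add: P_mult) (simp add: p_def d_def \<nu>_def b_def)
      qed
    qed
    then have "p \<otimes>\<^bsub>P\<^esub> d t [^]\<^bsub>P\<^esub> q \<in> N" by (simp add: N_def)
    then have "\<kappa> (p \<otimes>\<^bsub>P\<^esub> d t [^]\<^bsub>P\<^esub> q) = \<one>\<^bsub>G\<^esub>"
      using \<kappa>_one P.m_closed[OF p P.nat_pow_closed[OF d_in]] by blast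
    moreover have "mprod G (\<lambda>i. \<iota> i (c [^]\<^bsub>H\<^esub> \<epsilon> t i)) k = \<kappa> p"
      using \<iota>_mprod[of "\<lambda>i. c [^]\<^bsub>H\<^esub> \<epsilon> t i"] cH by (simp add: p_def)
    ultimately show ?thesis using p d_in by (simp add: \<upsilon>_def \<kappa>.hom_nat_pow)
  qed
  show ?thesis
    by (rule exI[of _ G], rule exI[of _ f], rule exI[of _ \<iota>], rule exI[of _ \<upsilon>],
        intro conjI allI impI ballI G.group_axioms f_mon vc \<iota>_hom f_mprod \<upsilon>_centre rel \<iota>_comm)
qed

section \<open>Central roots\<close>

lemma (in group) mprod_in_subgroup:
  assumes "subgroup K G" "\<And>i. i < n \<Longrightarrow> f i \<in> K"
  shows "mprod G f n \<in> K"
  using assms(2) by (induction n) (auto intro: subgroup.one_closed[OF assms(1)] subgroup.m_closed[OF assms(1)])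

lemma (in group) mprod_commute:
  assumes "x \<in> carrier G" "\<And>i. i < n \<Longrightarrow> f i \<in> carrier G" "\<And>i. i < n \<Longrightarrow> x \<otimes> f i = f i \<otimes> x"
  shows "x \<otimes> mprod G f n = mprod G f n \<otimes> x"
  using assms(2,3)
proof (induction n)
  case 0
  then show ?case using assms(1) by simp
next
  case (Suc n)
  have cl: "mprod G f n \<in> carrier G" "f n \<in> carrier G" using Suc.prems by auto
  have "x \<otimes> (mprod G f n \<otimes> f n) = (x \<otimes> mprod G f n) \<otimes> f n" using cl assms(1) by (simp add: m_assoc)
  also have "x \<otimes> mprod G f n = mprod G f n \<otimes> x" by (rule Suc.IH) (use Suc.prems in auto)
  also have "mprod G f n \<otimes> x \<otimes> f n = mprod G f n \<otimes> (x \<otimes> f n)" using cl assms(1) by (simp add: m_assoc)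
  also have "x \<otimes> f n = f n \<otimes> x" using Suc.prems(2) by simp
  finally show ?case using cl assms(1) by (simp add: m_assoc)
qed

lemma (in group) mprod_mult:
  assumes "\<And>i. i < n \<Longrightarrow> f i \<in> carrier G" "\<And>i. i < n \<Longrightarrow> g i \<in> carrier G"
    and "\<And>i j. i < n \<Longrightarrow> j < n \<Longrightarrow> i \<noteq> j \<Longrightarrow> f i \<otimes> g j = g j \<otimes> f i"
  shows "mprod G (\<lambda>i. f i \<otimes> g i) n = mprod G f n \<otimes> mprod G g n"
  using assms
proof (induction n)
  case (Suc n)
  have cl: "mprod G f n \<in> carrier G" "f n \<in> carrier G" "mprod G g n \<in> carrier G" "g n \<in> carrier G"
    using Suc.prems by auto
  have "mprod G (\<lambda>i. f i \<otimes> g i) (Suc n) = mprod G f n \<otimes> mprod G g n \<otimes> (f n \<otimes> g n)"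
    using Suc by simp
  also have "\<dots> = mprod G f n \<otimes> (mprod G g n \<otimes> f n) \<otimes> g n" using cl by (simp add: m_assoc)
  also have "mprod G g n \<otimes> f n = f n \<otimes> mprod G g n"
    by (rule mprod_commute[symmetric]) (use Suc.prems cl in auto)
  also have "mprod G f n \<otimes> (f n \<otimes> mprod G g n) \<otimes> g n = mprod G f (Suc n) \<otimes> mprod G g (Suc n)"
    using cl by (simp add: m_assoc)
  finally show ?case .
qed simp

lemma (in group) mprod_int_pow:
  fixes z :: int
  assumes "\<And>i. i < n \<Longrightarrow> f i \<in> carrier G"
    and "\<And>i j. i < n \<Longrightarrow> j < n \<Longrightarrow> i \<noteq> j \<Longrightarrow> f i \<otimes> f j = f j \<otimes> f i"
  shows "mprod G (\<lambda>i. f i [^] z) n = mprod G f n [^] z"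
  using assms
proof (induction n)
  case (Suc n)
  have cl: "mprod G f n \<in> carrier G" "f n \<in> carrier G" using Suc.prems by auto
  have "mprod G f n \<otimes> f n = f n \<otimes> mprod G f n"
    by (rule mprod_commute[symmetric]) (use Suc.prems cl in auto)
  then have "(mprod G f n \<otimes> f n) [^] z = mprod G f n [^] z \<otimes> f n [^] z"
    using cl by (intro int_pow_mult_distrib)
  then show ?case using Suc by simp
qed simp

section \<open>Words in generators and in commuting assignments\<close>

lemma (in group) word_val_in_subgroup:
  assumes "subgroup K G" "x \<in> {..<r} \<rightarrow> K" "w \<in> words {} r"
  shows "word_val G x w \<in> K"
  using word_val_hom[OF group_axioms group_axioms assms(1) _ _ assms(2,3), of "\<lambda>x. x"]
    subgroup.subset[OF assms(1)] by (auto simp: hom_def)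

lemma (in group) word_val_in_generate:
  assumes "x \<in> {..<r} \<rightarrow> carrier G" "w \<in> words {} r"
  shows "word_val G x w \<in> generate G (x ` {..<r})"
  by (rule word_val_in_subgroup[OF generate_is_subgroup _ assms(2)])
     (use assms(1) in \<open>auto intro: generate.incl\<close>)

text \<open>A root of a central element is written as a word in the generators, so that it can be
  copied into each of the k factors inside an equation.\<close>

lemma (in group) ex_word:
  assumes "a \<in> generate G (g ` {..<d})" "g \<in> {..<d} \<rightarrow> carrier G"
  shows "\<exists>u\<in>words {} d. word_val G g u = a"
  using assms(1)
proof (induction rule: generate.induct)
  case one
  show ?case by (intro bexI[of _ "[]"]) (auto simp: words_def)
next
  case (incl h)
  then obtain s where s: "s < d" "h = g s" by blast
  moreover have "g s \<in> carrier G" using s assms(2) by blast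
  ultimately show ?case by (intro bexI[of _ "[Var s]"]) (auto simp: words_def letters_def)
next
  case (inv h)
  then obtain s where s: "s < d" "h = g s" by blast
  moreover have "g s \<in> carrier G" using s assms(2) by blast
  ultimately show ?case by (intro bexI[of _ "[InvVar s]"]) (auto simp: words_def letters_def)
next
  case (eng h1 h2)
  then obtain u v where "u \<in> words {} d" "word_val G g u = h1" "v \<in> words {} d" "word_val G g v = h2"
    by blast
  then show ?case using word_val_append[OF group_axioms empty_subsetI assms(2), of u v]
    by (intro bexI[of _ "u @ v"]) (auto simp: words_def)
qed

lemma (in group) word_val_commuting_mult:
  assumes x: "x \<in> {..<d} \<rightarrow> carrier G" and y: "y \<in> {..<d} \<rightarrow> carrier G"
    and comm: "\<And>s s'. s < d \<Longrightarrow> s' < d \<Longrightarrow> x s \<otimes> y s' = y s' \<otimes> x s"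
    and w: "w \<in> words {} d"
  shows "word_val G (\<lambda>s. x s \<otimes> y s) w = word_val G x w \<otimes> word_val G y w"
  using w
proof (induction w)
  case (Cons l w)
  then have l: "[l] \<in> words {} d" and w: "w \<in> words {} d" by (auto simp: words_def)
  have sub: "x ` {..<d} \<subseteq> carrier G" "y ` {..<d} \<subseteq> carrier G" using x y by auto
  have lcl: "letter_val G x l \<in> carrier G" "letter_val G y l \<in> carrier G"
    using letter_val_closed[OF group_axioms _ empty_subsetI] x y l by (auto simp: words_def)
  have gen: "word_val G x w \<in> generate G (x ` {..<d})" "letter_val G y l \<in> generate G (y ` {..<d})"
    "letter_val G x l \<in> generate G (x ` {..<d})"
    using word_val_in_generate[OF x w] word_val_in_generate[OF y l] word_val_in_generate[OF x l] lcl by auto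
  have swap: "a \<otimes> b = b \<otimes> a" if "a \<in> generate G (x ` {..<d})" "b \<in> generate G (y ` {..<d})" for a b
    by (rule commute_generate[OF sub _ that]) (use comm in auto)
  have cl: "word_val G x w \<in> carrier G" "word_val G y w \<in> carrier G"
    using word_val_closed[OF group_axioms empty_subsetI _ w] x y by auto
  have "letter_val G (\<lambda>s. x s \<otimes> y s) l = letter_val G x l \<otimes> letter_val G y l"
  proof (cases l)
    case (InvVar s)
    then have s: "s < d" "x s \<in> carrier G" "y s \<in> carrier G" using l x y by (auto simp: words_def letters_def)
    have "inv (x s \<otimes> y s) = inv (y s \<otimes> x s)" using comm[of s s] s by simp
    then show ?thesis using InvVar s by (simp add: inv_mult_group)
  qed (use l in \<open>auto simp: words_def letters_def\<close>)
  then have "word_val G (\<lambda>s. x s \<otimes> y s) (l # w)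
      = letter_val G x l \<otimes> (letter_val G y l \<otimes> word_val G x w) \<otimes> word_val G y w"
    using Cons.IH[OF w] lcl cl by (simp add: m_assoc)
  also have "letter_val G y l \<otimes> word_val G x w = word_val G x w \<otimes> letter_val G y l"
    by (rule swap[OF gen(1,2), symmetric])
  finally show ?case using lcl cl by (simp add: m_assoc)
qed simp

text \<open>Splitting the generators into commuting parts thereby splits every element: this yields
  the factors of a root from those of the generators.\<close>

lemma (in group) word_val_mprod:
  assumes z: "\<And>i s. i < k \<Longrightarrow> s < d \<Longrightarrow> z i s \<in> carrier G"
    and comm: "\<And>i j s s'. i < k \<Longrightarrow> j < k \<Longrightarrow> i \<noteq> j \<Longrightarrow> s < d \<Longrightarrow> s' < d \<Longrightarrow> z i s \<otimes> z j s' = z j s' \<otimes> z i s"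
    and w: "w \<in> words {} d"
  shows "word_val G (\<lambda>s. mprod G (\<lambda>i. z i s) k) w = mprod G (\<lambda>i. word_val G (z i) w) k"
  using z comm
proof (induction k)
  case 0
  have "word_val G (\<lambda>s. \<one>) w = \<one>"
    using word_val_in_subgroup[OF triv_subgroup, of "\<lambda>s. \<one>" d w] w by auto
  then show ?case by simp
next
  case (Suc k)
  have "word_val G (\<lambda>s. mprod G (\<lambda>i. z i s) k \<otimes> z k s) w
      = word_val G (\<lambda>s. mprod G (\<lambda>i. z i s) k) w \<otimes> word_val G (z k) w"
  proof (rule word_val_commuting_mult[OF _ _ _ w])
    show "(\<lambda>s. mprod G (\<lambda>i. z i s) k) \<in> {..<d} \<rightarrow> carrier G" "z k \<in> {..<d} \<rightarrow> carrier G"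
      using Suc.prems(1) by auto
    show "mprod G (\<lambda>i. z i s) k \<otimes> z k s' = z k s' \<otimes> mprod G (\<lambda>i. z i s) k" if "s < d" "s' < d" for s s'
      by (rule mprod_commute[symmetric]) (use Suc.prems that in auto)
  qed
  then show ?case using Suc by simp
qed

section \<open>Central roots, from commuting products to arbitrary exponents\<close>

lemma (in group) centre_commute: "z \<in> centre G \<Longrightarrow> g \<in> carrier G \<Longrightarrow> z \<otimes> g = g \<otimes> z"
  unfolding centre_def by blast

lemma (in group) central_powers_mult:
  assumes "x \<in> centre G" "y \<in> centre G"
  shows "x [^] (n :: int) \<otimes> y [^] n = (x \<otimes> y) [^] n"
proof -
  have "x \<in> carrier G" "y \<in> carrier G" using assms by (auto simp: centre_def)
  then show ?thesis using int_pow_mult_distrib[OF centre_commute[OF assms(1)]] by simp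
qed

text \<open>
  If all but the indices in a small set \<open>L\<close> give central factors \<open>a\<^sub>i\<close> of \<open>a = \<Prod>i. a\<^sub>i\<close>, then a
  combination of the relations that is \<open>1\<close> on \<open>L\<close> expresses the noncentral part of \<open>a\<^sup>q\<close> by central
  \<open>q\<close>-th powers.
\<close>

lemma (in group) central_root_of_commuting_product:
  fixes \<epsilon> :: "nat \<Rightarrow> nat \<Rightarrow> nat" and q :: nat
  assumes a: "\<And>i. i < k \<Longrightarrow> a i \<in> carrier G"
    and comm: "\<And>i j. i < k \<Longrightarrow> j < k \<Longrightarrow> i \<noteq> j \<Longrightarrow> a i \<otimes> a j = a j \<otimes> a i"
    and \<eta>: "\<And>t. t < r \<Longrightarrow> \<eta> t \<in> centre G"
    and rel: "\<And>t. t < r \<Longrightarrow> mprod G (\<lambda>i. a i [^] (\<epsilon> t i * q)) k \<otimes> \<eta> t [^] q = \<one>"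
    and b: "\<And>i. i < k \<Longrightarrow> a i \<notin> centre G \<Longrightarrow> (\<Sum>t<r. b t * int (\<epsilon> t i)) = 1"
  shows "\<exists>\<zeta>\<in>centre G. \<zeta> [^] int q = mprod G a k [^] int q"
proof -
  have comm': "a i \<otimes> a j = a j \<otimes> a i" if "i < k" "j < k" for i j
    using comm[OF that] by (cases "i = j") auto
  have pow_comm: "a i [^] (m :: int) \<otimes> a j [^] (n :: int) = a j [^] n \<otimes> a i [^] m" if "i < k" "j < k" for i j m n
  proof (rule commute_generate[of "{a i}" "{a j}"])
    show "a i [^] m \<in> generate G {a i}" "a j [^] n \<in> generate G {a j}"
      using generate_pow a that by auto
  qed (use a that comm'[OF that] in auto)
  \<comment> \<open>As the a i commute, this is a homomorphism from exponent vectors, which reduces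
    the argument to linear algebra over \<int>.\<close>
  define \<Phi> where "\<Phi> v = mprod G (\<lambda>i. a i [^] (v i :: int)) k" for v
  have \<Phi>_cl: "\<Phi> v \<in> carrier G" for v using a by (auto simp: \<Phi>_def)
  have \<Phi>_add: "\<Phi> (\<lambda>i. v i + v' i) = \<Phi> v \<otimes> \<Phi> v'" for v v'
  proof -
    have "\<Phi> (\<lambda>i. v i + v' i) = mprod G (\<lambda>i. a i [^] v i \<otimes> a i [^] v' i) k"
      unfolding \<Phi>_def by (rule mprod_cong) (simp add: a int_pow_mult)
    also have "\<dots> = \<Phi> v \<otimes> \<Phi> v'"
      unfolding \<Phi>_def by (rule mprod_mult) (use a pow_comm in auto)
    finally show ?thesis .
  qed
  have \<Phi>_scale: "\<Phi> (\<lambda>i. v i * n) = \<Phi> v [^] n" for v and n :: int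
  proof -
    have "\<Phi> (\<lambda>i. v i * n) = mprod G (\<lambda>i. (a i [^] v i) [^] n) k"
      unfolding \<Phi>_def by (rule mprod_cong) (simp add: a int_pow_pow)
    also have "\<dots> = \<Phi> v [^] n"
      unfolding \<Phi>_def by (rule mprod_int_pow) (use a pow_comm in auto)
    finally show ?thesis .
  qed
  note Zpow = subgroup_int_pow_closed[OF centre_subgroup]
  \<comment> \<open>Row t says that its exponents, multiplied by q, give the q-th power of the
    central element \<open>inv (\<eta> t)\<close>. The combination is accumulated row by
    row.\<close>
  have "\<exists>\<zeta>\<in>centre G. \<Phi> (\<lambda>i. (\<Sum>t<r'. b t * int (\<epsilon> t i)) * int q) = \<zeta> [^] int q" if "r' \<le> r" for r'
    using that
  proof (induction r')
    case 0
    have "\<Phi> (\<lambda>i. 0) = \<one>" unfolding \<Phi>_def by (rule mprod_one) simp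
    then show ?case using subgroup.one_closed[OF centre_subgroup] by (intro bexI[of _ \<one>]) auto
  next
    case (Suc t)
    then obtain \<zeta> where \<zeta>: "\<zeta> \<in> centre G" "\<Phi> (\<lambda>i. (\<Sum>t<t. b t * int (\<epsilon> t i)) * int q) = \<zeta> [^] int q"
      by auto
    have t: "t < r" using Suc.prems by simp
    have \<eta>_cl: "\<eta> t \<in> carrier G" using \<eta>[OF t] by (simp add: centre_def)
    have "\<Phi> (\<lambda>i. int (\<epsilon> t i) * int q) = mprod G (\<lambda>i. a i [^] (\<epsilon> t i * q)) k"
      unfolding \<Phi>_def by (rule mprod_cong) (simp flip: int_pow_int)
    then have "\<Phi> (\<lambda>i. int (\<epsilon> t i) * int q) \<otimes> \<eta> t [^] q = \<one>" using rel[OF t] by simp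
    then have "\<Phi> (\<lambda>i. int (\<epsilon> t i) * int q) = inv (\<eta> t [^] q)"
      using \<Phi>_cl \<eta>_cl by (simp add: inv_equality)
    also have "\<dots> = inv (\<eta> t) [^] int q" using \<eta>_cl by (simp add: int_pow_int nat_pow_inv)
    finally have 1: "\<Phi> (\<lambda>i. int (\<epsilon> t i) * int q) = inv (\<eta> t) [^] int q" .
    have "\<Phi> (\<lambda>i. (b t * int (\<epsilon> t i)) * int q) = \<Phi> (\<lambda>i. (int (\<epsilon> t i) * int q) * b t)"
      by (simp add: mult_ac)
    also have "\<dots> = (inv (\<eta> t) [^] int q) [^] b t"
      using \<Phi>_scale[of "\<lambda>i. int (\<epsilon> t i) * int q" "b t"] unfolding 1 .
    also have "\<dots> = (inv (\<eta> t) [^] b t) [^] int q"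
      using \<eta>_cl by (simp add: int_pow_pow mult.commute)
    finally have 2: "\<Phi> (\<lambda>i. (b t * int (\<epsilon> t i)) * int q) = (inv (\<eta> t) [^] b t) [^] int q" .
    have "inv (\<eta> t) [^] b t \<in> centre G"
      by (rule Zpow[OF subgroup.m_inv_closed[OF centre_subgroup \<eta>[OF t]]])
    moreover have "\<Phi> (\<lambda>i. (\<Sum>t<Suc t. b t * int (\<epsilon> t i)) * int q)
        = \<zeta> [^] int q \<otimes> (inv (\<eta> t) [^] b t) [^] int q"
      using \<Phi>_add[of "\<lambda>i. (\<Sum>t<t. b t * int (\<epsilon> t i)) * int q" "\<lambda>i. (b t * int (\<epsilon> t i)) * int q"]
      by (simp add: \<zeta>(2) 2 distrib_right)
    ultimately show ?case
      using \<zeta>(1) central_powers_mult subgroup.m_closed[OF centre_subgroup] by metis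
  qed
  from this[OF order_refl] obtain \<zeta> where \<zeta>: "\<zeta> \<in> centre G"
    "\<Phi> (\<lambda>i. (\<Sum>t<r. b t * int (\<epsilon> t i)) * int q) = \<zeta> [^] int q" by blast
  \<comment> \<open>The all-one vector is v plus the combination. At noncentral a i the entry of v
    is 0, so \<Phi> v is central.\<close>
  define v where "v i = 1 - (\<Sum>t<r. b t * int (\<epsilon> t i))" for i
  have v: "\<Phi> v \<in> centre G" unfolding \<Phi>_def
  proof (rule mprod_in_subgroup[OF centre_subgroup])
    fix i assume i: "i < k"
    show "a i [^] v i \<in> centre G"
    proof (cases "a i \<in> centre G")
      case True
      then show ?thesis by (rule Zpow)
    next
      case False
      then have "v i = 0" using b[OF i] by (simp add: v_def)
      then show ?thesis using subgroup.one_closed[OF centre_subgroup] by simp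
    qed
  qed
  have "mprod G a k = \<Phi> (\<lambda>i. 1)" unfolding \<Phi>_def by (rule mprod_cong) (simp add: a)
  then have "mprod G a k [^] int q = \<Phi> (\<lambda>i. 1 * int q)" using \<Phi>_scale[of "\<lambda>i. 1" "int q"] by simp
  also have "\<dots> = \<Phi> (\<lambda>i. v i * int q + (\<Sum>t<r. b t * int (\<epsilon> t i)) * int q)"
    by (simp add: v_def flip: distrib_right)
  also have "\<dots> = \<Phi> v [^] int q \<otimes> \<zeta> [^] int q"
    by (simp only: \<Phi>_add \<Phi>_scale[of v] \<zeta>(2))
  also have "\<dots> = (\<Phi> v \<otimes> \<zeta>) [^] int q" by (rule central_powers_mult[OF v \<zeta>(1)])
  finally show ?thesis using subgroup.m_closed[OF centre_subgroup v \<zeta>(1)] by metis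
qed

text \<open>For n = q m with q, m coprime, let x be a central m-th root and y a central q-th root of
  a^n. If \<alpha> q + \<beta> m = 1, then x^\<alpha> y^\<beta> is a central n-th root. Here q is
  the full power of a prime in n, and m is left to the induction.\<close>

lemma (in group) central_root_of_prime_power_roots:
  assumes prime_power: "\<And>p e a. Factorial_Ring.prime (p :: nat) \<Longrightarrow> a \<in> carrier G \<Longrightarrow>
      a [^] int (p ^ e) \<in> centre G \<Longrightarrow> \<exists>z\<in>centre G. z [^] int (p ^ e) = a [^] int (p ^ e)"
    and "n > 0" "a \<in> carrier G" "a [^] int n \<in> centre G"
  shows "\<exists>z\<in>centre G. z [^] int n = a [^] int n"
  using assms(2-)
proof (induction n arbitrary: a rule: less_induct)
  case (less n)
  note a = less.prems(2)
  show ?case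
  proof (cases "n = 1")
    case True
    then show ?thesis using less.prems by (intro bexI[of _ a]) auto
  next
    case False
    then obtain p where p: "Factorial_Ring.prime p" "p dvd n" using prime_factor_nat by blast
    have "n \<noteq> 0" "\<not> is_unit p" using less.prems p by (auto dest: not_prime_unit)
    then obtain m where m: "n = p ^ multiplicity p n * m" "\<not> p dvd m"
      by (rule multiplicity_decompose')
    define q where "q = p ^ multiplicity p n"
    have n: "n = q * m" using m(1) by (simp add: q_def)
    have "multiplicity p n > 0"
      using p \<open>n \<noteq> 0\<close> \<open>\<not> is_unit p\<close> by (simp add: multiplicity_gt_zero_iff)
    then have "q > 1" unfolding q_def using prime_gt_1_nat[OF p(1)] by (intro one_less_power)
    moreover have "m > 0" using n \<open>n \<noteq> 0\<close> by simp
    ultimately have "m < n" by (simp add: n)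
    have "coprime q m" unfolding q_def using p(1) m(2) by (simp add: prime_imp_coprime)
    then obtain \<alpha> \<beta> where bezout: "\<alpha> * int q + \<beta> * int m = 1"
      using bezout_int[of "int q" "int m"] by (auto simp: coprime_iff_gcd_eq_1)
    have 1: "(a [^] int q) [^] int m = a [^] int n" "(a [^] int m) [^] int q = a [^] int n"
      using a by (simp_all add: int_pow_pow n mult.commute)
    obtain x where x: "x \<in> centre G" "x [^] int m = a [^] int n"
      using less.IH[OF \<open>m < n\<close> \<open>m > 0\<close>, of "a [^] int q"] a less.prems(3) 1 by auto
    obtain y where y: "y \<in> centre G" "y [^] int q = a [^] int n"
      using prime_power[OF p(1), of "a [^] int m" "multiplicity p n"] a less.prems(3) 1
      by (auto simp: q_def)
    have cl: "x \<in> carrier G" "y \<in> carrier G" using x y by (auto simp: centre_def)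
    define z where "z = x [^] \<alpha> \<otimes> y [^] \<beta>"
    note Zpow = subgroup_int_pow_closed[OF centre_subgroup]
    have z: "z \<in> centre G" unfolding z_def
      by (intro subgroup.m_closed[OF centre_subgroup] Zpow x y)
    have "z [^] int n = (x [^] \<alpha>) [^] int n \<otimes> (y [^] \<beta>) [^] int n"
      unfolding z_def by (rule central_powers_mult[symmetric]) (intro Zpow x y)+
    also have "(x [^] \<alpha>) [^] int n = (x [^] int m) [^] (\<alpha> * int q)"
      using cl by (simp add: int_pow_pow n mult_ac)
    also have "(y [^] \<beta>) [^] int n = (y [^] int q) [^] (\<beta> * int m)"
      using cl by (simp add: int_pow_pow n mult_ac)
    also have "(x [^] int m) [^] (\<alpha> * int q) \<otimes> (y [^] int q) [^] (\<beta> * int m)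
        = (a [^] int n) [^] (\<alpha> * int q + \<beta> * int m)"
      unfolding x(2) y(2) using a by (subst int_pow_mult) auto
    also have "\<dots> = a [^] int n" unfolding bezout using a by simp
    finally show ?thesis using z by blast
  qed
qed

lemma (in group) pure_centreI:
  assumes root: "\<And>(n :: nat) a. n > 0 \<Longrightarrow> a \<in> carrier G \<Longrightarrow> a [^] int n \<in> centre G \<Longrightarrow>
    \<exists>z\<in>centre G. z [^] int n = a [^] int n"
  shows "pure_subgroup (centre G) G"
  unfolding pure_subgroup_def
proof (intro conjI centre_subgroup allI ballI iffI)
  fix n :: int and b assume b: "b \<in> centre G" and "\<exists>a\<in>carrier G. a [^] n = b"
  then obtain a where a: "a \<in> carrier G" "a [^] n = b" by blast
  consider "n = 0" | "n > 0" | "n < 0" by linarith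
  then show "\<exists>c\<in>centre G. c [^] n = b"
  proof cases
    case 1
    then show ?thesis using a subgroup.one_closed[OF centre_subgroup] by (intro bexI[of _ \<one>]) auto
  next
    case 2
    then show ?thesis using root[of "nat n" a] a b by auto
  next
    case 3
    define m where "m = nat (- n)"
    have m: "n = - int m" "m > 0" using 3 by (simp_all add: m_def)
    have inv: "a [^] int m = inv b" using a m by (auto simp: int_pow_neg)
    then obtain z where z: "z \<in> centre G" "z [^] int m = inv b"
      using root[OF m(2) a(1)] subgroup.m_inv_closed[OF centre_subgroup b] by auto
    have "z \<in> carrier G" "b \<in> carrier G" using z b by (auto simp: centre_def)
    then have "z [^] n = b" using z(2) by (simp add: m(1) int_pow_neg)
    then show ?thesis using z(1) by blast
  qed
next
  fix n :: int and b assume "\<exists>c\<in>centre G. c [^] n = b"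
  then show "\<exists>a\<in>carrier G. a [^] n = b" by (auto simp: centre_def)
qed

section \<open>Finite systems of equations\<close>

text \<open>Serves to write one word in the unknowns of each copy of the generators.\<close>

primrec rename_letter :: "(nat \<Rightarrow> nat) \<Rightarrow> 'a letter \<Rightarrow> 'a letter" where
  "rename_letter \<rho> (Coeff a) = Coeff a"
| "rename_letter \<rho> (Var i) = Var (\<rho> i)"
| "rename_letter \<rho> (InvVar i) = InvVar (\<rho> i)"

lemma word_val_rename: "word_val G x (map (rename_letter \<rho>) w) = word_val G (\<lambda>i. x (\<rho> i)) w"
proof (induction w)
  case (Cons l w)
  then show ?case by (cases l) auto
qed simp

lemma rename_letter_words:
  "w \<in> words A r \<Longrightarrow> (\<And>i. i < r \<Longrightarrow> \<rho> i < n) \<Longrightarrow> map (rename_letter \<rho>) w \<in> words A n"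
  by (induction w) (auto simp: words_def letters_def)

lemma map_letter_rename: "map_letter f (rename_letter \<rho> l) = rename_letter \<rho> (map_letter f l)"
  by (cases l) auto

lemma words_mono: "A \<subseteq> B \<Longrightarrow> words A r \<subseteq> words B r"
  unfolding words_def letters_def by (intro lists_mono Un_mono image_mono order_refl)

lemma concat_words: "(\<And>w. w \<in> set ws \<Longrightarrow> w \<in> words A r) \<Longrightarrow> concat ws \<in> words A r"
  by (induction ws) (auto simp: words_def)

lemma word_val_concat:
  assumes "group G" "A \<subseteq> carrier G" "x \<in> {..<r} \<rightarrow> carrier G" "\<And>i. i < k \<Longrightarrow> W i \<in> words A r"
  shows "word_val G x (concat (map W [0..<k])) = mprod G (\<lambda>i. word_val G x (W i)) k"
  using assms(4)
proof (induction k)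
  case (Suc k)
  have "concat (map W [0..<k]) \<in> words A r" by (rule concat_words) (use Suc.prems in auto)
  then show ?case
    using Suc group.is_monoid[OF assms(1)] word_val_closed[OF assms(1,2,3), of "W k"]
    by (simp add: word_val_append[OF assms(1,2,3)])
qed simp

lemma word_val_replicate:
  assumes "group G" "A \<subseteq> carrier G" "x \<in> {..<r} \<rightarrow> carrier G" "w \<in> words A r"
  shows "word_val G x (concat (replicate m w)) = word_val G x w [^]\<^bsub>G\<^esub> m"
proof -
  interpret group G by fact
  have w: "word_val G x w \<in> carrier G" by (rule word_val_closed[OF assms])
  show ?thesis
  proof (induction m)
    case (Suc m)
    have "concat (replicate m w) \<in> words A r" by (rule concat_words) (use assms(4) in auto)
    then show ?case using Suc w nat_pow_Suc2[OF w, of m]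
      by (simp add: word_val_append[OF assms])
  qed simp
qed

text \<open>Coefficients and solution are pulled back along the embedding, so that systems can be
  stated in \<open>H\<close> itself.\<close>

lemma strongly_verbally_closed_solve:
  fixes H :: "('a, 'b) monoid_scheme" and G :: "('c, 'd) monoid_scheme"
  assumes svc: "strongly_verbally_closed H" and G: "group G" and f: "f \<in> mon H G"
    and vc: "verbally_closed_subgroup (f ` carrier H) G"
    and W: "finite W" "W \<subseteq> words (carrier H) n"
    and x: "x \<in> {..<n} \<rightarrow> carrier G"
    and sol: "\<And>w. w \<in> W \<Longrightarrow> word_val G x (map (map_letter f) w) = \<one>\<^bsub>G\<^esub>"
  shows "\<exists>y \<in> {..<n} \<rightarrow> carrier H. \<forall>w\<in>W. word_val H y w = \<one>\<^bsub>H\<^esub>"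
proof -
  have H: "group H" using svc by (simp add: strongly_verbally_closed_def)
  have f_hom: "group_hom H G f"
    using H G f by (simp add: group_hom_def group_hom_axioms_def mon_def)
  interpret f: group_hom H G f by (rule f_hom)
  define S where "S = map (map_letter f) ` W"
  have S: "finite S" "S \<subseteq> words (f ` carrier H) n"
    using W map_letter_words[of _ "carrier H" n f "f ` carrier H"] by (auto simp: S_def)
  have ac: "algebraically_closed_subgroup (f ` carrier H) G"
    by (rule strongly_verbally_closedD[OF svc G f vc])
  have "\<exists>x \<in> {..<n} \<rightarrow> carrier G. \<forall>w\<in>S. word_val G x w = \<one>\<^bsub>G\<^esub>"
    using x sol by (intro bexI[of _ x]) (auto simp: S_def)
  then have "\<exists>y \<in> {..<n} \<rightarrow> f ` carrier H. \<forall>w\<in>S. word_val G y w = \<one>\<^bsub>G\<^esub>"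
    using ac[unfolded algebraically_closed_subgroup_def, THEN conjunct2, rule_format, OF conjI[OF S]]
    by (rule iffD1[rotated])
  then obtain y where y: "y \<in> {..<n} \<rightarrow> f ` carrier H" "\<forall>w\<in>S. word_val G y w = \<one>\<^bsub>G\<^esub>"
    by (rule bexE)
  have "\<forall>i\<in>{..<n}. \<exists>h\<in>carrier H. y i = f h" using y(1) by blast
  then obtain y' where y': "\<And>i. i \<in> {..<n} \<Longrightarrow> y' i \<in> carrier H" "\<And>i. i \<in> {..<n} \<Longrightarrow> y i = f (y' i)"
    by metis
  have y'H: "y' \<in> {..<n} \<rightarrow> carrier H" using y'(1) by blast
  have "word_val H y' w = \<one>\<^bsub>H\<^esub>" if w: "w \<in> W" for w
  proof -
    have wH: "w \<in> words (carrier H) n" using W(2) w by blast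
    have wS: "map (map_letter f) w \<in> S" using w by (simp add: S_def)
    have "f (word_val H y' w) = word_val G (\<lambda>i. f (y' i)) (map (map_letter f) w)"
      by (rule word_val_hom_full[OF f_hom order_refl y'H wH, symmetric])
    also have "\<dots> = word_val G y (map (map_letter f) w)"
      by (rule word_val_cong[OF subsetD[OF S(2) wS]]) (simp add: y'(2))
    also have "\<dots> = \<one>\<^bsub>G\<^esub>" using y(2) wS by blast
    finally have "f (word_val H y' w) = f \<one>\<^bsub>H\<^esub>" by simp
    moreover have "word_val H y' w \<in> carrier H" by (rule word_val_closed[OF H order_refl y'H wH])
    ultimately show ?thesis using f inj_onD[of f "carrier H" "word_val H y' w" "\<one>\<^bsub>H\<^esub>"]
      by (simp add: mon_def)
  qed
  then show ?thesis using y'H by (intro bexI[of _ y']) auto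
qed

text \<open>The left side is what \<open>word_val\<close> unfolds to on a four-letter commutator
  word.\<close>

lemma (in group) commutator_word_val:
  assumes "x \<in> carrier G" "y \<in> carrier G"
  shows "x \<otimes> (y \<otimes> (inv x \<otimes> (inv y \<otimes> \<one>))) = \<one> \<longleftrightarrow> x \<otimes> y = y \<otimes> x"
proof -
  have "x \<otimes> (y \<otimes> (inv x \<otimes> (inv y \<otimes> \<one>))) = (x \<otimes> y) \<otimes> inv (y \<otimes> x)"
    using assms by (simp add: inv_mult_group m_assoc)
  then show ?thesis using assms by (simp add: inv_solve_right')
qed

text \<open>With b the inverse of a generator, the equation prescribes that generator as the product
  of k unknowns.\<close>

definition product_word :: "(nat \<Rightarrow> nat) \<Rightarrow> nat \<Rightarrow> 'a \<Rightarrow> 'a letter list" where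
  "product_word v k b = concat (map (\<lambda>i. [Var (v i)]) [0..<k]) @ [Coeff b]"

text \<open>The word \<Prod> u_i^(m i) * y^q, where u_i is u written in the unknowns of copy
  i.\<close>

definition relation_word ::
    "(nat \<Rightarrow> nat \<Rightarrow> nat) \<Rightarrow> (nat \<Rightarrow> nat) \<Rightarrow> nat \<Rightarrow> nat \<Rightarrow> nat \<Rightarrow> 'a letter list \<Rightarrow> 'a letter list" where
  "relation_word v m k y q u =
     concat (map (\<lambda>i. concat (replicate (m i) (map (rename_letter (v i)) u))) [0..<k]) @
     concat (replicate q [Var y])"

lemma product_word_words:
  "(\<And>i. i < k \<Longrightarrow> v i < n) \<Longrightarrow> b \<in> A \<Longrightarrow> product_word v k b \<in> words A n"
  unfolding product_word_def words_def letters_def by (induction k) auto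

lemma map_letter_product_word: "map (map_letter f) (product_word v k b) = product_word v k (f b)"
  by (simp add: product_word_def map_concat comp_def)

lemma word_val_product_word:
  assumes K: "group K" and x: "x \<in> {..<n} \<rightarrow> carrier K" and v: "\<And>i. i < k \<Longrightarrow> v i < n"
    and b: "b \<in> carrier K"
  shows "word_val K x (product_word v k b) = mprod K (\<lambda>i. x (v i)) k \<otimes>\<^bsub>K\<^esub> b"
proof -
  interpret group K by fact
  have letter: "[Var (v i)] \<in> words (carrier K) n" if "i < k" for i
    using v[OF that] by (simp add: words_def letters_def)
  then have words: "concat (map (\<lambda>i. [Var (v i)]) [0..<k]) \<in> words (carrier K) n"
    by (intro concat_words) auto
  have "[Coeff b] \<in> words (carrier K) n" using b by (simp add: words_def letters_def)
  from word_val_append[OF K order_refl x words this]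
  have "word_val K x (product_word v k b)
      = mprod K (\<lambda>i. word_val K x [Var (v i)]) k \<otimes>\<^bsub>K\<^esub> word_val K x [Coeff b]"
    using word_val_concat[OF K order_refl x letter] by (simp only: product_word_def)
  moreover have "mprod K (\<lambda>i. word_val K x [Var (v i)]) k = mprod K (\<lambda>i. x (v i)) k"
    by (rule mprod_cong) (use x v in \<open>auto simp: Pi_iff\<close>)
  ultimately show ?thesis using b by simp
qed

lemma relation_word_words:
  assumes "u \<in> words {} d" "\<And>i s. i < k \<Longrightarrow> s < d \<Longrightarrow> v i s < n" "y < n"
  shows "relation_word v m k y q u \<in> words {} n"
proof -
  have "concat (replicate (m i) (map (rename_letter (v i)) u)) \<in> words {} n" if "i < k" for i
    by (rule concat_words) (use rename_letter_words[OF assms(1)] assms(2)[OF that] in auto)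
  then have "concat (map (\<lambda>i. concat (replicate (m i) (map (rename_letter (v i)) u))) [0..<k]) \<in> words {} n"
    by (intro concat_words) auto
  moreover have "concat (replicate q [Var y]) \<in> words {} n"
    by (rule concat_words) (use assms(3) in \<open>auto simp: words_def letters_def\<close>)
  ultimately show ?thesis by (simp add: relation_word_def words_def)
qed

lemma map_letter_relation_word:
  "map (map_letter f) (relation_word v m k y q u) = relation_word v m k y q (map (map_letter f) u)"
  by (simp add: relation_word_def map_concat comp_def map_letter_rename)

lemma word_val_relation_word:
  assumes K: "group K" and x: "x \<in> {..<n} \<rightarrow> carrier K" and u: "u \<in> words {} d"
    and v: "\<And>i s. i < k \<Longrightarrow> s < d \<Longrightarrow> v i s < n" and y: "y < n"
  shows "word_val K x (relation_word v m k y q u) =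
    mprod K (\<lambda>i. word_val K (\<lambda>s. x (v i s)) u [^]\<^bsub>K\<^esub> m i) k \<otimes>\<^bsub>K\<^esub> x y [^]\<^bsub>K\<^esub> q"
proof -
  interpret group K by fact
  have ren: "map (rename_letter (v i)) u \<in> words {} n" if "i < k" for i
    by (rule rename_letter_words[OF u v[OF that]])
  have pow: "concat (replicate (m i) (map (rename_letter (v i)) u)) \<in> words {} n" if "i < k" for i
    by (rule concat_words) (use ren[OF that] in auto)
  then have words1: "concat (map (\<lambda>i. concat (replicate (m i) (map (rename_letter (v i)) u))) [0..<k]) \<in> words {} n"
    by (intro concat_words) auto
  have Y: "[Var y] \<in> words {} n" using y by (simp add: words_def letters_def)
  have words2: "concat (replicate q [Var y]) \<in> words {} n"
    by (rule concat_words) (use Y in auto)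
  have "word_val K x (concat (map (\<lambda>i. concat (replicate (m i) (map (rename_letter (v i)) u))) [0..<k]))
      = mprod K (\<lambda>i. word_val K x (concat (replicate (m i) (map (rename_letter (v i)) u)))) k"
    by (rule word_val_concat[OF K empty_subsetI x pow])
  also have "\<dots> = mprod K (\<lambda>i. word_val K (\<lambda>s. x (v i s)) u [^]\<^bsub>K\<^esub> m i) k"
    by (rule mprod_cong) (simp add: word_val_replicate[OF K empty_subsetI x ren] word_val_rename)
  finally have "word_val K x (relation_word v m k y q u)
      = mprod K (\<lambda>i. word_val K (\<lambda>s. x (v i s)) u [^]\<^bsub>K\<^esub> m i) k \<otimes>\<^bsub>K\<^esub> word_val K x (concat (replicate q [Var y]))"
    unfolding relation_word_def word_val_append[OF K empty_subsetI x words1 words2] by simp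
  moreover have "x y \<in> carrier K" using x y by blast
  ultimately show ?thesis using word_val_replicate[OF K empty_subsetI x Y] by simp
qed

text \<open>
  In the extension of \<open>ex_verbally_closed_extension\<close>, the role of \<open>z i s\<close> is played by the generator
  \<open>\<iota> i (g s)\<close> of the \<open>i\<close>-th copy of \<open>H\<close>, and that of \<open>\<eta> t\<close> by \<open>\<upsilon> t\<close>.  Since \<open>H\<close> is finitely
  generated, the conditions form a finite system of equations in the unknowns \<open>z i s\<close>
  (encoded as \<open>prod_encode (i, s)\<close>) and \<open>\<eta> t\<close> (encoded as \<open>prod_encode (k + t, 0)\<close>).
\<close>

lemma strongly_verbally_closed_decomposition:
  fixes H :: "('a, 'b) monoid_scheme" and q k r d :: nat and \<epsilon> :: "nat \<Rightarrow> nat \<Rightarrow> nat"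
  assumes svc: "strongly_verbally_closed H"
    and g: "g \<in> {..<d} \<rightarrow> carrier H" and u: "u \<in> words {} d"
    and c: "word_val H g u [^]\<^bsub>H\<^esub> q \<in> centre H" and q: "q > 0" and k: "k > 0"
    and code: "\<And>b :: nat \<Rightarrow> int. \<exists>i<k. int q dvd (\<Sum>t<r. b t * int (\<epsilon> t i))"
  shows "\<exists>z \<eta>. (\<forall>i<k. \<forall>s<d. z i s \<in> carrier H) \<and>
    (\<forall>i<k. \<forall>j<k. i \<noteq> j \<longrightarrow> (\<forall>s<d. \<forall>s'<d. z i s \<otimes>\<^bsub>H\<^esub> z j s' = z j s' \<otimes>\<^bsub>H\<^esub> z i s)) \<and>
    (\<forall>s<d. mprod H (\<lambda>i. z i s) k = g s) \<and>
    (\<forall>t<r. \<eta> t \<in> carrier H \<and> (\<forall>s<d. \<eta> t \<otimes>\<^bsub>H\<^esub> g s = g s \<otimes>\<^bsub>H\<^esub> \<eta> t)) \<and>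
    (\<forall>t<r. mprod H (\<lambda>i. word_val H (z i) u [^]\<^bsub>H\<^esub> (\<epsilon> t i * q)) k \<otimes>\<^bsub>H\<^esub> \<eta> t [^]\<^bsub>H\<^esub> q = \<one>\<^bsub>H\<^esub>)"
proof -
  have H: "group H" using svc by (simp add: strongly_verbally_closed_def)
  interpret H: group H by fact
  obtain G :: "((nat \<Rightarrow> 'a) \<times> (nat \<Rightarrow> int)) set monoid" and f \<iota> \<upsilon>
    where ext: "group G \<and> f \<in> mon H G \<and> verbally_closed_subgroup (f ` carrier H) G \<and>
    (\<forall>i<k. \<iota> i \<in> hom H G) \<and>
    (\<forall>i<k. \<forall>j<k. i \<noteq> j \<longrightarrow> (\<forall>a\<in>carrier H. \<forall>b\<in>carrier H. \<iota> i a \<otimes>\<^bsub>G\<^esub> \<iota> j b = \<iota> j b \<otimes>\<^bsub>G\<^esub> \<iota> i a)) \<and>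
    (\<forall>h\<in>carrier H. mprod G (\<lambda>i. \<iota> i h) k = f h) \<and>
    (\<forall>t<r. \<upsilon> t \<in> centre G \<and> mprod G (\<lambda>i. \<iota> i ((word_val H g u [^]\<^bsub>H\<^esub> q) [^]\<^bsub>H\<^esub> \<epsilon> t i)) k \<otimes>\<^bsub>G\<^esub> \<upsilon> t [^]\<^bsub>G\<^esub> q = \<one>\<^bsub>G\<^esub>)"
    using ex_verbally_closed_extension[OF H c q k code] by (elim exE)
  then have G: "group G" and f: "f \<in> mon H G" and vc: "verbally_closed_subgroup (f ` carrier H) G"
    by blast+
  interpret G: group G by fact
  have \<iota>: "group_hom H G (\<iota> i)" if "i < k" for i
    using ext that H G by (simp add: group_hom_def group_hom_axioms_def)
  have \<iota>_cl: "\<iota> i h \<in> carrier G" if "i < k" "h \<in> carrier H" for i h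
    using group_hom.hom_closed[OF \<iota>[OF that(1)] that(2)] .
  have \<iota>_comm: "\<iota> i a \<otimes>\<^bsub>G\<^esub> \<iota> j b = \<iota> j b \<otimes>\<^bsub>G\<^esub> \<iota> i a"
    if "i < k" "j < k" "i \<noteq> j" "a \<in> carrier H" "b \<in> carrier H" for i j a b
    using ext that by blast
  have \<iota>_mprod: "mprod G (\<lambda>i. \<iota> i h) k = f h" if "h \<in> carrier H" for h
    using ext that by blast
  have \<upsilon>: "\<upsilon> t \<in> centre G" if "t < r" for t using ext that by blast
  have rel: "mprod G (\<lambda>i. \<iota> i ((word_val H g u [^]\<^bsub>H\<^esub> q) [^]\<^bsub>H\<^esub> \<epsilon> t i)) k \<otimes>\<^bsub>G\<^esub> \<upsilon> t [^]\<^bsub>G\<^esub> q = \<one>\<^bsub>G\<^esub>"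
    if "t < r" for t using ext that by blast
  have f_hom: "group_hom H G f"
    using H G f by (simp add: group_hom_def group_hom_axioms_def mon_def)
  interpret f: group_hom H G f by (rule f_hom)
  have gH: "g s \<in> carrier H" if "s < d" for s using g that by blast

  \<comment> \<open>First components below k are copies of generators and those from k on are
    central unknowns, so the codes do not collide; n bounds them all.\<close>
  define V where "V i s = prod_encode (i, s)" for i s :: nat
  define Y where "Y t = prod_encode (k + t, 0)" for t :: nat
  have "finite ((\<lambda>(i, s). V i s) ` ({..<k} \<times> {..<d}) \<union> Y ` {..<r})" by simp
  then obtain n where n: "\<forall>v \<in> (\<lambda>(i, s). V i s) ` ({..<k} \<times> {..<d}) \<union> Y ` {..<r}. v < n"
    unfolding finite_nat_set_iff_bounded by (elim exE)
  have Vn: "V i s < n" if "i < k" "s < d" for i s using n that by auto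
  have Yn: "Y t < n" if "t < r" for t using n that by auto

  define com :: "nat \<Rightarrow> nat \<Rightarrow> 'a letter list" where "com v v' = [Var v, Var v', InvVar v, InvVar v']" for v v'
  define pro where "pro s = product_word (\<lambda>i. V i s) k (inv\<^bsub>H\<^esub> g s)" for s
  \<comment> \<open>Centrality would take one equation for every element of \<open>H\<close>;
    commuting with the generators takes finitely many.\<close>
  define cen where "cen t s = [Var (Y t), Coeff (g s), InvVar (Y t), Coeff (inv\<^bsub>H\<^esub> g s)]" for t s
  \<comment> \<open>Copy i of c is the q-th power of copy i of its root, hence the exponent
    \<open>\<epsilon> t i * q\<close>.\<close>
  define re where "re t = relation_word V (\<lambda>i. \<epsilon> t i * q) k (Y t) q u" for t
  define C where "C = {(i, j, s, s'). i < k \<and> j < k \<and> i \<noteq> j \<and> s < d \<and> s' < d}"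
  define W where "W = (\<lambda>(i, j, s, s'). com (V i s) (V j s')) ` C
     \<union> pro ` {..<d} \<union> (\<lambda>(t, s). cen t s) ` ({..<r} \<times> {..<d}) \<union> re ` {..<r}"
  have com_words: "com v v' \<in> words (carrier H) n" if "v < n" "v' < n" for v v'
    using that by (simp add: com_def words_def letters_def)
  have pro_words: "pro s \<in> words (carrier H) n" if "s < d" for s
    unfolding pro_def by (rule product_word_words) (use Vn that gH in auto)
  have cen_words: "cen t s \<in> words (carrier H) n" if "t < r" "s < d" for t s
    using Yn[OF that(1)] gH[OF that(2)] by (simp add: cen_def words_def letters_def)
  have re_words: "re t \<in> words (carrier H) n" if "t < r" for t
    unfolding re_def
    by (rule subsetD[OF words_mono[OF empty_subsetI] relation_word_words[OF u _ Yn[OF that]]]) (rule Vn)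
  have W_words: "W \<subseteq> words (carrier H) n"
    unfolding W_def C_def using com_words[OF Vn Vn] pro_words cen_words re_words by auto
  have "finite C" unfolding C_def
    by (rule finite_subset[of _ "{..<k} \<times> {..<k} \<times> {..<d} \<times> {..<d}"]) auto
  then have W_fin: "finite W" unfolding W_def by simp

  \<comment> \<open>Only the values at \<open>V i s\<close> and \<open>Y t\<close> matter; elsewhere
    any element of \<open>G\<close> would serve.\<close>
  define x where "x v = (case prod_decode v of (i, s) \<Rightarrow> if i < k then if s < d then \<iota> i (g s) else \<one>\<^bsub>G\<^esub>
    else if i - k < r then \<upsilon> (i - k) else \<one>\<^bsub>G\<^esub>)" for v
  have xV: "x (V i s) = \<iota> i (g s)" if "i < k" "s < d" for i s using that by (simp add: x_def V_def)
  have xY: "x (Y t) = \<upsilon> t" if "t < r" for t using that by (simp add: x_def Y_def)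
  have \<upsilon>G: "\<upsilon> t \<in> carrier G" if "t < r" for t using \<upsilon>[OF that] by (simp add: centre_def)
  have x: "x \<in> {..<n} \<rightarrow> carrier G"
    using \<iota>_cl[OF _ gH] \<upsilon>G by (auto simp: x_def split: prod.split)
  have x_com: "word_val G x (map (map_letter f) (com (V i s) (V j s'))) = \<one>\<^bsub>G\<^esub>"
    if "i < k" "j < k" "i \<noteq> j" "s < d" "s' < d" for i j s s'
    using G.commutator_word_val[of "\<iota> i (g s)" "\<iota> j (g s')"] \<iota>_comm[OF that(1-3) gH gH] \<iota>_cl[OF _ gH] that
    by (simp add: com_def xV)
  have x_pro: "word_val G x (map (map_letter f) (pro s)) = \<one>\<^bsub>G\<^esub>" if s: "s < d" for s
  proof -
    have "word_val G x (map (map_letter f) (pro s)) = mprod G (\<lambda>i. x (V i s)) k \<otimes>\<^bsub>G\<^esub> f (inv\<^bsub>H\<^esub> g s)"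
      unfolding pro_def map_letter_product_word
      by (rule word_val_product_word[OF G x]) (use Vn s gH in auto)
    also have "mprod G (\<lambda>i. x (V i s)) k = mprod G (\<lambda>i. \<iota> i (g s)) k"
      by (rule mprod_cong) (simp add: xV s)
    also have "\<dots> = f (g s)" by (rule \<iota>_mprod[OF gH[OF s]])
    finally show ?thesis using gH[OF s] by simp
  qed
  have x_cen: "word_val G x (map (map_letter f) (cen t s)) = \<one>\<^bsub>G\<^esub>" if "t < r" "s < d" for t s
    using G.commutator_word_val[of "\<upsilon> t" "f (g s)"] G.centre_commute[OF \<upsilon>[OF that(1)], of "f (g s)"]
      gH[OF that(2)] \<upsilon>G[OF that(1)] that
    by (simp add: cen_def xY)
  have x_re: "word_val G x (map (map_letter f) (re t)) = \<one>\<^bsub>G\<^esub>" if t: "t < r" for t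
  proof -
    have uG: "map (map_letter f) u \<in> words {} d" by (rule map_letter_free[OF u])
    have "word_val G x (map (map_letter f) (re t)) =
      mprod G (\<lambda>i. word_val G (\<lambda>s. x (V i s)) (map (map_letter f) u) [^]\<^bsub>G\<^esub> (\<epsilon> t i * q)) k
        \<otimes>\<^bsub>G\<^esub> x (Y t) [^]\<^bsub>G\<^esub> q"
      unfolding re_def map_letter_relation_word
      by (rule word_val_relation_word[OF G x uG _ Yn[OF t]]) (rule Vn)
    also have "mprod G (\<lambda>i. word_val G (\<lambda>s. x (V i s)) (map (map_letter f) u) [^]\<^bsub>G\<^esub> (\<epsilon> t i * q)) k
      = mprod G (\<lambda>i. \<iota> i ((word_val H g u [^]\<^bsub>H\<^esub> q) [^]\<^bsub>H\<^esub> \<epsilon> t i)) k"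
    proof (rule mprod_cong)
      fix i assume i: "i < k"
      have a: "word_val H g u \<in> carrier H" by (rule word_val_closed[OF H empty_subsetI g u])
      have "word_val G (\<lambda>s. x (V i s)) (map (map_letter f) u) = word_val G (\<lambda>s. \<iota> i (g s)) (map (map_letter f) u)"
        by (rule word_val_cong[OF uG]) (simp add: xV i)
      also have "\<dots> = \<iota> i (word_val H g u)" by (rule word_val_free_hom[OF \<iota>[OF i] g u])
      finally show "word_val G (\<lambda>s. x (V i s)) (map (map_letter f) u) [^]\<^bsub>G\<^esub> (\<epsilon> t i * q)
          = \<iota> i ((word_val H g u [^]\<^bsub>H\<^esub> q) [^]\<^bsub>H\<^esub> \<epsilon> t i)"
        using a by (simp add: H.nat_pow_pow group_hom.hom_nat_pow[OF \<iota>[OF i]] mult.commute)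
    qed
    finally show ?thesis using rel[OF t] by (simp add: xY t)
  qed
  have "word_val G x (map (map_letter f) w) = \<one>\<^bsub>G\<^esub>" if "w \<in> W" for w
    using that x_com x_pro x_cen x_re unfolding W_def C_def by auto
  from strongly_verbally_closed_solve[OF svc G f vc W_fin W_words x this]
  obtain y where y: "y \<in> {..<n} \<rightarrow> carrier H" "\<And>w. w \<in> W \<Longrightarrow> word_val H y w = \<one>\<^bsub>H\<^esub>" by blast
  have yV: "y (V i s) \<in> carrier H" if "i < k" "s < d" for i s using y(1) Vn[OF that] by blast
  have yY: "y (Y t) \<in> carrier H" if "t < r" for t using y(1) Yn[OF that] by blast
  have 1: "y (V i s) \<otimes>\<^bsub>H\<^esub> y (V j s') = y (V j s') \<otimes>\<^bsub>H\<^esub> y (V i s)"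
    if ij: "i < k" "j < k" "i \<noteq> j" "s < d" "s' < d" for i j s s'
  proof -
    have "(i, j, s, s') \<in> C" using ij by (simp add: C_def)
    then have "com (V i s) (V j s') \<in> W" unfolding W_def by force
    then show ?thesis
      using y(2)[of "com (V i s) (V j s')"] H.commutator_word_val[OF yV[OF ij(1,4)] yV[OF ij(2,5)]]
      by (simp add: com_def)
  qed
  have 2: "mprod H (\<lambda>i. y (V i s)) k = g s" if s: "s < d" for s
  proof -
    have "pro s \<in> W" unfolding W_def using s by auto
    then have "\<one>\<^bsub>H\<^esub> = word_val H y (pro s)" using y(2) by simp
    also have "\<dots> = mprod H (\<lambda>i. y (V i s)) k \<otimes>\<^bsub>H\<^esub> inv\<^bsub>H\<^esub> g s"
      unfolding pro_def by (rule word_val_product_word[OF H y(1)]) (use Vn s gH in auto)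
    finally show ?thesis using gH[OF s] H.mprod_closed[of k "\<lambda>i. y (V i s)"] yV[OF _ s]
      by (simp add: H.inv_solve_right)
  qed
  have 3: "y (Y t) \<otimes>\<^bsub>H\<^esub> g s = g s \<otimes>\<^bsub>H\<^esub> y (Y t)" if ts: "t < r" "s < d" for t s
  proof -
    have "cen t s \<in> W" unfolding W_def using ts by force
    then show ?thesis
      using y(2)[of "cen t s"] H.commutator_word_val[OF yY[OF ts(1)] gH[OF ts(2)]]
      by (simp add: cen_def)
  qed
  have 4: "mprod H (\<lambda>i. word_val H (\<lambda>s. y (V i s)) u [^]\<^bsub>H\<^esub> (\<epsilon> t i * q)) k \<otimes>\<^bsub>H\<^esub> y (Y t) [^]\<^bsub>H\<^esub> q = \<one>\<^bsub>H\<^esub>"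
    if t: "t < r" for t
  proof -
    have "re t \<in> W" unfolding W_def using t by auto
    then have "word_val H y (re t) = \<one>\<^bsub>H\<^esub>" by (rule y(2))
    moreover have "word_val H y (re t) =
        mprod H (\<lambda>i. word_val H (\<lambda>s. y (V i s)) u [^]\<^bsub>H\<^esub> (\<epsilon> t i * q)) k \<otimes>\<^bsub>H\<^esub> y (Y t) [^]\<^bsub>H\<^esub> q"
      unfolding re_def by (rule word_val_relation_word[OF H y(1) u _ Yn[OF t]]) (rule Vn)
    ultimately show ?thesis by simp
  qed
  show ?thesis
    by (rule exI[of _ "\<lambda>i s. y (V i s)"], rule exI[of _ "\<lambda>t. y (Y t)"],
        intro conjI allI impI yV yY 1 2 3 4)
qed

section \<open>Purity of the centre\<close>

theorem corollary1:
  fixes H :: "('a, 'b) monoid_scheme"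
  assumes "group H" and "finitely_generated H" and "strongly_verbally_closed H"
  shows "(max_condition_direct_factors (H Mod centre H) \<or>
            finite_product_of_indecomposables (H Mod centre H) \<longrightarrow>
          pure_subgroup (centre H) H) \<and>
         (solvable H \<longrightarrow> pure_subgroup (centre H) H)"
proof -
  interpret H: group H by fact
  \<comment> \<open>The three alternatives enter only through the bound l, so one argument covers
    both conjuncts.\<close>
  have pure: "pure_subgroup (centre H) H"
    if *: "max_condition_direct_factors (H Mod centre H) \<or>
      finite_product_of_indecomposables (H Mod centre H) \<or> solvable H"
  proof -
    obtain l :: nat where l: "\<forall>(k :: nat) A. (\<forall>i<k. subgroup (A i) H) \<longrightarrow>
      (\<forall>i<k. \<forall>j<k. i \<noteq> j \<longrightarrow> (\<forall>a\<in>A i. \<forall>b\<in>A j. a \<otimes>\<^bsub>H\<^esub> b = b \<otimes>\<^bsub>H\<^esub> a)) \<longrightarrow>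
      generate H (\<Union>i<k. A i) = carrier H \<longrightarrow> card {i. i < k \<and> \<not> A i \<subseteq> centre H} \<le> l"
      using H.bounded_noncentral_commuting_subgroups[OF H.bounded_factors_Mod_centre[OF assms(2) *]]
      by (elim exE)
    obtain S where S: "finite S" "S \<subseteq> carrier H" "generate H S = carrier H"
      using assms(2) by (auto simp: finitely_generated_def)
    obtain d g where g_img: "S = g ` {i :: nat. i < d}"
      using S(1) finite_imp_nat_seg_image_inj_on by blast
    then have Sg: "S = g ` {..<d}" by (simp add: lessThan_def)
    have g: "g \<in> {..<d} \<rightarrow> carrier H" using S(2) Sg by blast
    have prime_power: "\<exists>\<zeta>\<in>centre H. \<zeta> [^]\<^bsub>H\<^esub> int (p ^ e) = a [^]\<^bsub>H\<^esub> int (p ^ e)"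
      if p: "Factorial_Ring.prime p" and a: "a \<in> carrier H" "a [^]\<^bsub>H\<^esub> int (p ^ e) \<in> centre H"
      for p e :: nat and a
    proof -
      define q where "q = p ^ e"
      have q: "q > 0" using p by (simp add: q_def prime_gt_0_nat)
      obtain u where u: "u \<in> words {} d" "word_val H g u = a"
        using H.ex_word[OF _ g, of a] S(3) Sg a(1) by blast
      \<comment> \<open>The matrix, and with it k, depends on l; this is why l had to be fixed for
        all k beforehand.\<close>
      obtain k r and \<epsilon> :: "nat \<Rightarrow> nat \<Rightarrow> nat" where code: "k > 0 \<and>
        (\<forall>b :: nat \<Rightarrow> int. \<exists>i<k. int (p ^ e) dvd (\<Sum>t<r. b t * int (\<epsilon> t i))) \<and>
        (\<forall>L \<subseteq> {..<k}. card L \<le> l \<longrightarrow> (\<exists>b :: nat \<Rightarrow> int. \<forall>i\<in>L. (\<Sum>t<r. b t * int (\<epsilon> t i)) = 1))"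
        using ex_covering_code[OF p, of e l] by (elim exE)
      have c: "word_val H g u [^]\<^bsub>H\<^esub> q \<in> centre H"
        using a(2) unfolding u(2) q_def[symmetric] int_pow_int .
      have cov: "\<exists>i<k. int q dvd (\<Sum>t<r. b t * int (\<epsilon> t i))" for b
        using code unfolding q_def by blast
      obtain z \<eta> where z\<eta>: "(\<forall>i<k. \<forall>s<d. z i s \<in> carrier H) \<and>
        (\<forall>i<k. \<forall>j<k. i \<noteq> j \<longrightarrow> (\<forall>s<d. \<forall>s'<d. z i s \<otimes>\<^bsub>H\<^esub> z j s' = z j s' \<otimes>\<^bsub>H\<^esub> z i s)) \<and>
        (\<forall>s<d. mprod H (\<lambda>i. z i s) k = g s) \<and>
        (\<forall>t<r. \<eta> t \<in> carrier H \<and> (\<forall>s<d. \<eta> t \<otimes>\<^bsub>H\<^esub> g s = g s \<otimes>\<^bsub>H\<^esub> \<eta> t)) \<and>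
        (\<forall>t<r. mprod H (\<lambda>i. word_val H (z i) u [^]\<^bsub>H\<^esub> (\<epsilon> t i * q)) k \<otimes>\<^bsub>H\<^esub> \<eta> t [^]\<^bsub>H\<^esub> q = \<one>\<^bsub>H\<^esub>)"
        using strongly_verbally_closed_decomposition[OF assms(3) g u(1) c q conjunct1[OF code] cov] by (elim exE)
      have z: "z i s \<in> carrier H" if "i < k" "s < d" for i s using z\<eta> that by blast
      have z_comm: "z i s \<otimes>\<^bsub>H\<^esub> z j s' = z j s' \<otimes>\<^bsub>H\<^esub> z i s"
        if "i < k" "j < k" "i \<noteq> j" "s < d" "s' < d" for i j s s' using z\<eta> that by blast
      have z_mprod: "mprod H (\<lambda>i. z i s) k = g s" if "s < d" for s using z\<eta> that by blast
      have zH: "z i \<in> {..<d} \<rightarrow> carrier H" "z i ` {..<d} \<subseteq> carrier H" if "i < k" for i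
        using z[OF that] by auto
      define A where "A i = generate H (z i ` {..<d})" for i
      have A: "subgroup (A i) H" if "i < k" for i
        unfolding A_def by (rule H.generate_is_subgroup[OF zH(2)[OF that]])
      have A_comm: "x \<otimes>\<^bsub>H\<^esub> y = y \<otimes>\<^bsub>H\<^esub> x" if "i < k" "j < k" "i \<noteq> j" "x \<in> A i" "y \<in> A j" for i j x y
        by (rule H.commute_generate[OF zH(2)[OF that(1)] zH(2)[OF that(2)]])
           (use that z_comm in \<open>auto simp: A_def\<close>)
      have A_sub: "(\<Union>i<k. A i) \<subseteq> carrier H" using A subgroup.subset by blast
      have "S \<subseteq> generate H (\<Union>i<k. A i)"
      proof
        fix h assume "h \<in> S"
        then obtain s where s: "s < d" "h = g s" using Sg by blast
        have "mprod H (\<lambda>i. z i s) k \<in> generate H (\<Union>i<k. A i)"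
        proof (rule H.mprod_in_subgroup[OF H.generate_is_subgroup[OF A_sub]])
          fix i assume "i < k"
          then have "z i s \<in> (\<Union>i<k. A i)" using s(1) unfolding A_def by (auto intro: generate.incl)
          then show "z i s \<in> generate H (\<Union>i<k. A i)" by (rule generate.incl)
        qed
        then show "h \<in> generate H (\<Union>i<k. A i)" using z_mprod s by simp
      qed
      then have "carrier H \<subseteq> generate H (\<Union>i<k. A i)"
        using H.generate_subgroup_incl[OF _ H.generate_is_subgroup[OF A_sub], of S] S(3) by simp
      then have A_gen: "generate H (\<Union>i<k. A i) = carrier H" using H.generate_incl[OF A_sub] by blast
      define L where "L = {i. i < k \<and> \<not> A i \<subseteq> centre H}"
      have "card L \<le> l" unfolding L_def
        using l[THEN spec, of k, THEN spec, of A] A A_comm A_gen by blast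
      moreover have "L \<subseteq> {..<k}" by (auto simp: L_def)
      \<comment> \<open>\<open>L\<close> is known only now that the system has been solved in
        \<open>H\<close>; the code provides a combination for every set of this size.\<close>
      ultimately obtain b :: "nat \<Rightarrow> int" where b: "\<forall>i\<in>L. (\<Sum>t<r. b t * int (\<epsilon> t i)) = 1"
        using code by blast
      define a' where "a' i = word_val H (z i) u" for i
      have a'_A: "a' i \<in> A i" if "i < k" for i
        unfolding a'_def A_def by (rule H.word_val_in_generate[OF zH(1)[OF that] u(1)])
      have "\<exists>\<zeta>\<in>centre H. \<zeta> [^]\<^bsub>H\<^esub> int q = mprod H a' k [^]\<^bsub>H\<^esub> int q"
      proof (rule H.central_root_of_commuting_product)
        show "a' i \<in> carrier H" if "i < k" for i
          using subgroup.mem_carrier[OF A[OF that] a'_A[OF that]] .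
        show "a' i \<otimes>\<^bsub>H\<^esub> a' j = a' j \<otimes>\<^bsub>H\<^esub> a' i" if "i < k" "j < k" "i \<noteq> j" for i j
          by (rule A_comm[OF that a'_A[OF that(1)] a'_A[OF that(2)]])
        show "mprod H (\<lambda>i. a' i [^]\<^bsub>H\<^esub> (\<epsilon> t i * q)) k \<otimes>\<^bsub>H\<^esub> \<eta> t [^]\<^bsub>H\<^esub> q = \<one>\<^bsub>H\<^esub>" if "t < r" for t
          using z\<eta> that unfolding a'_def by blast
        show "(\<Sum>t<r. b t * int (\<epsilon> t i)) = 1" if "i < k" "a' i \<notin> centre H" for i
          using b a'_A[OF that(1)] that by (auto simp: L_def)
        show "\<eta> t \<in> centre H" if t: "t < r" for t
        proof -
          have \<eta>H: "\<eta> t \<in> carrier H" using z\<eta> t by blast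
          \<comment> \<open>Commuting with the generating set \<open>S\<close> implies commuting
            with all of \<open>H\<close>.\<close>
          have "\<eta> t \<otimes>\<^bsub>H\<^esub> h = h \<otimes>\<^bsub>H\<^esub> \<eta> t" if h: "h \<in> carrier H" for h
          proof (rule H.commute_generate[of "{\<eta> t}" S])
            show "\<eta> t \<in> generate H {\<eta> t}" by (rule generate.incl) simp
            show "x \<otimes>\<^bsub>H\<^esub> y = y \<otimes>\<^bsub>H\<^esub> x" if "x \<in> {\<eta> t}" "y \<in> S" for x y
              using that z\<eta> t Sg by blast
          qed (use \<eta>H S h in auto)
          then show ?thesis using \<eta>H by (simp add: centre_def)
        qed
      qed
      moreover have "mprod H a' k = a"
      proof -
        have "mprod H a' k = word_val H (\<lambda>s. mprod H (\<lambda>i. z i s) k) u"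
          unfolding a'_def by (rule H.word_val_mprod[symmetric]) (use z z_comm u(1) in auto)
        also have "\<dots> = word_val H g u" by (rule word_val_cong[OF u(1)]) (rule z_mprod)
        finally show ?thesis using u(2) by simp
      qed
      ultimately show ?thesis by (simp add: q_def)
    qed
    show ?thesis
    proof (rule H.pure_centreI)
      show "\<exists>z\<in>centre H. z [^]\<^bsub>H\<^esub> int n = a [^]\<^bsub>H\<^esub> int n"
        if "n > 0" "a \<in> carrier H" "a [^]\<^bsub>H\<^esub> int n \<in> centre H" for n :: nat and a
        using prime_power that by (rule H.central_root_of_prime_power_roots)
    qed
  qed
  then show ?thesis by blast
qed

end
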